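(* Let $\mathbb X$ be a virtual equipment and let $j\colon A\to E$ be a tight-cell in $\mathbb X$. The commutative square of categories $$\begin{array}{ccc}\mathbf{RMnd}(j)&\hookrightarrow&\mathbf{LRMnd}(j)\\ {\scriptstyle U_j}\downarrow&&\downarrow{\scriptstyle U_j}\\ \mathbb X[A,E]&\hookrightarrow&\mathbb X[[A,E]]\end{array}$$ is a pullback of categories, where $\mathbf{RMnd}(j)$ is the category of $j$-relative monads, $\mathbf{LRMnd}(j)$ is the category of loose $j$-relative monads, the lower functor is the fully faithful functor $t\mapsto E(1,t)$, and the upper functor sends a $j$-relative monad $(t,\dagger,\eta)$ to $(E(1,t),\mu,E(1,\eta))$, with $\mu$ the transpose of $\dagger$.
   Context: Virtual equipments. A virtual double category has objects; a category of tight-cells $f\colon A\to B$ (the composite of $f\colon A\to B$ and $g\colon B\to C$ is $gf$); loose-cells $p\colon A\nrightarrow B$; and 2-cells, each having as frame a chain of loose-cells $p_1\colon A_1\nrightarrow A_0,\dots,p_n\colon A_n\nrightarrow A_{n-1}$ ($n\ge 0$; chains are always listed in this order), a loose-cell $q\colon B_n\nrightarrow B_0$, and tight-cells $f_0\colon A_0\to B_0$ (left) and $f_n\colon A_n\to B_n$ (right); 2-cells have identities and associative unital multicategory-style composition. $\phi\colon p_1,\dots,p_n\Rightarrow q$ denotes a 2-cell whose tight-cells are identities; $(\phi_1,\dots,\phi_n)$ denotes juxtaposition. A 2-cell $q_1,\dots,q_m\Rightarrow q$ is opcartesian if every 2-cell (with any tight-cells) with domain $p_1,\dots,p_l,q_1,\dots,q_m,r_1,\dots,r_n$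 factors uniquely through it; then $q$ is the loose-composite $q_1\odot\cdots\odot q_m$ (the loose-identity $A(1,1)\colon A\nrightarrow A$ if $m=0$). A unary 2-cell from $p$ to $q$ with left $f$ and right $g$ is cartesian if every 2-cell into $q$ with left $ff'$ and right $gg'$ factors uniquely through it via a 2-cell with left $f'$ and right $g'$; then $p$ is the restriction $q(f,g)$. A virtual equipment has all loose-identities and restrictions. Write $E(f,g):=E(1,1)(f,g)$; for $f\colon D\to E$, $g\colon A\to E$ it is a loose-cell $A\nrightarrow D$. The canonical isomorphisms $q(f,g)\cong C(f,1)\odot q\odot B(1,g)$ are used implicitly. A 2-cell $f\Rightarrow g$ between tight-cells $A\to B$ is equivalently a 2-cell $B(1,f)\Rightarrow B(1,g)$, or $B(g,1)\Rightarrow B(f,1)$, or $()\Rightarrow B(f,g)$; $\mathbb X[A,B]$ is the category of tight-cells $A\to B$ and such 2-cells, and $\mathbb X[[A,B]]$ is the category of loose-cells $A\nrightarrow B$ and 2-cells $p\Rightarrow q$. Restriction is functorial in 2-cells (contravariantly in the first argument, covariantly in the second). For $f\colon A\to B$, $\frown_f\colon ()\Rightarrow B(f,f)$ (corresponding to $1_f$) and $\smile_f\colon B(1,f),B(f,1)\Rightarrow B(1,1)$ are the canonical 2-cells (unit and counit of the adjunction $B(1,f)\dashv B(f,1)$). $\phi(f,g)$ denotes the 2-cell obtained from $\phi$ by restricting along $f$ on the left and $g$ on the right; e.g. $\smile_t(x,y)\colon E(x,t),E(t,y)\Rightarrow E(x,y)$ is composition. Relative monads. A $j$-relative monad $(t,\dagger,\eta)$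 comprises a tight-cell $t\colon A\to E$, a 2-cell $\dagger\colon E(j,t)\Rightarrow E(t,t)$ and a 2-cell $\eta\colon j\Rightarrow t$ such that: (i) $E(\eta,t)\circ\dagger=1_{E(j,t)}$; (ii) $\dagger\circ E(j,\eta)\circ\frown_j=\frown_t$ as 2-cells $()\Rightarrow E(t,t)$; (iii) the following two 2-cells $E(j,t),E(j,t)\Rightarrow E(t,t)$ are equal: $(\dagger,\dagger)$ followed by $\smile_t(t,t)$; and $(1,\dagger)$ followed by $\smile_t(j,t)\colon E(j,t),E(t,t)\Rightarrow E(j,t)$ followed by $\dagger$. A morphism $(t,\dagger,\eta)\to(t',\dagger',\eta')$ is a 2-cell $\tau\colon t\Rightarrow t'$ with $\tau\circ\eta=\eta'$ and $E(t,\tau)\circ\dagger=E(\tau,t')\circ\dagger'\circ E(j,\tau)$. These form $\mathbf{RMnd}(j)$; $U_j\colon\mathbf{RMnd}(j)\to\mathbb X[A,E]$ sends $(t,\dagger,\eta)$ to $t$. The transpose of $\dagger$ is $\mu\colon E(1,t),E(j,1),E(1,t)\Rightarrow E(1,t)$ given by $(1_{E(1,t)},\dagger)$ followed by $\smile_t(1,t)\colon E(1,t),E(t,t)\Rightarrow E(1,t)$. Loose relative monads. A loose $j$-relative monad comprises a loose-cell $p\colon A\nrightarrow E$, a 2-cell $\mu\colon p,E(j,1),p\Rightarrow p$ and a 2-cell $u\colon E(1,j)\Rightarrow p$ such that: (a) $(u,1,1)$ followed by $\mu$, a 2-cell $E(1,j),E(j,1),p\Rightarrow p$, equals $\smile_j$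 pasted with $1_p$; (b) the 2-cell $p\Rightarrow p$ obtained by pasting $\frown_j\colon()\Rightarrow E(j,1)\odot E(1,j)$ after $p$, then applying $(1_p,1,u)$, then $\mu$, is $1_p$; (c) $\mu\circ(\mu,1,1)=\mu\circ(1,1,\mu)$ as 2-cells $p,E(j,1),p,E(j,1),p\Rightarrow p$. (These are exactly the monoids in the associative-normal left-skew-multicategory of loose-cells $A\nrightarrow E$, whose multimorphisms $p_1,\dots,p_n\to q$ are 2-cells $p_1,E(j,1),p_2,\dots,E(j,1),p_n\Rightarrow q$, with unit $E(1,j)$.) A morphism $(p,\mu,u)\to(p',\mu',u')$ is a 2-cell $\tau\colon p\Rightarrow p'$ with $\tau\circ u=u'$ and $\tau\circ\mu=\mu'\circ(\tau,1,\tau)$. These form $\mathbf{LRMnd}(j)$; $U_j\colon\mathbf{LRMnd}(j)\to\mathbb X[[A,E]]$ sends $(p,\mu,u)$ to $p$. *)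

theory Defs
  imports Main
begin

section \<open>Virtual double categories\<close>

text \<open>
  A loose-cell \<open>p\<close> runs from \<open>lsrc p\<close> to \<open>ltgt p\<close>.  Chains of loose-cells are listed from their
  final target to their initial source, so the \<^emph>\<open>left\<close> end of a loose-cell is its target and the
  \<^emph>\<open>right\<close> end is its source.

  \<open>ccomp X \<psi> h [\<phi>\<^sub>1, \<dots>, \<phi>\<^sub>n]\<close> is the composite of the juxtaposition \<open>(\<phi>\<^sub>1, \<dots>, \<phi>\<^sub>n)\<close> followed by \<open>\<psi>\<close>.
  The tight-cell \<open>h\<close> is the left boundary of the juxtaposition: for \<open>n > 0\<close> it has to be the left
  tight-cell of \<open>\<phi>\<^sub>1\<close>, while for \<open>n = 0\<close> the juxtaposition consists of the tight-cell \<open>h\<close> alone,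
  and \<open>ccomp X \<psi> h []\<close> is the nullary 2-cell \<open>\<psi>\<close> precomposed with \<open>h\<close>.
  Tight-cells compose in the usual order: \<open>tcomp X g f\<close> is \<open>f\<close> followed by \<open>g\<close>.
\<close>

record ('o, 't, 'l, 'c) vdc =
  Ob :: "'o set"
  Tight :: "'t set"
  tdom :: "'t \<Rightarrow> 'o"
  tcod :: "'t \<Rightarrow> 'o"
  tid :: "'o \<Rightarrow> 't"
  tcomp :: "'t \<Rightarrow> 't \<Rightarrow> 't"
  Loose :: "'l set"
  lsrc :: "'l \<Rightarrow> 'o"
  ltgt :: "'l \<Rightarrow> 'o"
  Cell :: "'c set"
  cdom :: "'c \<Rightarrow> 'l list"
  ccod :: "'c \<Rightarrow> 'l"
  cleft :: "'c \<Rightarrow> 't"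
  cright :: "'c \<Rightarrow> 't"
  cid :: "'l \<Rightarrow> 'c"
  ccomp :: "'c \<Rightarrow> 't \<Rightarrow> 'c list \<Rightarrow> 'c"

definition is_tight :: "('o, 't, 'l, 'c, 'z) vdc_scheme \<Rightarrow> 't \<Rightarrow> 'o \<Rightarrow> 'o \<Rightarrow> bool" where
  "is_tight X f A B \<longleftrightarrow> f \<in> Tight X \<and> tdom X f = A \<and> tcod X f = B"

definition is_loose :: "('o, 't, 'l, 'c, 'z) vdc_scheme \<Rightarrow> 'l \<Rightarrow> 'o \<Rightarrow> 'o \<Rightarrow> bool" where
  "is_loose X p A B \<longleftrightarrow> p \<in> Loose X \<and> lsrc X p = A \<and> ltgt X p = B"

definition is_cell ::
  "('o, 't, 'l, 'c, 'z) vdc_scheme \<Rightarrow> 'c \<Rightarrow> 'l list \<Rightarrow> 'l \<Rightarrow> 't \<Rightarrow> 't \<Rightarrow> bool" where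
  "is_cell X \<phi> ps q f g \<longleftrightarrow>
     \<phi> \<in> Cell X \<and> cdom X \<phi> = ps \<and> ccod X \<phi> = q \<and> cleft X \<phi> = f \<and> cright X \<phi> = g"

text \<open>The 2-cells written \<open>\<phi> : p\<^sub>1, \<dots>, p\<^sub>n \<Rightarrow> q\<close>, whose tight-cells are identities.\<close>

definition globular :: "('o, 't, 'l, 'c, 'z) vdc_scheme \<Rightarrow> 'c \<Rightarrow> 'l list \<Rightarrow> 'l \<Rightarrow> bool" where
  "globular X \<phi> ps q \<longleftrightarrow> is_cell X \<phi> ps q (tid X (ltgt X q)) (tid X (lsrc X q))"

fun loose_chain :: "('o, 't, 'l, 'c, 'z) vdc_scheme \<Rightarrow> 'o \<Rightarrow> 'l list \<Rightarrow> 'o \<Rightarrow> bool" where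
  "loose_chain X A [] B \<longleftrightarrow> A \<in> Ob X \<and> A = B"
| "loose_chain X A (p # ps) B \<longleftrightarrow> p \<in> Loose X \<and> ltgt X p = A \<and> loose_chain X (lsrc X p) ps B"

text \<open>
  \<open>juxtaposable X h \<phi>s\<close>: the 2-cells \<open>\<phi>s\<close> can be placed side by side, with left boundary \<open>h\<close>;
  \<open>right_end X h \<phi>s\<close> is then the right boundary of the juxtaposition.
\<close>

fun juxtaposable :: "('o, 't, 'l, 'c, 'z) vdc_scheme \<Rightarrow> 't \<Rightarrow> 'c list \<Rightarrow> bool" where
  "juxtaposable X h [] \<longleftrightarrow> h \<in> Tight X"
| "juxtaposable X h (\<phi> # \<phi>s) \<longleftrightarrow> \<phi> \<in> Cell X \<and> cleft X \<phi> = h \<and> juxtaposable X (cright X \<phi>) \<phi>s"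

definition right_end :: "('o, 't, 'l, 'c, 'z) vdc_scheme \<Rightarrow> 't \<Rightarrow> 'c list \<Rightarrow> 't" where
  "right_end X h \<phi>s = (if \<phi>s = [] then h else cright X (last \<phi>s))"

definition composable :: "('o, 't, 'l, 'c, 'z) vdc_scheme \<Rightarrow> 'c \<Rightarrow> 't \<Rightarrow> 'c list \<Rightarrow> bool" where
  "composable X \<psi> h \<phi>s \<longleftrightarrow>
     \<psi> \<in> Cell X \<and> juxtaposable X h \<phi>s \<and> map (ccod X) \<phi>s = cdom X \<psi> \<and> tcod X h = tdom X (cleft X \<psi>)"

locale virtual_double_category =
  fixes X :: "('o, 't, 'l, 'c, 'z) vdc_scheme"
  assumes tight_ends: "f \<in> Tight X \<Longrightarrow> tdom X f \<in> Ob X \<and> tcod X f \<in> Ob X"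
    and tight_id: "A \<in> Ob X \<Longrightarrow> is_tight X (tid X A) A A"
    and tight_comp: "is_tight X f A B \<Longrightarrow> is_tight X g B C \<Longrightarrow> is_tight X (tcomp X g f) A C"
    and tight_id_left: "is_tight X f A B \<Longrightarrow> tcomp X (tid X B) f = f"
    and tight_id_right: "is_tight X f A B \<Longrightarrow> tcomp X f (tid X A) = f"
    and tight_assoc: "is_tight X f A B \<Longrightarrow> is_tight X g B C \<Longrightarrow> is_tight X h C D \<Longrightarrow>
      tcomp X h (tcomp X g f) = tcomp X (tcomp X h g) f"
    and loose_ends: "p \<in> Loose X \<Longrightarrow> lsrc X p \<in> Ob X \<and> ltgt X p \<in> Ob X"
    and cell_frame: "is_cell X \<phi> ps q f g \<Longrightarrow>
      f \<in> Tight X \<and> g \<in> Tight X \<and>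
      loose_chain X (tdom X f) ps (tdom X g) \<and> is_loose X q (tcod X g) (tcod X f)"
    and cell_id: "p \<in> Loose X \<Longrightarrow> globular X (cid X p) [p] p"
    and cell_comp: "composable X \<psi> h \<phi>s \<Longrightarrow>
      is_cell X (ccomp X \<psi> h \<phi>s) (concat (map (cdom X) \<phi>s)) (ccod X \<psi>)
        (tcomp X (cleft X \<psi>) h) (tcomp X (cright X \<psi>) (right_end X h \<phi>s))"
    and cell_id_left: "\<phi> \<in> Cell X \<Longrightarrow> ccomp X (cid X (ccod X \<phi>)) (cleft X \<phi>) [\<phi>] = \<phi>"
    and cell_id_right: "\<phi> \<in> Cell X \<Longrightarrow>
      ccomp X \<phi> (tid X (tdom X (cleft X \<phi>))) (map (cid X) (cdom X \<phi>)) = \<phi>"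
    and cell_assoc: "composable X \<psi> h \<phi>s \<Longrightarrow> composable X (ccomp X \<psi> h \<phi>s) k (concat \<chi>ss) \<Longrightarrow>
      map (map (ccod X)) \<chi>ss = map (cdom X) \<phi>s \<Longrightarrow>
      ccomp X (ccomp X \<psi> h \<phi>s) k (concat \<chi>ss) =
      ccomp X \<psi> (tcomp X h k)
        (map (\<lambda>i. ccomp X (\<phi>s ! i) (right_end X k (concat (take i \<chi>ss))) (\<chi>ss ! i)) [0..<length \<phi>s])"

text \<open>Composition with a nonempty juxtaposition, whose left boundary need not be given.\<close>

definition cmp :: "('o, 't, 'l, 'c, 'z) vdc_scheme \<Rightarrow> 'c \<Rightarrow> 'c list \<Rightarrow> 'c" where
  "cmp X \<psi> \<phi>s = ccomp X \<psi> (cleft X (hd \<phi>s)) \<phi>s"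


section \<open>Opcartesian and cartesian 2-cells, virtual equipments\<close>

definition opfactor ::
  "('o, 't, 'l, 'c, 'z) vdc_scheme \<Rightarrow> 'l list \<Rightarrow> 'c \<Rightarrow> 'l list \<Rightarrow> 'c \<Rightarrow> 'c \<Rightarrow> bool" where
  "opfactor X ps \<sigma> rs \<phi> \<chi> \<longleftrightarrow>
     is_cell X \<chi> (ps @ [ccod X \<sigma>] @ rs) (ccod X \<phi>) (cleft X \<phi>) (cright X \<phi>) \<and>
     cmp X \<chi> (map (cid X) ps @ [\<sigma>] @ map (cid X) rs) = \<phi>"

text \<open>
  The condition on \<open>ps\<close> only matters for nullary \<open>\<sigma>\<close>, where it says that the split of the domain of
  \<open>\<phi>\<close> takes place at the object on which \<open>\<sigma>\<close> lives.
\<close>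

definition opcartesian :: "('o, 't, 'l, 'c, 'z) vdc_scheme \<Rightarrow> 'c \<Rightarrow> bool" where
  "opcartesian X \<sigma> \<longleftrightarrow>
     globular X \<sigma> (cdom X \<sigma>) (ccod X \<sigma>) \<and>
     (\<forall>ps rs \<phi>. \<phi> \<in> Cell X \<and> cdom X \<phi> = ps @ cdom X \<sigma> @ rs \<and>
        loose_chain X (tdom X (cleft X \<phi>)) ps (ltgt X (ccod X \<sigma>)) \<longrightarrow>
        (\<exists>!\<chi>. opfactor X ps \<sigma> rs \<phi> \<chi>))"

definition factor ::
  "('o, 't, 'l, 'c, 'z) vdc_scheme \<Rightarrow> 'c \<Rightarrow> 't \<Rightarrow> 't \<Rightarrow> 'c \<Rightarrow> 'c \<Rightarrow> bool" where
  "factor X \<kappa> f' g' \<phi> \<chi> \<longleftrightarrow>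
     is_cell X \<chi> (cdom X \<phi>) (hd (cdom X \<kappa>)) f' g' \<and> cmp X \<kappa> [\<chi>] = \<phi>"

definition cartesian :: "('o, 't, 'l, 'c, 'z) vdc_scheme \<Rightarrow> 'c \<Rightarrow> bool" where
  "cartesian X \<kappa> \<longleftrightarrow>
     \<kappa> \<in> Cell X \<and> length (cdom X \<kappa>) = 1 \<and>
     (\<forall>\<phi> f' g'. \<phi> \<in> Cell X \<and> ccod X \<phi> = ccod X \<kappa> \<and>
        f' \<in> Tight X \<and> tcod X f' = tdom X (cleft X \<kappa>) \<and> cleft X \<phi> = tcomp X (cleft X \<kappa>) f' \<and>
        g' \<in> Tight X \<and> tcod X g' = tdom X (cright X \<kappa>) \<and> cright X \<phi> = tcomp X (cright X \<kappa>) g' \<longrightarrow>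
        (\<exists>!\<chi>. factor X \<kappa> f' g' \<phi> \<chi>))"

text \<open>
  A virtual equipment is given together with an arbitrary choice of loose-identities \<open>lid X A\<close>
  (with opcartesian 2-cell \<open>lidc X A : () \<Rightarrow> lid X A\<close>) and restrictions \<open>res X q f g\<close> (with
  cartesian 2-cell \<open>resc X q f g\<close> to \<open>q\<close>).  The choice is subject to no strictness conditions.
\<close>

record ('o, 't, 'l, 'c) equipment = "('o, 't, 'l, 'c) vdc" +
  lid :: "'o \<Rightarrow> 'l"
  lidc :: "'o \<Rightarrow> 'c"
  res :: "'l \<Rightarrow> 't \<Rightarrow> 't \<Rightarrow> 'l"
  resc :: "'l \<Rightarrow> 't \<Rightarrow> 't \<Rightarrow> 'c"

locale virtual_equipment = virtual_double_category X
  for X :: "('o, 't, 'l, 'c, 'z) equipment_scheme" +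
  assumes loose_identity: "A \<in> Ob X \<Longrightarrow>
      is_cell X (lidc X A) [] (lid X A) (tid X A) (tid X A) \<and> opcartesian X (lidc X A)"
    and restriction: "is_loose X q B B' \<Longrightarrow> is_tight X f A' B' \<Longrightarrow> is_tight X g A B \<Longrightarrow>
      is_cell X (resc X q f g) [res X q f g] q f g \<and> cartesian X (resc X q f g)"

definition the_opfactor ::
  "('o, 't, 'l, 'c, 'z) vdc_scheme \<Rightarrow> 'l list \<Rightarrow> 'c \<Rightarrow> 'l list \<Rightarrow> 'c \<Rightarrow> 'c" where
  "the_opfactor X ps \<sigma> rs \<phi> = (THE \<chi>. opfactor X ps \<sigma> rs \<phi> \<chi>)"

definition the_factor :: "('o, 't, 'l, 'c, 'z) vdc_scheme \<Rightarrow> 'c \<Rightarrow> 't \<Rightarrow> 't \<Rightarrow> 'c \<Rightarrow> 'c" where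
  "the_factor X \<kappa> f' g' \<phi> = (THE \<chi>. factor X \<kappa> f' g' \<phi> \<chi>)"


section \<open>Canonical loose-cells and 2-cells in a virtual equipment\<close>

text \<open>
  \<open>rep X f g\<close> is \<open>E(f,g)\<close>, the restriction of the loose-identity \<open>E(1,1)\<close> on the common codomain
  of \<open>f\<close> and \<open>g\<close>.
\<close>

definition rep :: "('o, 't, 'l, 'c, 'z) equipment_scheme \<Rightarrow> 't \<Rightarrow> 't \<Rightarrow> 'l" where
  "rep X f g = res X (lid X (tcod X f)) f g"

definition repc :: "('o, 't, 'l, 'c, 'z) equipment_scheme \<Rightarrow> 't \<Rightarrow> 't \<Rightarrow> 'c" where
  "repc X f g = resc X (lid X (tcod X f)) f g"

text \<open>The canonical 2-cell \<open>B(1,1), p \<Rightarrow> p\<close> for \<open>p\<close> with target \<open>B\<close>.\<close>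

definition lunit :: "('o, 't, 'l, 'c, 'z) equipment_scheme \<Rightarrow> 'l \<Rightarrow> 'c" where
  "lunit X p = the_opfactor X [] (lidc X (ltgt X p)) [p] (cid X p)"

text \<open>\<open>frown X f : () \<Rightarrow> B(f,f)\<close> corresponds to the identity of \<open>f\<close>.\<close>

definition frown :: "('o, 't, 'l, 'c, 'z) equipment_scheme \<Rightarrow> 't \<Rightarrow> 'c" where
  "frown X f = the_factor X (repc X f f) (tid X (tdom X f)) (tid X (tdom X f))
     (ccomp X (lidc X (tcod X f)) f [])"

text \<open>
  \<open>smile X f : B(1,f), B(f,1) \<Rightarrow> B(1,1)\<close>, and its restriction
  \<open>smile_at X f x y : B(x,f), B(f,y) \<Rightarrow> B(x,y)\<close> along \<open>x\<close> on the left and \<open>y\<close> on the right, which is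
  taken directly between the chosen restrictions of \<open>B(1,1)\<close>.  For \<open>f\<close> an identity the latter is the
  canonical opcartesian 2-cell \<open>B(x,1), B(1,y) \<Rightarrow> B(x,y)\<close>.
\<close>

definition smile :: "('o, 't, 'l, 'c, 'z) equipment_scheme \<Rightarrow> 't \<Rightarrow> 'c" where
  "smile X f = (let B = tcod X f in
     cmp X (lunit X (lid X B)) [repc X (tid X B) f, repc X f (tid X B)])"

definition smile_at :: "('o, 't, 'l, 'c, 'z) equipment_scheme \<Rightarrow> 't \<Rightarrow> 't \<Rightarrow> 't \<Rightarrow> 'c" where
  "smile_at X f x y = the_factor X (repc X x y) (tid X (tdom X x)) (tid X (tdom X y))
     (cmp X (lunit X (lid X (tcod X f))) [repc X x f, repc X f y])"

text \<open>
  A 2-cell \<open>f \<Rightarrow> g\<close> between tight-cells \<open>A \<rightarrow> B\<close> is taken in the form \<open>() \<Rightarrow> B(f,g)\<close>.  As such a 2-cell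
  need not determine \<open>f\<close> and \<open>g\<close>, the operations below take the tight-cells as arguments.
\<close>

definition tight_2cell :: "('o, 't, 'l, 'c, 'z) equipment_scheme \<Rightarrow> 'c \<Rightarrow> 't \<Rightarrow> 't \<Rightarrow> bool" where
  "tight_2cell X \<phi> f g \<longleftrightarrow> globular X \<phi> [] (rep X f g)"

text \<open>The composite of \<open>\<phi> : f \<Rightarrow> g\<close> followed by \<open>\<psi> : g \<Rightarrow> h\<close>.\<close>

definition tight_vcomp ::
  "('o, 't, 'l, 'c, 'z) equipment_scheme \<Rightarrow> 't \<Rightarrow> 't \<Rightarrow> 't \<Rightarrow> 'c \<Rightarrow> 'c \<Rightarrow> 'c" where
  "tight_vcomp X f g h \<phi> \<psi> = cmp X (smile_at X g f h) [\<phi>, \<psi>]"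

text \<open>
  \<open>rep_post X x f g \<phi>\<close> is \<open>B(x,\<phi>) : B(x,f) \<Rightarrow> B(x,g)\<close> and
  \<open>rep_pre X f g \<phi> x\<close> is \<open>B(\<phi>,x) : B(g,x) \<Rightarrow> B(f,x)\<close>, for \<open>\<phi> : f \<Rightarrow> g\<close>.
\<close>

definition rep_post ::
  "('o, 't, 'l, 'c, 'z) equipment_scheme \<Rightarrow> 't \<Rightarrow> 't \<Rightarrow> 't \<Rightarrow> 'c \<Rightarrow> 'c" where
  "rep_post X x f g \<phi> = cmp X (smile_at X f x g) [cid X (rep X x f), \<phi>]"

definition rep_pre ::
  "('o, 't, 'l, 'c, 'z) equipment_scheme \<Rightarrow> 't \<Rightarrow> 't \<Rightarrow> 'c \<Rightarrow> 't \<Rightarrow> 'c" where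
  "rep_pre X f g \<phi> x = cmp X (smile_at X g f x) [\<phi>, cid X (rep X g x)]"


section \<open>Relative monads and loose relative monads\<close>

definition rel_monad ::
  "('o, 't, 'l, 'c, 'z) equipment_scheme \<Rightarrow> 't \<Rightarrow> 't \<times> 'c \<times> 'c \<Rightarrow> bool" where
  "rel_monad X j = (\<lambda>(t, d, \<eta>).
     is_tight X t (tdom X j) (tcod X j) \<and>
     globular X d [rep X j t] (rep X t t) \<and>
     tight_2cell X \<eta> j t \<and>
     cmp X (rep_pre X j t \<eta> t) [d] = cid X (rep X j t) \<and>
     cmp X d [cmp X (rep_post X j j t \<eta>) [frown X j]] = frown X t \<and>
     cmp X (smile_at X t t t) [d, d] =
       cmp X d [cmp X (smile_at X t j t) [cid X (rep X j t), d]])"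

definition rel_monad_hom ::
  "('o, 't, 'l, 'c, 'z) equipment_scheme \<Rightarrow> 't \<Rightarrow> 't \<times> 'c \<times> 'c \<Rightarrow> 't \<times> 'c \<times> 'c \<Rightarrow> 'c set" where
  "rel_monad_hom X j = (\<lambda>(t, d, \<eta>) (t', d', \<eta>'). {\<tau>.
     tight_2cell X \<tau> t t' \<and>
     tight_vcomp X j t t' \<eta> \<tau> = \<eta>' \<and>
     cmp X (rep_post X t t t' \<tau>) [d] =
       cmp X (rep_pre X t t' \<tau> t') [cmp X d' [rep_post X j t t' \<tau>]]})"

definition loose_rel_monad ::
  "('o, 't, 'l, 'c, 'z) equipment_scheme \<Rightarrow> 't \<Rightarrow> 'l \<times> 'c \<times> 'c \<Rightarrow> bool" where
  "loose_rel_monad X j = (\<lambda>(p, \<mu>, u).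
     let i = tid X (tcod X j); J = rep X j i in
     is_loose X p (tdom X j) (tcod X j) \<and>
     globular X \<mu> [p, J, p] p \<and>
     globular X u [rep X i j] p \<and>
     cmp X \<mu> [u, cid X J, cid X p] = cmp X (lunit X p) [smile X j, cid X p] \<and>
     \<comment> \<open>\<open>\<mu> \<circ> (1,1,u)\<close> is regarded as a 2-cell out of \<open>p, E(j,1) \<odot> E(1,j)\<close>, with \<open>E(j,j)\<close> as loose-composite\<close>
     cmp X (the_opfactor X [p] (smile_at X i j j) [] (cmp X \<mu> [cid X p, cid X J, u]))
       [cid X p, frown X j] = cid X p \<and>
     cmp X \<mu> [\<mu>, cid X J, cid X p] = cmp X \<mu> [cid X p, cid X J, \<mu>])"

definition loose_rel_monad_hom ::
  "('o, 't, 'l, 'c, 'z) equipment_scheme \<Rightarrow> 't \<Rightarrow> 'l \<times> 'c \<times> 'c \<Rightarrow> 'l \<times> 'c \<times> 'c \<Rightarrow> 'c set" where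
  "loose_rel_monad_hom X j = (\<lambda>(p, \<mu>, u) (p', \<mu>', u'). {\<tau>.
     globular X \<tau> [p] p' \<and>
     cmp X \<tau> [u] = u' \<and>
     cmp X \<tau> [\<mu>] = cmp X \<mu>' [\<tau>, cid X (rep X j (tid X (tcod X j))), \<tau>]})"

text \<open>
  The transpose of \<open>d : E(j,t) \<Rightarrow> E(t,t)\<close>, where \<open>d\<close> is first regarded as a 2-cell
  \<open>E(j,1), E(1,t) \<Rightarrow> E(t,t)\<close>.
\<close>

definition transpose_ext :: "('o, 't, 'l, 'c, 'z) equipment_scheme \<Rightarrow> 't \<Rightarrow> 't \<Rightarrow> 'c \<Rightarrow> 'c" where
  "transpose_ext X j t d = (let i = tid X (tcod X j) in
     cmp X (smile_at X t i t) [cid X (rep X i t), cmp X d [smile_at X i j t]])"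


section \<open>Categories, functors, pullbacks\<close>

record ('a, 'm) cat =
  Obj :: "'a set"
  Arr :: "'m set"
  Dom :: "'m \<Rightarrow> 'a"
  Cod :: "'m \<Rightarrow> 'a"
  Id :: "'a \<Rightarrow> 'm"
  Comp :: "'m \<Rightarrow> 'm \<Rightarrow> 'm"

definition Hom :: "('a, 'm) cat \<Rightarrow> 'a \<Rightarrow> 'a \<Rightarrow> 'm set" where
  "Hom C a b = {f \<in> Arr C. Dom C f = a \<and> Cod C f = b}"

locale category =
  fixes C :: "('a, 'm) cat"
  assumes ends: "f \<in> Arr C \<Longrightarrow> Dom C f \<in> Obj C \<and> Cod C f \<in> Obj C"
    and id_in_hom: "a \<in> Obj C \<Longrightarrow> Id C a \<in> Hom C a a"
    and comp_in_hom: "f \<in> Hom C a b \<Longrightarrow> g \<in> Hom C b c \<Longrightarrow> Comp C g f \<in> Hom C a c"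
    and id_left: "f \<in> Hom C a b \<Longrightarrow> Comp C (Id C b) f = f"
    and id_right: "f \<in> Hom C a b \<Longrightarrow> Comp C f (Id C a) = f"
    and assoc: "f \<in> Hom C a b \<Longrightarrow> g \<in> Hom C b c \<Longrightarrow> h \<in> Hom C c d \<Longrightarrow>
      Comp C h (Comp C g f) = Comp C (Comp C h g) f"

record ('a, 'm, 'b, 'n) fctr =
  FO :: "'a \<Rightarrow> 'b"
  FA :: "'m \<Rightarrow> 'n"

locale is_functor =
  fixes C :: "('a, 'm) cat" and D :: "('b, 'n) cat" and F :: "('a, 'm, 'b, 'n) fctr"
  assumes source: "category C"
    and target: "category D"
    and obj: "a \<in> Obj C \<Longrightarrow> FO F a \<in> Obj D"
    and arr: "f \<in> Hom C a b \<Longrightarrow> FA F f \<in> Hom D (FO F a) (FO F b)"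
    and preserves_id: "a \<in> Obj C \<Longrightarrow> FA F (Id C a) = Id D (FO F a)"
    and preserves_comp: "f \<in> Hom C a b \<Longrightarrow> g \<in> Hom C b c \<Longrightarrow>
      FA F (Comp C g f) = Comp D (FA F g) (FA F f)"

definition fcomp :: "('b, 'n, 'c, 'k) fctr \<Rightarrow> ('a, 'm, 'b, 'n) fctr \<Rightarrow> ('a, 'm, 'c, 'k) fctr" where
  "fcomp G F = \<lparr>FO = FO G \<circ> FO F, FA = FA G \<circ> FA F\<rparr>"

text \<open>
  Equality of functors on \<open>C\<close>: the underlying functions are total, and their values outside of \<open>C\<close>
  are irrelevant.
\<close>

definition functor_eq :: "('a, 'm) cat \<Rightarrow> ('a, 'm, 'b, 'n) fctr \<Rightarrow> ('a, 'm, 'b, 'n) fctr \<Rightarrow> bool" where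
  "functor_eq C F G \<longleftrightarrow> (\<forall>a \<in> Obj C. FO F a = FO G a) \<and> (\<forall>f \<in> Arr C. FA F f = FA G f)"

definition fully_faithful :: "('a, 'm) cat \<Rightarrow> ('b, 'n) cat \<Rightarrow> ('a, 'm, 'b, 'n) fctr \<Rightarrow> bool" where
  "fully_faithful C D F \<longleftrightarrow> is_functor C D F \<and>
     (\<forall>a \<in> Obj C. \<forall>b \<in> Obj C. bij_betw (FA F) (Hom C a b) (Hom D (FO F a) (FO F b)))"

text \<open>
  \<open>pullback_square TYPE('zo \<times> 'za) P B C D H K G F\<close>: the square of categories and functors with
  \<open>H : P \<rightarrow> B\<close> on top, \<open>K : P \<rightarrow> C\<close> on the left, \<open>G : B \<rightarrow> D\<close> on the right and \<open>F : C \<rightarrow> D\<close> at the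
  bottom commutes, and has the universal property of a (strict) pullback with respect to all
  categories \<open>Z\<close> with objects in \<open>'zo\<close> and arrows in \<open>'za\<close>.  The type argument is meant to be
  a variable, hence arbitrary.
\<close>

definition pullback_square ::
  "('zo \<times> 'za) itself \<Rightarrow>
   ('p, 'pa) cat \<Rightarrow> ('b, 'ba) cat \<Rightarrow> ('c, 'ca) cat \<Rightarrow> ('d, 'da) cat \<Rightarrow>
   ('p, 'pa, 'b, 'ba) fctr \<Rightarrow> ('p, 'pa, 'c, 'ca) fctr \<Rightarrow>
   ('b, 'ba, 'd, 'da) fctr \<Rightarrow> ('c, 'ca, 'd, 'da) fctr \<Rightarrow> bool" where
  "pullback_square _ P B C D H K G F \<longleftrightarrow>
     is_functor P B H \<and> is_functor P C K \<and> is_functor B D G \<and> is_functor C D F \<and>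
     functor_eq P (fcomp G H) (fcomp F K) \<and>
     (\<forall>(Z :: ('zo, 'za) cat) U V.
        is_functor Z B U \<and> is_functor Z C V \<and> functor_eq Z (fcomp G U) (fcomp F V) \<longrightarrow>
        (\<exists>W. is_functor Z P W \<and> functor_eq Z (fcomp H W) U \<and> functor_eq Z (fcomp K W) V \<and>
           (\<forall>W'. is_functor Z P W' \<and> functor_eq Z (fcomp H W') U \<and> functor_eq Z (fcomp K W') V \<longrightarrow>
              functor_eq Z W' W)))"

text \<open>
  Categories and functors given by families of hom-sets, which need not be disjoint: an arrow is
  a triple of its domain, an element of the hom-set and its codomain.  In \<open>hom_cat\<close>, the argument
  \<open>m a b c \<phi> \<psi>\<close> is the composite of \<open>\<phi> : a \<rightarrow> b\<close> followed by \<open>\<psi> : b \<rightarrow> c\<close>.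
\<close>

definition hom_cat ::
  "'a set \<Rightarrow> ('a \<Rightarrow> 'a \<Rightarrow> 'm set) \<Rightarrow> ('a \<Rightarrow> 'm) \<Rightarrow> ('a \<Rightarrow> 'a \<Rightarrow> 'a \<Rightarrow> 'm \<Rightarrow> 'm \<Rightarrow> 'm) \<Rightarrow>
   ('a, 'a \<times> 'm \<times> 'a) cat" where
  "hom_cat S H i m =
     \<lparr>Obj = S,
      Arr = {(a, \<phi>, b). a \<in> S \<and> b \<in> S \<and> \<phi> \<in> H a b},
      Dom = (\<lambda>(a, \<phi>, b). a),
      Cod = (\<lambda>(a, \<phi>, b). b),
      Id = (\<lambda>a. (a, i a, a)),
      Comp = (\<lambda>(b, \<psi>, c) (a, \<phi>, b'). (a, m a b c \<phi> \<psi>, c))\<rparr>"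

definition hom_functor ::
  "('a \<Rightarrow> 'b) \<Rightarrow> ('a \<Rightarrow> 'a \<Rightarrow> 'm \<Rightarrow> 'n) \<Rightarrow> ('a, 'a \<times> 'm \<times> 'a, 'b, 'b \<times> 'n \<times> 'b) fctr" where
  "hom_functor o\<^sub>F h = \<lparr>FO = o\<^sub>F, FA = (\<lambda>(a, \<phi>, b). (o\<^sub>F a, h a b \<phi>, o\<^sub>F b))\<rparr>"


section \<open>The categories and functors of the square\<close>

definition tight_cat :: "('o, 't, 'l, 'c, 'z) equipment_scheme \<Rightarrow> 'o \<Rightarrow> 'o \<Rightarrow> ('t, 't \<times> 'c \<times> 't) cat" where
  "tight_cat X A B =
     hom_cat {f. is_tight X f A B} (\<lambda>f g. {\<phi>. tight_2cell X \<phi> f g}) (frown X) (tight_vcomp X)"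

definition loose_cat :: "('o, 't, 'l, 'c, 'z) equipment_scheme \<Rightarrow> 'o \<Rightarrow> 'o \<Rightarrow> ('l, 'l \<times> 'c \<times> 'l) cat" where
  "loose_cat X A B =
     hom_cat {p. is_loose X p A B} (\<lambda>p q. {\<phi>. globular X \<phi> [p] q}) (cid X)
       (\<lambda>p q r \<phi> \<psi>. cmp X \<psi> [\<phi>])"

definition RMnd ::
  "('o, 't, 'l, 'c, 'z) equipment_scheme \<Rightarrow> 't \<Rightarrow>
   ('t \<times> 'c \<times> 'c, ('t \<times> 'c \<times> 'c) \<times> 'c \<times> ('t \<times> 'c \<times> 'c)) cat" where
  "RMnd X j =
     hom_cat {M. rel_monad X j M} (rel_monad_hom X j) (\<lambda>M. frown X (fst M))
       (\<lambda>M M' M''. tight_vcomp X (fst M) (fst M') (fst M''))"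

definition LRMnd ::
  "('o, 't, 'l, 'c, 'z) equipment_scheme \<Rightarrow> 't \<Rightarrow>
   ('l \<times> 'c \<times> 'c, ('l \<times> 'c \<times> 'c) \<times> 'c \<times> ('l \<times> 'c \<times> 'c)) cat" where
  "LRMnd X j =
     hom_cat {M. loose_rel_monad X j M} (loose_rel_monad_hom X j) (\<lambda>M. cid X (fst M))
       (\<lambda>M M' M'' \<phi> \<psi>. cmp X \<psi> [\<phi>])"

text \<open>The functors \<open>t \<mapsto> E(1,t)\<close> and \<open>(t,d,\<eta>) \<mapsto> (E(1,t), \<mu>, E(1,\<eta>))\<close>.\<close>

definition tight_to_loose ::
  "('o, 't, 'l, 'c, 'z) equipment_scheme \<Rightarrow> 'o \<Rightarrow> ('t, 't \<times> 'c \<times> 't, 'l, 'l \<times> 'c \<times> 'l) fctr" where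
  "tight_to_loose X E = hom_functor (rep X (tid X E)) (rep_post X (tid X E))"

definition RMnd_to_LRMnd ::
  "('o, 't, 'l, 'c, 'z) equipment_scheme \<Rightarrow> 't \<Rightarrow>
   ('t \<times> 'c \<times> 'c, ('t \<times> 'c \<times> 'c) \<times> 'c \<times> ('t \<times> 'c \<times> 'c),
    'l \<times> 'c \<times> 'c, ('l \<times> 'c \<times> 'c) \<times> 'c \<times> ('l \<times> 'c \<times> 'c)) fctr" where
  "RMnd_to_LRMnd X j = (let i = tid X (tcod X j) in
     hom_functor (\<lambda>(t, d, \<eta>). (rep X i t, transpose_ext X j t d, rep_post X i j t \<eta>))
       (\<lambda>M M'. rep_post X i (fst M) (fst M')))"

text \<open>Both functors \<open>U\<^sub>j\<close> project to the first component and leave the 2-cells unchanged.\<close>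

definition forget ::
  "('a \<times> 'b, ('a \<times> 'b) \<times> 'c \<times> ('a \<times> 'b), 'a, 'a \<times> 'c \<times> 'a) fctr" where
  "forget = hom_functor fst (\<lambda>M M' \<tau>. \<tau>)"

end

theory Submission
  imports Defs
begin

text \<open>
  Write \<open>I\<close> for the loose-identity on \<open>E\<close>.  By the universal property of restrictions, a 2-cell
  \<open>\<phi> : \<Gamma> \<Rightarrow> E(f,g)\<close> amounts to its image \<open>\<phi>'\<close> in the cells from \<open>\<Gamma>\<close> to \<open>I\<close> with left \<open>f\<close> and right
  \<open>g\<close>.  Such cells compose horizontally through \<open>I, I \<Rightarrow> I\<close>; this operation \<open>star\<close> is associative and
  unital, and all operations occurring in the laws become instances of it.  With \<open>\<pi>\<close> the cell
  corresponding to the identity of \<open>E(1,t)\<close>, the map \<open>\<phi> \<mapsto> star \<pi> \<phi>\<close> is a bijection from cells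
  \<open>\<Gamma> \<rightarrow> I\<close> with left \<open>t\<close> to cells \<open>E(1,t), \<Gamma> \<rightarrow> I\<close> with left \<open>1\<close>, inverse to precomposition with the
  companion unit of \<open>t\<close>.  Together with \<open>E(j,1) \<odot> E(1,t) = E(j,t)\<close> it makes transposition
  \<open>\<mu>' = star \<pi> (d' \<circ> s)\<close>, where \<open>s : E(j,1), E(1,t) \<Rightarrow> E(j,t)\<close>, a bijection.  Applied to both sides
  of each law it turns the loose laws into the laws of relative monads.  So the structures over
  \<open>t\<close> are exactly the loose structures over \<open>E(1,t)\<close>, likewise for morphisms, and the square is a
  pullback because \<open>t \<mapsto> E(1,t)\<close> is fully faithful.
\<close>

section \<open>Juxtaposition and associativity in virtual double categories\<close>

text \<open>Most of the cells that matter are not globular: the unit of the companion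
  \<open>E(1,t)\<close>, for example, has left boundary \<open>t\<close>. Moreover, an empty list of
  cells does not determine its boundary. Hence cells are carried with their full frames
  (\<open>cell\<close>, \<open>jux\<close>), the left boundary stays explicit wherever a block may
  be empty, and a shorter calculus for \<open>cmp\<close> is derived for nonempty blocks. Cells into
  the chosen restrictions are compared only after composition with the cartesian cells to
  \<open>I\<close>, which avoids coherence isomorphisms between restrictions. Two points need more
  than cancellation. Surjectivity of transposition needs cells out of \<open>E(j,1), E(1,t)\<close>
  to factor through \<open>E(j,t)\<close>; this is derived from the opcartesian loose-identity in
  \<open>sm_factor\<close>. The right unit law of a loose relative monad mentions a chosen
  factorisation through \<open>E(j,j)\<close>, which first has to be identified with an explicit
  cell. Finally, \<open>E(1,t)\<close> need not determine \<open>t\<close>, so structures are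
  matched over each fixed \<open>t\<close>, and the strict pullback is built from this fibrewise
  statement.\<close>

context virtual_double_category
begin

abbreviation cell :: "'c \<Rightarrow> 'l list \<Rightarrow> 'l \<Rightarrow> 't \<Rightarrow> 't \<Rightarrow> bool" where
  "cell \<equiv> is_cell X"

text \<open>The frame of a juxtaposition, in the same shape as the frame of a single cell, so that
  frames of composites can be found by resolution. The left boundary is an argument because an empty
  list determines none.\<close>

definition jux :: "'c list \<Rightarrow> 'l list \<Rightarrow> 'l list \<Rightarrow> 't \<Rightarrow> 't \<Rightarrow> bool" where
  "jux \<phi>s \<Gamma> qs f g \<longleftrightarrow>
     juxtaposable X f \<phi>s \<and> concat (map (cdom X) \<phi>s) = \<Gamma> \<and> map (ccod X) \<phi>s = qs \<and>
     right_end X f \<phi>s = g"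

lemma cellD:
  assumes "cell \<phi> \<Gamma> q f g"
  shows "\<phi> \<in> Cell X" "cdom X \<phi> = \<Gamma>" "ccod X \<phi> = q" "cleft X \<phi> = f" "cright X \<phi> = g"
    "f \<in> Tight X" "g \<in> Tight X" "loose_chain X (tdom X f) \<Gamma> (tdom X g)"
    "is_loose X q (tcod X g) (tcod X f)"
  using assms cell_frame[OF assms] by (auto simp: is_cell_def)

lemma Cell_tight: "\<phi> \<in> Cell X \<Longrightarrow> cleft X \<phi> \<in> Tight X" "\<phi> \<in> Cell X \<Longrightarrow> cright X \<phi> \<in> Tight X"
  using cell_frame[of \<phi> "cdom X \<phi>" "ccod X \<phi>" "cleft X \<phi>" "cright X \<phi>"]
  by (simp_all add: is_cell_def)

lemma juxtaposable_append:
  "juxtaposable X f (\<phi>s @ \<psi>s) \<longleftrightarrow> juxtaposable X f \<phi>s \<and> juxtaposable X (right_end X f \<phi>s) \<psi>s"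
proof (induction \<phi>s arbitrary: f)
  case Nil
  then show ?case
    by (cases \<psi>s) (auto simp: right_end_def Cell_tight)
next
  case (Cons a \<phi>s)
  then show ?case by (simp add: right_end_def)
qed

lemma right_end_append: "right_end X f (\<phi>s @ \<psi>s) = right_end X (right_end X f \<phi>s) \<psi>s"
  by (simp add: right_end_def)

lemma jux_Nil: "f \<in> Tight X \<Longrightarrow> jux [] [] [] f f"
  by (simp add: jux_def right_end_def)

lemma jux_append:
  "jux \<phi>s \<Gamma> P f g \<Longrightarrow> jux \<psi>s \<Delta> Q g h \<Longrightarrow> jux (\<phi>s @ \<psi>s) (\<Gamma> @ \<Delta>) (P @ Q) f h"
  by (auto simp: jux_def juxtaposable_append right_end_append)

lemma jux_single: "cell \<phi> \<Gamma> q f g \<Longrightarrow> jux [\<phi>] \<Gamma> [q] f g"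
  using cellD[of \<phi> \<Gamma> q f g] by (auto simp: jux_def right_end_def)

lemma jux_Cons:
  "cell \<phi> \<Gamma> q f g \<Longrightarrow> jux \<phi>s \<Delta> Q g h \<Longrightarrow> jux (\<phi> # \<phi>s) (\<Gamma> @ \<Delta>) (q # Q) f h"
  using jux_append[OF jux_single] by fastforce

lemma jux_two: "cell \<phi> \<Gamma> q f g \<Longrightarrow> cell \<psi> \<Delta> r g h \<Longrightarrow> jux [\<phi>, \<psi>] (\<Gamma> @ \<Delta>) [q, r] f h"
  using jux_Cons jux_single by blast

lemma juxtaposable_left: "juxtaposable X f \<phi>s \<Longrightarrow> f \<in> Tight X"
  by (cases \<phi>s) (auto simp: Cell_tight)

lemma cell_ccomp:
  assumes "cell \<psi> qs r f' g'" "jux \<phi>s \<Gamma> qs f g" "tcod X f = tdom X f'"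
  shows "cell (ccomp X \<psi> f \<phi>s) \<Gamma> r (tcomp X f' f) (tcomp X g' g)"
  using assms cell_comp[of \<psi> f \<phi>s] by (auto simp: is_cell_def jux_def composable_def)

lemma loose_chain_end: "loose_chain X A \<Gamma> B \<Longrightarrow> A \<in> Ob X \<and> B \<in> Ob X"
  by (induction \<Gamma> arbitrary: A) (auto simp: loose_ends)

lemma loose_chain_append:
  "loose_chain X A (\<Gamma> @ \<Delta>) B \<longleftrightarrow> (\<exists>C. loose_chain X A \<Gamma> C \<and> loose_chain X C \<Delta> B)"
  by (induction \<Gamma> arbitrary: A) (auto dest: loose_chain_end)

lemma cell_cid: "is_loose X p A B \<Longrightarrow> cell (cid X p) [p] p (tid X B) (tid X A)"
  using cell_id[of p] by (auto simp: is_loose_def globular_def)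

lemma jux_ids: "loose_chain X A \<Gamma> B \<Longrightarrow> jux (map (cid X) \<Gamma>) \<Gamma> \<Gamma> (tid X A) (tid X B)"
proof (induction \<Gamma> arbitrary: A)
  case Nil
  then show ?case using jux_Nil tight_id by (auto simp: is_tight_def)
next
  case (Cons p \<Gamma>)
  have "cell (cid X p) [p] p (tid X A) (tid X (lsrc X p))"
    using Cons.prems by (auto intro: cell_cid simp: is_loose_def)
  from jux_Cons[OF this] Cons show ?case by auto
qed

lemma map_cdom_cid: "loose_chain X A \<Gamma> B \<Longrightarrow> map (cdom X) (map (cid X) \<Gamma>) = map (\<lambda>x. [x]) \<Gamma>"
  by (induction \<Gamma> arbitrary: A) (auto dest: cell_id simp: globular_def is_cell_def)

lemma tid_simps [simp]:
  assumes "A \<in> Ob X"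
  shows "tid X A \<in> Tight X" "tdom X (tid X A) = A" "tcod X (tid X A) = A"
  using tight_id[OF assms] by (auto simp: is_tight_def)

lemma tid_left [simp]: "f \<in> Tight X \<Longrightarrow> B = tcod X f \<Longrightarrow> tcomp X (tid X B) f = f"
  using tight_id_left by (auto simp: is_tight_def)

lemma tid_right [simp]: "f \<in> Tight X \<Longrightarrow> A = tdom X f \<Longrightarrow> tcomp X f (tid X A) = f"
  using tight_id_right by (auto simp: is_tight_def)

lemma comp_id_right: "cell \<phi> \<Gamma> q f g \<Longrightarrow> A = tdom X f \<Longrightarrow> ccomp X \<phi> (tid X A) (map (cid X) \<Gamma>) = \<phi>"
  using cell_id_right[of \<phi>] by (auto simp: is_cell_def)

lemma comp_id_left: "cell \<phi> \<Gamma> q f g \<Longrightarrow> cmp X (cid X q) [\<phi>] = \<phi>"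
  using cell_id_left[of \<phi>] by (auto simp: is_cell_def cmp_def)

lemma ccomp_cmp: "cell \<phi> \<Gamma> q f g \<Longrightarrow> ccomp X \<psi> f (\<phi> # \<phi>s) = cmp X \<psi> (\<phi> # \<phi>s)"
  by (auto simp: cmp_def is_cell_def)

lemma jux_ccomp_cmp: "jux \<phi>s \<Gamma> qs f g \<Longrightarrow> \<phi>s \<noteq> [] \<Longrightarrow> ccomp X \<psi> f \<phi>s = cmp X \<psi> \<phi>s"
  by (cases \<phi>s) (auto simp: cmp_def jux_def)

lemma cell_cmp:
  assumes "cell \<psi> qs r f' g'" "jux \<phi>s \<Gamma> qs f g" "tcod X f = tdom X f'" "\<phi>s \<noteq> []"
  shows "cell (cmp X \<psi> \<phi>s) \<Gamma> r (tcomp X f' f) (tcomp X g' g)"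
  using cell_ccomp[OF assms(1-3)] jux_ccomp_cmp[OF assms(2,4)] by simp

text \<open>The list on the right of \<open>cell_assoc\<close>, by recursion instead of by index, so
  that it unfolds on concrete lists. The left boundary \<open>k\<close> is advanced past each block,
  which also covers empty blocks.\<close>

fun block_comp :: "'t \<Rightarrow> 'c list \<Rightarrow> 'c list list \<Rightarrow> 'c list" where
  "block_comp k (\<phi> # \<phi>s) (\<chi>s # \<chi>ss) = ccomp X \<phi> k \<chi>s # block_comp (right_end X k \<chi>s) \<phi>s \<chi>ss"
| "block_comp k _ _ = []"

lemma block_comp_eq:
  "length \<phi>s = length \<chi>ss \<Longrightarrow>
   map (\<lambda>i. ccomp X (\<phi>s ! i) (right_end X k (concat (take i \<chi>ss))) (\<chi>ss ! i)) [0..<length \<phi>s] =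
   block_comp k \<phi>s \<chi>ss"
proof (induction \<phi>s \<chi>ss arbitrary: k rule: list_induct2)
  case Nil
  then show ?case by simp
next
  case (Cons \<phi> \<phi>s \<chi>s \<chi>ss)
  have "[0..<length (\<phi> # \<phi>s)] = 0 # map Suc [0..<length \<phi>s]"
    by (simp only: map_Suc_upt upt_conv_Cons list.size zero_less_Suc add_Suc_right add_0_right One_nat_def)
  then show ?case using Cons.IH[of "right_end X k \<chi>s"]
    by (simp add: right_end_append o_def) (simp add: right_end_def)
qed

lemma assoc:
  assumes \<psi>: "cell \<psi> qs r f' g'" and \<phi>s: "jux \<phi>s \<Delta> qs f g" and f: "tcod X f = tdom X f'"
    and \<chi>s: "jux (concat \<chi>ss) \<Gamma> \<Delta> k l" and k: "tcod X k = tdom X f"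
    and blocks: "map (map (ccod X)) \<chi>ss = map (cdom X) \<phi>s"
  shows "ccomp X (ccomp X \<psi> f \<phi>s) k (concat \<chi>ss) = ccomp X \<psi> (tcomp X f k) (block_comp k \<phi>s \<chi>ss)"
proof -
  have ft: "f \<in> Tight X" "f' \<in> Tight X"
    using \<phi>s juxtaposable_left cellD(6)[OF \<psi>] by (auto simp: jux_def)
  \<comment> \<open>This makes the outer composite composable: the left boundary of the inner one is
    \<open>tcomp X f' f\<close>, so \<open>k\<close> has to end at the domain of
    \<open>f\<close>.\<close>
  have "tdom X (tcomp X f' f) = tdom X f"
    using tight_comp[of f _ _ f'] ft f by (auto simp: is_tight_def)
  then have c: "composable X (ccomp X \<psi> f \<phi>s) k (concat \<chi>ss)"
    using cell_ccomp[OF \<psi> \<phi>s f] \<chi>s k by (auto simp: composable_def jux_def is_cell_def)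
  have "composable X \<psi> f \<phi>s"
    using \<psi> \<phi>s f by (auto simp: composable_def jux_def is_cell_def)
  from cell_assoc[OF this c blocks] show ?thesis
    using block_comp_eq[of \<phi>s \<chi>ss k] map_eq_imp_length_eq[OF blocks] by simp
qed

text \<open>Each identity absorbs its singleton block by \<open>cell_id_left\<close>. This is what
  lets \<open>cmp_assoc_ids\<close> act on the first input only.\<close>

lemma block_comp_ids:
  "jux \<omega>s \<Gamma> P k l \<Longrightarrow> block_comp k (map (cid X) P) (map (\<lambda>x. [x]) \<omega>s) = \<omega>s"
proof (induction \<omega>s arbitrary: P k \<Gamma>)
  case Nil
  then show ?case by (simp add: jux_def)
next
  case (Cons w \<omega>s)
  then obtain q Q where P: "P = q # Q" and w: "cell w (cdom X w) q k (cright X w)"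
    and r: "jux \<omega>s (concat (map (cdom X) \<omega>s)) Q (cright X w) l"
    by (auto simp: jux_def is_cell_def right_end_def split: if_splits)
  show ?case
    using Cons.IH[OF r] cell_id_left[of w] w by (simp add: P right_end_def is_cell_def)
qed

lemma juxD:
  assumes "jux \<chi>s \<Gamma> P k l"
  shows "map (ccod X) \<chi>s = P" "right_end X k \<chi>s = l"
  using assms by (auto simp: jux_def)

text \<open>This and the next three lemmas specialise associativity to short lists and keep
  \<open>k\<close> explicit, since blocks such as \<open>\<chi>s\<close> may be empty. The versions
  \<open>assoc1\<close>, \<open>assoc2\<close>, \<open>assoc_ids\<close> and \<open>assoc3\<close>
  drop \<open>k\<close> for nonempty blocks.\<close>

lemma cmp_assoc1:
  assumes "cell \<psi> [q] r f' g'" "cell \<phi> P q f g" "tcod X f = tdom X f'"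
    "jux \<chi>s \<Gamma> P k l" "tcod X k = tdom X f"
  shows "ccomp X (cmp X \<psi> [\<phi>]) k \<chi>s = cmp X \<psi> [ccomp X \<phi> k \<chi>s]"
proof -
  have "ccomp X (ccomp X \<psi> f [\<phi>]) k (concat [\<chi>s]) = ccomp X \<psi> (tcomp X f k) (block_comp k [\<phi>] [\<chi>s])"
    by (rule assoc[where \<Gamma> = \<Gamma> and l = l, OF assms(1) jux_single[OF assms(2)] assms(3) _ assms(5)])
      (simp_all add: assms(4) juxD[OF assms(4)] cellD(2)[OF assms(2)])
  then show ?thesis
    by (simp add: ccomp_cmp[OF assms(2)] ccomp_cmp[OF cell_ccomp[OF assms(2,4,5)]])
qed

lemma cmp_assoc2:
  assumes "cell \<psi> [q1, q2] r f' g'" "cell \<phi>1 P q1 f g" "cell \<phi>2 Q q2 g h" "tcod X f = tdom X f'"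
    "jux \<chi>s \<Gamma> P k l" "jux \<omega>s \<Delta> Q l m" "tcod X k = tdom X f"
  shows "ccomp X (cmp X \<psi> [\<phi>1, \<phi>2]) k (\<chi>s @ \<omega>s) = cmp X \<psi> [ccomp X \<phi>1 k \<chi>s, ccomp X \<phi>2 l \<omega>s]"
proof -
  have "ccomp X (ccomp X \<psi> f [\<phi>1, \<phi>2]) k (concat [\<chi>s, \<omega>s]) =
      ccomp X \<psi> (tcomp X f k) (block_comp k [\<phi>1, \<phi>2] [\<chi>s, \<omega>s])"
    by (rule assoc[where \<Gamma> = "\<Gamma> @ \<Delta>" and l = m, OF assms(1) jux_two[OF assms(2,3)] assms(4) _ assms(7)])
      (simp_all add: jux_append[OF assms(5,6)] juxD[OF assms(5)] juxD[OF assms(6)]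
        cellD(2)[OF assms(2)] cellD(2)[OF assms(3)])
  then show ?thesis
    by (simp add: juxD(2)[OF assms(5)] ccomp_cmp[OF assms(2)]
        ccomp_cmp[OF cell_ccomp[OF assms(2,5,7)]])
qed

lemma cmp_assoc_ids:
  assumes "cell \<psi> (q # P) r f' g'" "cell \<phi> Q q f (tid X A)" "loose_chain X A P B"
    "tcod X f = tdom X f'"
    "jux \<chi>s \<Gamma> Q k l" "jux \<omega>s \<Delta> P l m" "tcod X k = tdom X f"
  shows "ccomp X (cmp X \<psi> (\<phi> # map (cid X) P)) k (\<chi>s @ \<omega>s) = cmp X \<psi> (ccomp X \<phi> k \<chi>s # \<omega>s)"
proof -
  have bl: "map (\<lambda>x. [ccod X x]) \<omega>s = map (\<lambda>x. [x]) P"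
    using juxD(1)[OF assms(6)] by auto
  have "ccomp X (ccomp X \<psi> f (\<phi> # map (cid X) P)) k (concat (\<chi>s # map (\<lambda>x. [x]) \<omega>s)) =
      ccomp X \<psi> (tcomp X f k) (block_comp k (\<phi> # map (cid X) P) (\<chi>s # map (\<lambda>x. [x]) \<omega>s))"
    by (rule assoc[where \<Gamma> = "\<Gamma> @ \<Delta>" and l = m, OF assms(1) jux_Cons[OF assms(2) jux_ids[OF assms(3)]] assms(4) _ assms(7)])
      (use map_cdom_cid[OF assms(3)] in
        \<open>simp_all add: jux_append[OF assms(5,6)] juxD(1)[OF assms(5)] bl o_def
          cellD(2)[OF assms(2)]\<close>)
  then show ?thesis
    by (simp add: juxD(2)[OF assms(5)] block_comp_ids[OF assms(6)] ccomp_cmp[OF assms(2)]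
        ccomp_cmp[OF cell_ccomp[OF assms(2,5,7)]])
qed

lemma cmp_assoc3:
  assumes "cell \<psi> [q1, q2, q3] r f' g'" "cell \<phi>1 P q1 f g" "cell \<phi>2 Q q2 g h" "cell \<phi>3 R q3 h i"
    "tcod X f = tdom X f'"
    "jux \<chi>s \<Gamma> P k l" "jux \<omega>s \<Delta> Q l m" "jux \<xi>s \<Theta> R m n" "tcod X k = tdom X f"
  shows "ccomp X (cmp X \<psi> [\<phi>1, \<phi>2, \<phi>3]) k (\<chi>s @ \<omega>s @ \<xi>s) =
    cmp X \<psi> [ccomp X \<phi>1 k \<chi>s, ccomp X \<phi>2 l \<omega>s, ccomp X \<phi>3 m \<xi>s]"
proof -
  have "ccomp X (ccomp X \<psi> f [\<phi>1, \<phi>2, \<phi>3]) k (concat [\<chi>s, \<omega>s, \<xi>s]) =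
      ccomp X \<psi> (tcomp X f k) (block_comp k [\<phi>1, \<phi>2, \<phi>3] [\<chi>s, \<omega>s, \<xi>s])"
    by (rule assoc[where \<Gamma> = "\<Gamma> @ \<Delta> @ \<Theta>" and l = n, OF assms(1) jux_Cons[OF assms(2) jux_two[OF assms(3,4)]] assms(5) _ assms(9)])
      (simp_all add: jux_append[OF assms(6) jux_append[OF assms(7,8)]]
        juxD(1)[OF assms(6)] juxD(1)[OF assms(7)] juxD(1)[OF assms(8)]
        cellD(2)[OF assms(2)] cellD(2)[OF assms(3)] cellD(2)[OF assms(4)])
  then show ?thesis
    by (simp add: juxD(2)[OF assms(6)] juxD(2)[OF assms(7)] ccomp_cmp[OF assms(2)]
        ccomp_cmp[OF cell_ccomp[OF assms(2,6,9)]])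
qed

lemma cell_src_ltgt:
  "cell \<phi> \<Gamma> q f g \<Longrightarrow> ltgt X q = tcod X f \<and> lsrc X q = tcod X g \<and> q \<in> Loose X"
  using cellD(9) by (auto simp: is_loose_def)

lemma jux_chain: "jux \<phi>s \<Gamma> qs f g \<Longrightarrow> f \<in> Tight X \<and> g \<in> Tight X \<and> loose_chain X (tcod X f) qs (tcod X g)"
proof (induction \<phi>s arbitrary: f qs \<Gamma>)
  case Nil
  then show ?case using tight_ends[of f] by (auto simp: jux_def right_end_def)
next
  case (Cons a \<phi>s)
  then obtain q Q where qs: "qs = q # Q" and a: "cell a (cdom X a) q f (cright X a)"
    and r: "jux \<phi>s (concat (map (cdom X) \<phi>s)) Q (cright X a) g"
    by (auto simp: jux_def is_cell_def right_end_def split: if_splits)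
  show ?case using Cons.IH[OF r] cell_src_ltgt[OF a] cellD[OF a] qs by auto
qed

lemma loose_chain_unique: "loose_chain X A P B \<Longrightarrow> loose_chain X A' P B' \<Longrightarrow> P \<noteq> [] \<Longrightarrow> A = A' \<and> B = B'"
proof (induction P arbitrary: A A')
  case (Cons p P)
  then show ?case by (cases P) auto
qed simp

text \<open>The end objects of a nonempty chain can be read off its loose-cells, so the boundaries
  meet automatically. An empty chain fixes no object, which is why the \<open>ccomp\<close> versions
  carry the matching condition as a hypothesis.\<close>

lemma jux_match:
  "cell \<psi> qs r f' g' \<Longrightarrow> jux \<phi>s \<Gamma> qs f g \<Longrightarrow> qs \<noteq> [] \<Longrightarrow> tcod X f = tdom X f' \<and> tcod X g = tdom X g'"
  using cellD(8)[of \<psi> qs r f' g'] jux_chain[of \<phi>s \<Gamma> qs f g] loose_chain_unique by blast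

lemma jux_nonempty: "jux \<phi>s \<Gamma> qs f g \<Longrightarrow> qs \<noteq> [] \<longleftrightarrow> \<phi>s \<noteq> []"
  by (auto simp: jux_def)

lemma cell_post:
  assumes "cell \<psi> qs r (tid X B) (tid X A)" "jux \<phi>s \<Gamma> qs f g" "\<phi>s \<noteq> []" "A \<in> Ob X" "B \<in> Ob X"
  shows "cell (cmp X \<psi> \<phi>s) \<Gamma> r f g"
  using cell_cmp[OF assms(1,2) _ assms(3)] jux_match[OF assms(1,2)] jux_chain[OF assms(2)]
    jux_nonempty[OF assms(2)] assms(3-) by simp

lemma cell_pre:
  assumes "cell \<psi> qs r f g" "jux \<phi>s \<Gamma> qs (tid X B) (tid X A)" "\<phi>s \<noteq> []" "A \<in> Ob X" "B \<in> Ob X"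
  shows "cell (cmp X \<psi> \<phi>s) \<Gamma> r f g"
  using cell_cmp[OF assms(1,2) _ assms(3)] jux_match[OF assms(1,2)] cellD[OF assms(1)]
    jux_nonempty[OF assms(2)] assms(3-) by simp

lemma assoc1:
  assumes "cell \<psi> [q] r f' g'" "cell \<phi> P q f g" "jux \<chi>s \<Gamma> P k l" "\<chi>s \<noteq> []"
  shows "cmp X (cmp X \<psi> [\<phi>]) \<chi>s = cmp X \<psi> [cmp X \<phi> \<chi>s]"
  using cmp_assoc1[OF assms(1,2) _ assms(3)] jux_ccomp_cmp[OF assms(3,4)]
    jux_match[OF assms(1) jux_single[OF assms(2)]] jux_match[OF assms(2,3)]
    jux_nonempty[OF assms(3)] assms(4) by simp

lemma assoc2:
  assumes "cell \<psi> [q1, q2] r f' g'" "cell \<phi>1 P q1 f g" "cell \<phi>2 Q q2 g h"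
    "jux \<chi>s \<Gamma> P k l" "jux \<omega>s \<Delta> Q l m" "\<chi>s \<noteq> []" "\<omega>s \<noteq> []"
  shows "cmp X (cmp X \<psi> [\<phi>1, \<phi>2]) (\<chi>s @ \<omega>s) = cmp X \<psi> [cmp X \<phi>1 \<chi>s, cmp X \<phi>2 \<omega>s]"
  using cmp_assoc2[OF assms(1-3) _ assms(4,5)] jux_ccomp_cmp[OF assms(4,6)]
    jux_ccomp_cmp[OF assms(5,7)] jux_ccomp_cmp[OF jux_append[OF assms(4,5)]]
    jux_match[OF assms(1) jux_two[OF assms(2,3)]] jux_match[OF assms(2,4)]
    jux_nonempty[OF assms(4)] assms(6) by simp

lemma assoc_ids:
  assumes "cell \<psi> (q # P) r f' g'" "cell \<phi> Q q f (tid X A)" "loose_chain X A P B"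
    "jux \<chi>s \<Gamma> Q k l" "jux \<omega>s \<Delta> P l m" "\<chi>s \<noteq> []"
  shows "cmp X (cmp X \<psi> (\<phi> # map (cid X) P)) (\<chi>s @ \<omega>s) = cmp X \<psi> (cmp X \<phi> \<chi>s # \<omega>s)"
  using cmp_assoc_ids[OF assms(1-3) _ assms(4,5)] jux_ccomp_cmp[OF assms(4,6)]
    jux_ccomp_cmp[OF jux_append[OF assms(4,5)]] jux_nonempty[OF assms(4)] assms(6)
    jux_match[OF assms(1) jux_Cons[OF assms(2) jux_ids[OF assms(3)]]] jux_match[OF assms(2,4)]
  by simp

lemma assoc3:
  assumes "cell \<psi> [q1, q2, q3] r f' g'" "cell \<phi>1 P q1 f g" "cell \<phi>2 Q q2 g h" "cell \<phi>3 R q3 h i"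
    "jux \<chi>s \<Gamma> P k l" "jux \<omega>s \<Delta> Q l m" "jux \<xi>s \<Theta> R m n" "\<chi>s \<noteq> []" "\<omega>s \<noteq> []" "\<xi>s \<noteq> []"
  shows "cmp X (cmp X \<psi> [\<phi>1, \<phi>2, \<phi>3]) (\<chi>s @ \<omega>s @ \<xi>s) =
    cmp X \<psi> [cmp X \<phi>1 \<chi>s, cmp X \<phi>2 \<omega>s, cmp X \<phi>3 \<xi>s]"
  using cmp_assoc3[OF assms(1-4) _ assms(5-7)] jux_ccomp_cmp[OF assms(5,8)]
    jux_ccomp_cmp[OF assms(6,9)] jux_ccomp_cmp[OF assms(7,10)]
    jux_ccomp_cmp[OF jux_append[OF assms(5) jux_append[OF assms(6,7)]]]
    jux_match[OF assms(1) jux_Cons[OF assms(2) jux_two[OF assms(3,4)]]] jux_match[OF assms(2,5)]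
    jux_nonempty[OF assms(5)] assms(8-) by simp

lemma cmp_id_right:
  "cell \<phi> \<Gamma> q f g \<Longrightarrow> \<Gamma> \<noteq> [] \<Longrightarrow> cmp X \<phi> (map (cid X) \<Gamma>) = \<phi>"
  using comp_id_right[of \<phi> \<Gamma> q f g] jux_ccomp_cmp[OF jux_ids] cellD(8) by fastforce

lemma cell_ends:
  "cell \<phi> \<Gamma> q f g \<Longrightarrow> tdom X f \<in> Ob X \<and> tcod X f \<in> Ob X \<and> tdom X g \<in> Ob X \<and> tcod X g \<in> Ob X"
  using cellD(6,7) tight_ends by metis

end

section \<open>Unit laws for loose-identities\<close>

context virtual_equipment
begin

lemma lidc_cell: "A \<in> Ob X \<Longrightarrow> cell (lidc X A) [] (lid X A) (tid X A) (tid X A)"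
  using loose_identity by blast

lemma lid_loose: "A \<in> Ob X \<Longrightarrow> is_loose X (lid X A) A A"
  using cellD(9)[OF lidc_cell] by simp

lemma lidc_ids_cell:
  assumes "cell \<chi> (ps @ lid X B # rs) q f g" "B \<in> Ob X"
  shows "cell (cmp X \<chi> (map (cid X) ps @ lidc X B # map (cid X) rs)) (ps @ rs) q f g"
proof -
  have I: "lsrc X (lid X B) = B" "ltgt X (lid X B) = B"
    using lid_loose[OF assms(2)] by (auto simp: is_loose_def)
  have c: "loose_chain X (tdom X f) ps B" "loose_chain X B rs (tdom X g)"
    using cellD(8)[OF assms(1)] by (auto simp: loose_chain_append I)
  have "jux (map (cid X) ps @ [lidc X B] @ map (cid X) rs) (ps @ [] @ rs) (ps @ [lid X B] @ rs)
      (tid X (tdom X f)) (tid X (tdom X g))"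
    using jux_append[OF jux_ids[OF c(1)] jux_append[OF jux_single jux_ids[OF c(2)]]]
      lidc_cell[OF assms(2)] by blast
  then show ?thesis
    using cell_pre[OF assms(1)] cell_ends[OF assms(1)] by simp
qed

text \<open>The uniqueness half of opcartesianness of \<open>lidc X B\<close>. It is the tool for
  equations between cells that have a loose-identity in their domain.\<close>

lemma lid_ext:
  assumes "cell \<chi> (ps @ lid X B # rs) q f g" "cell \<chi>' (ps @ lid X B # rs) q f g" "B \<in> Ob X"
    and eq: "cmp X \<chi> (map (cid X) ps @ lidc X B # map (cid X) rs) =
      cmp X \<chi>' (map (cid X) ps @ lidc X B # map (cid X) rs)"
  shows "\<chi> = \<chi>'"
proof -
  let ?\<phi> = "cmp X \<chi> (map (cid X) ps @ lidc X B # map (cid X) rs)"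
  note l = cellD[OF lidc_cell[OF assms(3)]]
  have c: "cell ?\<phi> (ps @ rs) q f g"
    using lidc_ids_cell assms by blast
  obtain C where "loose_chain X (tdom X f) ps C" "loose_chain X C (lid X B # rs) (tdom X g)"
    using cellD(8)[OF assms(1)] by (auto simp: loose_chain_append)
  then have "loose_chain X (tdom X f) ps B"
    using lid_loose[OF assms(3)] by (auto simp: is_loose_def)
  then have "\<exists>!\<chi>. opfactor X ps (lidc X B) rs ?\<phi> \<chi>"
    using loose_identity[OF assms(3)] cellD[OF c] l lid_loose[OF assms(3)]
    unfolding opcartesian_def by (simp add: is_loose_def)
  moreover have "opfactor X ps (lidc X B) rs ?\<phi> \<chi>" "opfactor X ps (lidc X B) rs ?\<phi> \<chi>'"
    using assms eq cellD[OF c] l by (simp_all add: opfactor_def)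
  ultimately show ?thesis by blast
qed

lemma lid_factor:
  assumes "cell \<phi> (ps @ rs) q f g" "loose_chain X (tdom X f) ps B"
  shows "\<exists>!\<chi>. opfactor X ps (lidc X B) rs \<phi> \<chi>"
proof -
  have B: "B \<in> Ob X" using loose_chain_end[OF assms(2)] by simp
  show ?thesis
    using loose_identity[OF B] cellD[OF lidc_cell[OF B]] lid_loose[OF B] assms cellD[OF assms(1)]
    unfolding opcartesian_def by (simp add: is_loose_def)
qed

text \<open>The mirror image of \<open>lunit\<close>, which has no name in the definitions.
  Existence is enough: \<open>sm_factor\<close> uses only the frame of such a cell and its unit
  equation.\<close>

lemma runit_ex:
  assumes "is_loose X p A B"
  shows "\<exists>\<chi>. cell \<chi> [p, lid X A] p (tid X B) (tid X A) \<and> cmp X \<chi> [cid X p, lidc X A] = cid X p"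
proof -
  have A: "A \<in> Ob X" "B \<in> Ob X" using assms loose_ends by (auto simp: is_loose_def)
  have c: "cell (cid X p) ([p] @ []) p (tid X B) (tid X A)" using cell_cid[OF assms] by simp
  have "loose_chain X (tdom X (tid X B)) [p] A"
    using assms A by (auto simp: is_loose_def)
  from ex1_implies_ex[OF lid_factor[OF c this]] show ?thesis
    using cellD[OF c] cellD[OF lidc_cell[OF A(1)]] by (auto simp: opfactor_def)
qed

lemma lunit_spec:
  assumes "is_loose X p A B"
  shows "cell (lunit X p) [lid X B, p] p (tid X B) (tid X A)"
    and "cmp X (lunit X p) [lidc X B, cid X p] = cid X p"
proof -
  have A: "A \<in> Ob X" "B \<in> Ob X" using assms loose_ends by (auto simp: is_loose_def)
  have c: "cell (cid X p) ([] @ [p]) p (tid X B) (tid X A)" using cell_cid[OF assms] by simp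
  have "loose_chain X (tdom X (tid X B)) [] B" using A by simp
  from theI'[OF lid_factor[OF c this]]
  have "opfactor X [] (lidc X B) [p] (cid X p) (lunit X p)"
    using assms by (simp add: lunit_def the_opfactor_def is_loose_def)
  then show "cell (lunit X p) [lid X B, p] p (tid X B) (tid X A)"
    "cmp X (lunit X p) [lidc X B, cid X p] = cid X p"
    using cellD[OF c] cellD[OF lidc_cell[OF A(2)]] by (auto simp: opfactor_def)
qed

text \<open>The defining equation of \<open>lunit X q\<close>, precomposed with the empty block on
  \<open>f\<close> followed by \<open>\<phi>\<close>. The empty block is what turns
  \<open>lidc X B\<close> into \<open>ccomp X (lidc X B) f []\<close>.\<close>

lemma lunit_lidc_left:
  assumes "cell \<phi> \<Gamma> q f g" "tcod X f = B"
  shows "cmp X (lunit X q) [ccomp X (lidc X B) f [], \<phi>] = \<phi>"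
proof -
  have q: "is_loose X q (tcod X g) B" using cellD(9)[OF assms(1)] assms(2) by simp
  have B: "B \<in> Ob X" "tcod X g \<in> Ob X" using cell_ends[OF assms(1)] assms(2) by auto
  note l = lunit_spec[OF q]
  have "ccomp X (cmp X (lunit X q) [lidc X B, cid X q]) f ([] @ [\<phi>]) =
      cmp X (lunit X q) [ccomp X (lidc X B) f [], ccomp X (cid X q) f [\<phi>]]"
    by (rule cmp_assoc2[OF l(1) lidc_cell[OF B(1)] cell_cid[OF q] _ jux_Nil jux_single[OF assms(1)]])
      (use B assms cellD[OF assms(1)] in simp_all)
  then show ?thesis
    using l(2) comp_id_left[OF assms(1)] by (simp add: ccomp_cmp[OF assms(1)])
qed

text \<open>Both sides become \<open>\<phi>\<close> once the loose-identity is filled with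
  \<open>lidc X B\<close>, so \<open>lid_ext\<close> applies. With the multiplication of
  \<open>I\<close> as \<open>\<phi>\<close> this yields associativity of \<open>star\<close>; with
  other cells it slides \<open>I\<close> past them in the Yoneda correspondence.\<close>

lemma lunit_natural:
  assumes \<phi>: "cell \<phi> (p # \<Gamma>) q (tid X B) g" and B: "B \<in> Ob X"
  shows "cmp X (lunit X q) [cid X (lid X B), \<phi>] = cmp X \<phi> (lunit X p # map (cid X) \<Gamma>)"
proof -
  have Cp: "loose_chain X B (p # \<Gamma>) (tdom X g)" using cellD(8)[OF \<phi>] B by simp
  then have p: "is_loose X p (lsrc X p) B" and C: "loose_chain X (lsrc X p) \<Gamma> (tdom X g)"
    by (auto simp: is_loose_def)
  have q: "is_loose X q (tcod X g) B" using cellD(9)[OF \<phi>] B by simp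
  have ob: "lsrc X p \<in> Ob X" "tcod X g \<in> Ob X" "tdom X g \<in> Ob X"
    using loose_chain_end[OF C] cell_ends[OF \<phi>] by auto
  note lp = lunit_spec[OF p] and lq = lunit_spec[OF q]
  note I = lid_loose[OF B] and lc = lidc_cell[OF B]
  have jC: "jux (map (cid X) (p # \<Gamma>)) (p # \<Gamma>) (p # \<Gamma>) (tid X B) (tid X (tdom X g))"
    by (rule jux_ids[OF Cp])
  have L: "cell (cmp X (lunit X q) [cid X (lid X B), \<phi>]) (lid X B # p # \<Gamma>) q (tid X B) g"
    using cell_post[OF lq(1) jux_two[OF cell_cid[OF I] \<phi>]] ob B by simp
  have R: "cell (cmp X \<phi> (lunit X p # map (cid X) \<Gamma>)) (lid X B # p # \<Gamma>) q (tid X B) g"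
    using cell_pre[OF \<phi> jux_Cons[OF lp(1) jux_ids[OF C]]] ob B by simp
  have "cmp X (cmp X (lunit X q) [cid X (lid X B), \<phi>]) ([lidc X B] @ map (cid X) (p # \<Gamma>)) =
      cmp X (lunit X q) [cmp X (cid X (lid X B)) [lidc X B], cmp X \<phi> (map (cid X) (p # \<Gamma>))]"
    by (rule assoc2[OF lq(1) cell_cid[OF I] \<phi> jux_single[OF lc] jC]) simp_all
  also have "\<dots> = cmp X (lunit X q) [lidc X B, \<phi>]"
    using comp_id_left[OF lc] cmp_id_right[OF \<phi>] by simp
  also have "\<dots> = \<phi>"
    using lunit_lidc_left[OF \<phi>, of B] comp_id_right[OF lc] B by simp
  finally have 1: "cmp X (cmp X (lunit X q) [cid X (lid X B), \<phi>]) (lidc X B # map (cid X) (p # \<Gamma>)) = \<phi>"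
    by simp
  have "cmp X (cmp X \<phi> (lunit X p # map (cid X) \<Gamma>)) ([lidc X B, cid X p] @ map (cid X) \<Gamma>) =
      cmp X \<phi> (cmp X (lunit X p) [lidc X B, cid X p] # map (cid X) \<Gamma>)"
    by (rule assoc_ids[OF \<phi> lp(1) C jux_two[OF lc cell_cid[OF p]] jux_ids[OF C]]) simp
  also have "\<dots> = \<phi>" using lp(2) cmp_id_right[OF \<phi>] by simp
  finally have 2: "cmp X (cmp X \<phi> (lunit X p # map (cid X) \<Gamma>)) (lidc X B # map (cid X) (p # \<Gamma>)) = \<phi>"
    by simp
  show ?thesis
    using lid_ext[where ps = "[]", simplified, OF L R B] 1 2 by simp
qed

text \<open>The multiplication on the loose-identity is defined by its left unit law alone. It is
  right unital too, because precomposing with a further \<open>lidc X B\<close> turns both sides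
  into \<open>lidc X B\<close>.\<close>

lemma lunit_lidc_right:
  assumes B: "B \<in> Ob X"
  shows "cmp X (lunit X (lid X B)) [cid X (lid X B), lidc X B] = cid X (lid X B)"
proof -
  note I = lid_loose[OF B] and lc = lidc_cell[OF B]
  note l = lunit_spec[OF I]
  have c: "cell (cmp X (lunit X (lid X B)) [cid X (lid X B), lidc X B]) [lid X B] (lid X B) (tid X B) (tid X B)"
    using cell_post[OF l(1) jux_two[OF cell_cid[OF I] lc]] B by simp
  have "ccomp X (cmp X (lunit X (lid X B)) [cid X (lid X B), lidc X B]) (tid X B) ([lidc X B] @ []) =
     cmp X (lunit X (lid X B)) [ccomp X (cid X (lid X B)) (tid X B) [lidc X B], ccomp X (lidc X B) (tid X B) []]"
    by (rule cmp_assoc2[OF l(1) cell_cid[OF I] lc _ jux_single[OF lc] jux_Nil]) (use B in simp_all)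
  also have "\<dots> = cmp X (lunit X (lid X B)) [lidc X B, lidc X B]"
    using comp_id_left[OF lc] comp_id_right[OF lc, of B] B by (simp add: ccomp_cmp[OF lc])
  also have "\<dots> = lidc X B"
    using lunit_lidc_left[OF lc, of B] comp_id_right[OF lc, of B] B by simp
  finally have "cmp X (cmp X (lunit X (lid X B)) [cid X (lid X B), lidc X B]) [lidc X B] = lidc X B"
    by (simp add: ccomp_cmp[OF lc])
  then show ?thesis
    using lid_ext[where ps = "[]" and rs = "[]", simplified, OF c cell_cid[OF I] B] comp_id_left[OF lc]
    by simp
qed

end

section \<open>Cells into a loose-identity\<close>

locale equipment_at = virtual_equipment X
  for X :: "('o, 't, 'l, 'c, 'z) equipment_scheme" +
  fixes E :: 'o
  assumes E: "E \<in> Ob X"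
begin

abbreviation I :: 'l where "I \<equiv> lid X E"
abbreviation one :: 't where "one \<equiv> tid X E"

definition star :: "'c \<Rightarrow> 'c \<Rightarrow> 'c" where
  "star \<alpha> \<beta> = cmp X (lunit X I) [\<alpha>, \<beta>]"

text \<open>The identity 2-cell of \<open>f\<close>, seen as a cell into \<open>I\<close> with
  \<open>f\<close> on both sides; these cells are the units of \<open>star\<close>.\<close>

definition tight_unit :: "'t \<Rightarrow> 'c" where
  "tight_unit f = ccomp X (lidc X E) f []"

abbreviation into :: "'t \<Rightarrow> bool" where
  "into f \<equiv> f \<in> Tight X \<and> tcod X f = E"

lemmas I_loose = lid_loose[OF E]
lemmas lunit_I_cell = lunit_spec(1)[OF I_loose]

lemma cell_into: "cell \<alpha> \<Gamma> I f g \<Longrightarrow> into f \<and> into g"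
  using cell_src_ltgt[of \<alpha> \<Gamma> I f g] I_loose cellD(6,7) by (auto simp: is_loose_def)

lemma star_cell: "cell \<alpha> \<Gamma> I f g \<Longrightarrow> cell \<beta> \<Delta> I g h \<Longrightarrow> cell (star \<alpha> \<beta>) (\<Gamma> @ \<Delta>) I f h"
  unfolding star_def using cell_post[OF lunit_I_cell jux_two] E by blast

lemma tight_unit_cell: "into f \<Longrightarrow> cell (tight_unit f) [] I f f"
  unfolding tight_unit_def using cell_ccomp[OF lidc_cell[OF E] jux_Nil[of f]] E by simp

lemma star_unit_left: "cell \<alpha> \<Gamma> I f g \<Longrightarrow> star (tight_unit f) \<alpha> = \<alpha>"
  using lunit_lidc_left cell_into by (simp add: star_def tight_unit_def)

lemma star_unit_right:
  assumes \<alpha>: "cell \<alpha> \<Gamma> I f g"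
  shows "star \<alpha> (tight_unit g) = \<alpha>"
proof -
  note cI = cell_cid[OF I_loose]
  have "ccomp X (cmp X (lunit X I) [cid X I, lidc X E]) f ([\<alpha>] @ []) =
      cmp X (lunit X I) [ccomp X (cid X I) f [\<alpha>], ccomp X (lidc X E) g []]"
    by (rule cmp_assoc2[OF lunit_I_cell cI lidc_cell[OF E] _ jux_single[OF \<alpha>] jux_Nil])
      (use E cell_into[OF \<alpha>] in simp_all)
  then show ?thesis
    using lunit_lidc_right[OF E] comp_id_left[OF \<alpha>]
    by (simp add: star_def tight_unit_def ccomp_cmp[OF \<alpha>])
qed

lemma star_ccomp:
  assumes "cell \<alpha> \<Gamma> I f g" "cell \<beta> \<Delta> I g h" "jux \<chi>s \<Gamma>' \<Gamma> k l" "jux \<omega>s \<Delta>' \<Delta> l m"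
    "tcod X k = tdom X f"
  shows "ccomp X (star \<alpha> \<beta>) k (\<chi>s @ \<omega>s) = star (ccomp X \<alpha> k \<chi>s) (ccomp X \<beta> l \<omega>s)"
  unfolding star_def
  by (rule cmp_assoc2[OF lunit_I_cell assms(1,2) _ assms(3-5)]) (use E cell_into[OF assms(1)] in simp)

lemma star_cmp:
  assumes "cell \<alpha> \<Gamma> I f g" "cell \<beta> \<Delta> I g h" "jux \<chi>s \<Gamma>' \<Gamma> k l" "jux \<omega>s \<Delta>' \<Delta> l m"
    "\<chi>s \<noteq> []" "\<omega>s \<noteq> []"
  shows "cmp X (star \<alpha> \<beta>) (\<chi>s @ \<omega>s) = star (cmp X \<alpha> \<chi>s) (cmp X \<beta> \<omega>s)"
  unfolding star_def by (rule assoc2[OF lunit_I_cell assms])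

text \<open>The second factor is nullary and therefore receives an empty block, a case excluded from
  \<open>star_cmp\<close>. The identity on the right of \<open>\<chi>s\<close> ensures that this
  empty block leaves \<open>\<beta>\<close> unchanged.\<close>

lemma star_cmp_left:
  assumes \<alpha>: "cell \<alpha> \<Gamma> I f g" and \<beta>: "cell \<beta> [] I g h"
    and \<chi>s: "jux \<chi>s \<Gamma>' \<Gamma> k (tid X B)" "\<chi>s \<noteq> []" "B \<in> Ob X"
  shows "cmp X (star \<alpha> \<beta>) \<chi>s = star (cmp X \<alpha> \<chi>s) \<beta>"
proof -
  have g: "tdom X g = B" "tcod X k = tdom X f"
    using jux_match[OF \<alpha> \<chi>s(1)] jux_nonempty[OF \<chi>s(1)] \<chi>s(2,3) by auto
  have "ccomp X (star \<alpha> \<beta>) k (\<chi>s @ []) = star (ccomp X \<alpha> k \<chi>s) (ccomp X \<beta> (tid X B) [])"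
    by (rule star_ccomp[OF \<alpha> \<beta> \<chi>s(1) jux_Nil]) (use \<chi>s g in simp_all)
  then show ?thesis
    using comp_id_right[OF \<beta>, of B] g jux_ccomp_cmp[OF \<chi>s(1,2)]
      cell_frame[OF \<beta>] by simp
qed

lemma star_cmp_right:
  assumes \<alpha>: "cell \<alpha> [] I f g" and \<beta>: "cell \<beta> \<Delta> I g h"
    and \<chi>s: "jux \<chi>s \<Delta>' \<Delta> (tid X B) l" "\<chi>s \<noteq> []" "B \<in> Ob X"
  shows "cmp X (star \<alpha> \<beta>) \<chi>s = star \<alpha> (cmp X \<beta> \<chi>s)"
proof -
  have g: "tdom X g = B"
    using jux_match[OF \<beta> \<chi>s(1)] jux_nonempty[OF \<chi>s(1)] \<chi>s(2,3) by auto
  then have f: "tdom X f = B" using cellD(8)[OF \<alpha>] by simp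
  have "ccomp X (star \<alpha> \<beta>) (tid X B) ([] @ \<chi>s) = star (ccomp X \<alpha> (tid X B) []) (ccomp X \<beta> (tid X B) \<chi>s)"
    by (rule star_ccomp[OF \<alpha> \<beta> jux_Nil \<chi>s(1)]) (use \<chi>s g f in simp_all)
  then show ?thesis
    using comp_id_right[OF \<alpha>, of B] g f jux_ccomp_cmp[OF \<chi>s(1,2)] by simp
qed

text \<open>Associativity of \<open>I, I \<Rightarrow> I\<close> is naturality of the left unitor
  applied to this very cell; the three arguments are then plugged in.\<close>

lemma star_assoc:
  assumes "cell \<alpha> \<Gamma> I f g" "cell \<beta> \<Delta> I g h" "cell \<gamma> \<Theta> I h k"
  shows "star (star \<alpha> \<beta>) \<gamma> = star \<alpha> (star \<beta> \<gamma>)"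
proof -
  note cI = cell_cid[OF I_loose]
  have [simp]: "star \<alpha> \<beta> = cmp X (lunit X I) [\<alpha>, \<beta>]" for \<alpha> \<beta> by (simp add: star_def)
  have *: "cmp X (lunit X I) [cid X I, lunit X I] = cmp X (lunit X I) [lunit X I, cid X I]"
    using lunit_natural[OF lunit_I_cell E] by simp
  have "cmp X (cmp X (lunit X I) [cid X I, lunit X I]) ([\<alpha>] @ [\<beta>, \<gamma>]) =
      cmp X (lunit X I) [cmp X (cid X I) [\<alpha>], cmp X (lunit X I) [\<beta>, \<gamma>]]"
    by (rule assoc2[OF lunit_I_cell cI lunit_I_cell jux_single[OF assms(1)] jux_two[OF assms(2,3)]]) simp_all
  moreover have "cmp X (cmp X (lunit X I) [lunit X I, cid X I]) ([\<alpha>, \<beta>] @ [\<gamma>]) =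
      cmp X (lunit X I) [cmp X (lunit X I) [\<alpha>, \<beta>], cmp X (cid X I) [\<gamma>]]"
    by (rule assoc2[OF lunit_I_cell lunit_I_cell cI jux_two[OF assms(1,2)] jux_single[OF assms(3)]]) simp_all
  ultimately show ?thesis
    using * comp_id_left[OF assms(1)] comp_id_left[OF assms(3)] by simp
qed

section \<open>The loose-cells \<open>E(f,g)\<close> and the cells into them\<close>

abbreviation rp :: "'t \<Rightarrow> 't \<Rightarrow> 'l" where "rp \<equiv> rep X"
abbreviation \<kappa> :: "'t \<Rightarrow> 't \<Rightarrow> 'c" where "\<kappa> \<equiv> repc X"

lemma rep_cell:
  assumes "into f" "into g"
  shows "cell (\<kappa> f g) [rp f g] I f g" "cartesian X (\<kappa> f g)" "is_loose X (rp f g) (tdom X g) (tdom X f)"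
proof -
  have "is_tight X f (tdom X f) E" "is_tight X g (tdom X g) E"
    using assms by (auto simp: is_tight_def)
  from restriction[OF I_loose this] show c: "cell (\<kappa> f g) [rp f g] I f g" "cartesian X (\<kappa> f g)"
    using assms by (auto simp: repc_def rep_def)
  show "is_loose X (rp f g) (tdom X g) (tdom X f)"
    using cellD(8)[OF c(1)] by (auto simp: is_loose_def)
qed

lemma cart_ex1:
  assumes "into f" "into g" "cell \<phi> \<Gamma> I (tcomp X f f') (tcomp X g g')"
    "f' \<in> Tight X" "tcod X f' = tdom X f" "g' \<in> Tight X" "tcod X g' = tdom X g"
  shows "\<exists>!\<chi>. cell \<chi> \<Gamma> (rp f g) f' g' \<and> cmp X (\<kappa> f g) [\<chi>] = \<phi>"
proof -
  note k = cellD[OF rep_cell(1)[OF assms(1,2)]] and p = cellD[OF assms(3)]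
  have "\<exists>!\<chi>. factor X (\<kappa> f g) f' g' \<phi> \<chi>"
    using rep_cell(2)[OF assms(1,2)] assms(4-) k(2-5) p(1,3-5) unfolding cartesian_def by metis
  then show ?thesis using k(2) p(2) by (simp add: factor_def)
qed

text \<open>In lemma names, \<open>hat\<close> stands for the passage from \<open>\<phi>\<close> to
  \<open>cmp X (\<kappa> f g) [\<phi>]\<close>. It is set up for arbitrary boundaries
  \<open>f'\<close> and \<open>g'\<close>, since companion and conjoint units are not
  globular.\<close>

lemma hat_cell:
  assumes "into f" "into g" "cell \<phi> \<Gamma> (rp f g) f' g'"
  shows "cell (cmp X (\<kappa> f g) [\<phi>]) \<Gamma> I (tcomp X f f') (tcomp X g g')"
    "f' \<in> Tight X" "tcod X f' = tdom X f" "g' \<in> Tight X" "tcod X g' = tdom X g"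
  using cell_cmp[OF rep_cell(1)[OF assms(1,2)] jux_single[OF assms(3)]]
    jux_match[OF rep_cell(1)[OF assms(1,2)] jux_single[OF assms(3)]] cellD(6,7)[OF assms(3)]
  by auto

lemma hat_inj:
  assumes "into f" "into g" "cell \<chi> \<Gamma> (rp f g) f' g'" "cell \<chi>' \<Gamma> (rp f g) f' g'"
    "cmp X (\<kappa> f g) [\<chi>] = cmp X (\<kappa> f g) [\<chi>']"
  shows "\<chi> = \<chi>'"
  using cart_ex1[OF assms(1,2) hat_cell[OF assms(1-3)]] assms(3-) by (metis (no_types))

lemma hat_cmp:
  assumes "into f" "into g" "cell \<phi> \<Gamma> (rp f g) f' g'" "jux \<chi>s \<Delta> \<Gamma> k l" "\<chi>s \<noteq> []"
  shows "cmp X (\<kappa> f g) [cmp X \<phi> \<chi>s] = cmp X (cmp X (\<kappa> f g) [\<phi>]) \<chi>s"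
  using assoc1[OF rep_cell(1)[OF assms(1,2)] assms(3-5)] by simp

abbreviation gl :: "'c \<Rightarrow> 'l list \<Rightarrow> 't \<Rightarrow> 't \<Rightarrow> bool" where
  "gl \<phi> \<Gamma> f g \<equiv> cell \<phi> \<Gamma> (rp f g) (tid X (tdom X f)) (tid X (tdom X g))"

lemma globular_rep:
  assumes "into f" "into g"
  shows "globular X \<phi> \<Gamma> (rp f g) \<longleftrightarrow> gl \<phi> \<Gamma> f g"
  using rep_cell(3)[OF assms] by (simp add: globular_def is_loose_def)

lemma hat_gl:
  assumes "into f" "into g" "gl \<phi> \<Gamma> f g"
  shows "cell (cmp X (\<kappa> f g) [\<phi>]) \<Gamma> I f g"
  using hat_cell(1)[OF assms] assms by simp

definition rep_factor :: "'t \<Rightarrow> 't \<Rightarrow> 'c \<Rightarrow> 'c" where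
  "rep_factor f g \<phi> = the_factor X (\<kappa> f g) (tid X (tdom X f)) (tid X (tdom X g)) \<phi>"

lemma rep_factor_spec:
  assumes "cell \<phi> \<Gamma> I f g"
  shows "gl (rep_factor f g \<phi>) \<Gamma> f g" "cmp X (\<kappa> f g) [rep_factor f g \<phi>] = \<phi>"
proof -
  have fg: "into f" "into g" using cell_into[OF assms] by auto
  have "tdom X f \<in> Ob X" "tdom X g \<in> Ob X" using fg tight_ends by auto
  then have "\<exists>!\<chi>. gl \<chi> \<Gamma> f g \<and> cmp X (\<kappa> f g) [\<chi>] = \<phi>"
    using cart_ex1[OF fg, of \<phi> \<Gamma> "tid X (tdom X f)" "tid X (tdom X g)"] assms fg by simp
  then have "\<exists>!\<chi>. factor X (\<kappa> f g) (tid X (tdom X f)) (tid X (tdom X g)) \<phi> \<chi>"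
    using cellD(2)[OF assms] cellD(2)[OF rep_cell(1)[OF fg]] by (simp add: factor_def)
  from theI'[OF this] show "gl (rep_factor f g \<phi>) \<Gamma> f g" "cmp X (\<kappa> f g) [rep_factor f g \<phi>] = \<phi>"
    using cellD(2)[OF assms] cellD(2)[OF rep_cell(1)[OF fg]]
    by (auto simp: factor_def rep_factor_def the_factor_def)
qed

lemma hat_inj_gl:
  "into f \<Longrightarrow> into g \<Longrightarrow> gl \<chi> \<Gamma> f g \<Longrightarrow> gl \<chi>' \<Gamma> f g \<Longrightarrow>
    cmp X (\<kappa> f g) [\<chi>] = cmp X (\<kappa> f g) [\<chi>'] \<Longrightarrow> \<chi> = \<chi>'"
  by (rule hat_inj)

lemma frown_spec:
  assumes "into f"
  shows "gl (frown X f) [] f f" "cmp X (\<kappa> f f) [frown X f] = tight_unit f"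
  using rep_factor_spec[OF tight_unit_cell[OF assms]] assms by (auto simp: frown_def rep_factor_def tight_unit_def)

lemma smile_at_spec:
  assumes "into t" "into x" "into y"
  shows "gl (smile_at X t x y) [rp x t, rp t y] x y"
    "cmp X (\<kappa> x y) [smile_at X t x y] = star (\<kappa> x t) (\<kappa> t y)"
  using rep_factor_spec[OF star_cell[OF rep_cell(1)[of x t] rep_cell(1)[of t y]]] assms
  by (auto simp: smile_at_def rep_factor_def star_def)

text \<open>\<open>rep_post\<close>, \<open>rep_pre\<close>, \<open>tight_vcomp\<close> and
  transposition are all composites with some \<open>smile_at\<close>, so this one computation
  provides their images in terms of \<open>star\<close>. The outer boundaries of
  \<open>\<alpha>\<close> and \<open>\<beta>\<close>, and the one they share, are arbitrary, as
  required by \<open>sm_section\<close>.\<close>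

lemma smile_at_cmp:
  assumes "into t" "into x" "into y" "cell \<alpha> \<Gamma> (rp x t) f g" "cell \<beta> \<Delta> (rp t y) g h"
  shows "cell (cmp X (smile_at X t x y) [\<alpha>, \<beta>]) (\<Gamma> @ \<Delta>) (rp x y) f h"
    and "cmp X (\<kappa> x y) [cmp X (smile_at X t x y) [\<alpha>, \<beta>]] =
      star (cmp X (\<kappa> x t) [\<alpha>]) (cmp X (\<kappa> t y) [\<beta>])"
proof -
  have o: "tdom X x \<in> Ob X" "tdom X y \<in> Ob X" using assms tight_ends by auto
  note s = smile_at_spec[OF assms(1-3)] and j = jux_two[OF assms(4,5)]
  show "cell (cmp X (smile_at X t x y) [\<alpha>, \<beta>]) (\<Gamma> @ \<Delta>) (rp x y) f h"
    using cell_post[OF s(1) j] o by simp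
  have "cmp X (\<kappa> x y) [cmp X (smile_at X t x y) [\<alpha>, \<beta>]] = cmp X (star (\<kappa> x t) (\<kappa> t y)) ([\<alpha>] @ [\<beta>])"
    using hat_cmp[OF assms(2,3) s(1) j] s(2) by simp
  also have "\<dots> = star (cmp X (\<kappa> x t) [\<alpha>]) (cmp X (\<kappa> t y) [\<beta>])"
    by (rule star_cmp[OF rep_cell(1)[OF assms(2,1)] rep_cell(1)[OF assms(1,3)]
          jux_single[OF assms(4)] jux_single[OF assms(5)]]) simp_all
  finally show "cmp X (\<kappa> x y) [cmp X (smile_at X t x y) [\<alpha>, \<beta>]] =
      star (cmp X (\<kappa> x t) [\<alpha>]) (cmp X (\<kappa> t y) [\<beta>])" .
qed

lemma into_dom: "into f \<Longrightarrow> tdom X f \<in> Ob X"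
  using tight_ends by blast

lemma hat_cid:
  assumes "into f" "into g"
  shows "gl (cid X (rp f g)) [rp f g] f g" "cmp X (\<kappa> f g) [cid X (rp f g)] = \<kappa> f g"
  using cell_cid[OF rep_cell(3)[OF assms]] cmp_id_right[OF rep_cell(1)[OF assms]] by auto

lemma rep_post_spec:
  assumes "into x" "into f" "into g" "gl \<phi> [] f g" "tdom X f = A" "tdom X g = A"
  shows "gl (rep_post X x f g \<phi>) [rp x f] x g"
    "cmp X (\<kappa> x g) [rep_post X x f g \<phi>] = star (\<kappa> x f) (cmp X (\<kappa> f g) [\<phi>])"
  using smile_at_cmp[OF assms(2,1,3) hat_cid(1)[OF assms(1,2)]] assms hat_cid[OF assms(1,2)]
  by (auto simp: rep_post_def)

lemma rep_pre_spec:
  assumes "into x" "into f" "into g" "gl \<phi> [] f g" "tdom X f = A" "tdom X g = A"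
  shows "gl (rep_pre X f g \<phi> x) [rp g x] f x"
    "cmp X (\<kappa> f x) [rep_pre X f g \<phi> x] = star (cmp X (\<kappa> f g) [\<phi>]) (\<kappa> g x)"
  using smile_at_cmp[OF assms(3,2,1,4) hat_cid(1)[OF assms(3,1)]] assms hat_cid[OF assms(3,1)]
  by (auto simp: rep_pre_def)

lemma tight_vcomp_spec:
  assumes "into f" "into g" "into h" "gl \<phi> [] f g" "gl \<psi> [] g h"
  shows "gl (tight_vcomp X f g h \<phi> \<psi>) [] f h"
    "cmp X (\<kappa> f h) [tight_vcomp X f g h \<phi> \<psi>] = star (cmp X (\<kappa> f g) [\<phi>]) (cmp X (\<kappa> g h) [\<psi>])"
  using smile_at_cmp[OF assms(2,1,3,4,5)] by (auto simp: tight_vcomp_def)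

end

section \<open>Companions, conjoints and the Yoneda correspondence\<close>

context equipment_at
begin

lemma into_one: "into one" "tdom X one = E"
  using E by simp_all

lemma companion_unit_ex:
  assumes "into t"
  shows "\<exists>\<eta>. cell \<eta> [] (rp one t) t (tid X (tdom X t)) \<and> cmp X (\<kappa> one t) [\<eta>] = tight_unit t"
  using cart_ex1[OF into_one(1) assms, of "tight_unit t" "[]" t "tid X (tdom X t)"]
    tight_unit_cell[OF assms] into_dom[OF assms] E assms by auto

lemma conjoint_unit_ex:
  assumes "into j"
  shows "\<exists>\<epsilon>. cell \<epsilon> [] (rp j one) (tid X (tdom X j)) j \<and> cmp X (\<kappa> j one) [\<epsilon>] = tight_unit j"
  using cart_ex1[OF assms into_one(1), of "tight_unit j" "[]" "tid X (tdom X j)" j]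
    tight_unit_cell[OF assms] into_dom[OF assms] E assms by auto

lemma whisker_ex:
  assumes "into j" "into t"
  shows "\<exists>\<rho>. cell \<rho> [rp j t] (rp one t) j (tid X (tdom X t)) \<and> cmp X (\<kappa> one t) [\<rho>] = \<kappa> j t"
  using cart_ex1[OF into_one(1) assms(2), of "\<kappa> j t" "[rp j t]" j "tid X (tdom X t)"]
    rep_cell(1)[OF assms] into_dom[OF assms(2)] E assms by auto

text \<open>Together with \<open>\<kappa> one t\<close>, this is the pair of binding cells that
  makes \<open>E(1,t)\<close> a companion of \<open>t\<close>. The two zigzag equations are the
  second part of \<open>companion_unit_spec\<close> and \<open>companion_zigzag\<close>.\<close>

definition companion_unit :: "'t \<Rightarrow> 'c" where
  "companion_unit t = (SOME \<eta>. cell \<eta> [] (rp one t) t (tid X (tdom X t)) \<and> cmp X (\<kappa> one t) [\<eta>] = tight_unit t)"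

text \<open>Dually, this and \<open>\<kappa> j one\<close> are the binding cells of the conjoint
  \<open>E(j,1)\<close>.\<close>

definition conjoint_unit :: "'t \<Rightarrow> 'c" where
  "conjoint_unit j = (SOME \<epsilon>. cell \<epsilon> [] (rp j one) (tid X (tdom X j)) j \<and> cmp X (\<kappa> j one) [\<epsilon>] = tight_unit j)"

text \<open>The comparison through which \<open>E(j,t)\<close> arises by restricting
  \<open>E(1,t)\<close> along \<open>j\<close> on the left.\<close>

definition whisker :: "'t \<Rightarrow> 't \<Rightarrow> 'c" where
  "whisker j t = (SOME \<rho>. cell \<rho> [rp j t] (rp one t) j (tid X (tdom X t)) \<and> cmp X (\<kappa> one t) [\<rho>] = \<kappa> j t)"

lemma companion_unit_spec:
  "into t \<Longrightarrow> cell (companion_unit t) [] (rp one t) t (tid X (tdom X t))"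
  "into t \<Longrightarrow> cmp X (\<kappa> one t) [companion_unit t] = tight_unit t"
  using someI_ex[OF companion_unit_ex] unfolding companion_unit_def by blast+

lemma conjoint_unit_spec:
  "into j \<Longrightarrow> cell (conjoint_unit j) [] (rp j one) (tid X (tdom X j)) j"
  "into j \<Longrightarrow> cmp X (\<kappa> j one) [conjoint_unit j] = tight_unit j"
  using someI_ex[OF conjoint_unit_ex] unfolding conjoint_unit_def by blast+

lemma whisker_spec:
  "into j \<Longrightarrow> into t \<Longrightarrow> cell (whisker j t) [rp j t] (rp one t) j (tid X (tdom X t))"
  "into j \<Longrightarrow> into t \<Longrightarrow> cmp X (\<kappa> one t) [whisker j t] = \<kappa> j t"
  using someI_ex[OF whisker_ex] unfolding whisker_def by blast+

text \<open>Naturality of the left unitor along \<open>\<kappa> one t\<close> moves the action of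
  \<open>I\<close> on \<open>E(1,t)\<close> to the multiplication of \<open>I\<close>.\<close>

lemma lunit_rep:
  assumes t: "into t" and \<alpha>: "cell \<alpha> \<Gamma> I f g" and \<beta>: "cell \<beta> \<Delta> (rp one t) g k"
  shows "cell (cmp X (lunit X (rp one t)) [\<alpha>, \<beta>]) (\<Gamma> @ \<Delta>) (rp one t) f k"
    "cmp X (\<kappa> one t) [cmp X (lunit X (rp one t)) [\<alpha>, \<beta>]] = star \<alpha> (cmp X (\<kappa> one t) [\<beta>])"
proof -
  note K = rep_cell[OF into_one(1) t]
  have p: "is_loose X (rp one t) (tdom X t) E" using K(3) E by simp
  note l = lunit_spec(1)[OF p] and ab = jux_two[OF \<alpha> \<beta>] and cI = cell_cid[OF I_loose]
  show "cell (cmp X (lunit X (rp one t)) [\<alpha>, \<beta>]) (\<Gamma> @ \<Delta>) (rp one t) f k"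
    using cell_post[OF l ab] into_dom[OF t] E by simp
  have "cmp X (\<kappa> one t) [cmp X (lunit X (rp one t)) [\<alpha>, \<beta>]] =
      cmp X (cmp X (\<kappa> one t) [lunit X (rp one t)]) [\<alpha>, \<beta>]"
    using assoc1[OF K(1) l ab] by simp
  also have "\<dots> = cmp X (cmp X (lunit X I) [cid X I, \<kappa> one t]) ([\<alpha>] @ [\<beta>])"
    using lunit_natural[OF K(1) E] by simp
  also have "\<dots> = cmp X (lunit X I) [cmp X (cid X I) [\<alpha>], cmp X (\<kappa> one t) [\<beta>]]"
    by (rule assoc2[OF lunit_I_cell cI K(1) jux_single[OF \<alpha>] jux_single[OF \<beta>]]) simp_all
  finally show "cmp X (\<kappa> one t) [cmp X (lunit X (rp one t)) [\<alpha>, \<beta>]] = star \<alpha> (cmp X (\<kappa> one t) [\<beta>])"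
    using comp_id_left[OF \<alpha>] by (simp add: star_def)
qed

lemma companion_zigzag:
  assumes t: "into t"
  shows "cmp X (lunit X (rp one t)) [\<kappa> one t, companion_unit t] = cid X (rp one t)"
proof (rule hat_inj[OF into_one(1) t])
  note l = lunit_rep[OF t rep_cell(1)[OF into_one(1) t] companion_unit_spec(1)[OF t]]
  show "cell (cmp X (lunit X (rp one t)) [\<kappa> one t, companion_unit t]) [rp one t] (rp one t) one (tid X (tdom X t))"
    using l(1) by simp
  show "cell (cid X (rp one t)) [rp one t] (rp one t) one (tid X (tdom X t))"
    using hat_cid(1)[OF into_one(1) t] into_one(2) by simp
  show "cmp X (\<kappa> one t) [cmp X (lunit X (rp one t)) [\<kappa> one t, companion_unit t]] = cmp X (\<kappa> one t) [cid X (rp one t)]"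
    using l(2) companion_unit_spec(2)[OF t] star_unit_right[OF rep_cell(1)[OF into_one(1) t]]
      hat_cid(2)[OF into_one(1) t] by simp
qed

text \<open>By interchange the companion unit meets only \<open>\<kappa> one t\<close>. There it
  produces \<open>tight_unit t\<close>, which is a left unit for \<open>star\<close>.\<close>

lemma yoneda_eval:
  assumes \<phi>: "cell \<phi> \<Gamma> I t g"
  shows "cmp X (star (\<kappa> one t) \<phi>) (companion_unit t # map (cid X) \<Gamma>) = \<phi>"
proof -
  have t: "into t" using cell_into[OF \<phi>] by simp
  note c = companion_unit_spec[OF t]
  have "ccomp X (star (\<kappa> one t) \<phi>) t ([companion_unit t] @ map (cid X) \<Gamma>) =
      star (ccomp X (\<kappa> one t) t [companion_unit t]) (ccomp X \<phi> (tid X (tdom X t)) (map (cid X) \<Gamma>))"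
    by (rule star_ccomp[OF rep_cell(1)[OF into_one(1) t] \<phi> jux_single[OF c(1)] jux_ids[OF cellD(8)[OF \<phi>]]])
      (use t E in simp)
  then show ?thesis
    using c(2) comp_id_right[OF \<phi>] star_unit_left[OF \<phi>] by (simp add: ccomp_cmp[OF c(1)])
qed

lemma yoneda_inj:
  "cell \<phi> \<Gamma> I t g \<Longrightarrow> cell \<phi>' \<Gamma> I t g \<Longrightarrow> star (\<kappa> one t) \<phi> = star (\<kappa> one t) \<phi>' \<longleftrightarrow> \<phi> = \<phi>'"
  using yoneda_eval by metis

text \<open>The other inverse law. Naturality of the left unitor moves \<open>\<kappa> one t\<close>
  from outside \<open>\<psi>\<close> into its first input, where it cancels against the companion
  unit by \<open>companion_zigzag\<close>.\<close>

lemma yoneda_surj: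
  assumes t: "into t" and \<psi>: "cell \<psi> (rp one t # \<Gamma>) I one g"
  shows "cell (cmp X \<psi> (companion_unit t # map (cid X) \<Gamma>)) \<Gamma> I t g"
    and "star (\<kappa> one t) (cmp X \<psi> (companion_unit t # map (cid X) \<Gamma>)) = \<psi>"
proof -
  note K = rep_cell[OF into_one(1) t] and c = companion_unit_spec(1)[OF t] and cI = cell_cid[OF I_loose]
  have p: "is_loose X (rp one t) (tdom X t) E" using K(3) E by simp
  note l = lunit_spec(1)[OF p]
  have ch: "loose_chain X (tdom X t) \<Gamma> (tdom X g)"
    using cellD(8)[OF \<psi>] p by (auto simp: is_loose_def)
  have j: "jux (companion_unit t # map (cid X) \<Gamma>) \<Gamma> (rp one t # \<Gamma>) t (tid X (tdom X g))"
    using jux_Cons[OF c jux_ids[OF ch]] by simp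
  show "cell (cmp X \<psi> (companion_unit t # map (cid X) \<Gamma>)) \<Gamma> I t g"
    using cell_cmp[OF \<psi> j] t E cellD(7)[OF \<psi>] by simp
  have "star (\<kappa> one t) (cmp X \<psi> (companion_unit t # map (cid X) \<Gamma>)) =
      cmp X (lunit X I) [cmp X (cid X I) [\<kappa> one t], cmp X \<psi> (companion_unit t # map (cid X) \<Gamma>)]"
    using comp_id_left[OF K(1)] by (simp add: star_def)
  also have "\<dots> = cmp X (cmp X (lunit X I) [cid X I, \<psi>]) ([\<kappa> one t] @ companion_unit t # map (cid X) \<Gamma>)"
    by (rule assoc2[OF lunit_I_cell cI \<psi> jux_single[OF K(1)] j, symmetric]) simp_all
  also have "\<dots> = cmp X (cmp X \<psi> (lunit X (rp one t) # map (cid X) \<Gamma>)) ([\<kappa> one t, companion_unit t] @ map (cid X) \<Gamma>)"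
    using lunit_natural[OF \<psi> E] by simp
  also have "\<dots> = cmp X \<psi> (cmp X (lunit X (rp one t)) [\<kappa> one t, companion_unit t] # map (cid X) \<Gamma>)"
    by (rule assoc_ids[OF \<psi> l ch jux_two[OF K(1) c] jux_ids[OF ch]]) simp
  also have "\<dots> = \<psi>"
    using companion_zigzag[OF t] cmp_id_right[OF \<psi>] by simp
  finally show "star (\<kappa> one t) (cmp X \<psi> (companion_unit t # map (cid X) \<Gamma>)) = \<psi>" .
qed

text \<open>
  \<open>[conjoint_unit j, whisker j t]\<close> is a section of \<open>E(j,1), E(1,t) \<Rightarrow> E(j,t)\<close>; its two members are
  not globular, but their juxtaposition has identities as outer boundaries.
\<close>

abbreviation sm :: "'t \<Rightarrow> 't \<Rightarrow> 'c" where "sm j t \<equiv> smile_at X one j t"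

lemma sm_spec:
  assumes "into j" "into t"
  shows "gl (sm j t) [rp j one, rp one t] j t" "cmp X (\<kappa> j t) [sm j t] = star (\<kappa> j one) (\<kappa> one t)"
  using smile_at_spec[OF into_one(1) assms] by auto

text \<open>The image of the left side is \<open>star (tight_unit j) (\<kappa> j t)\<close>, hence
  \<open>\<kappa> j t\<close>.\<close>

lemma sm_section:
  assumes "into j" "into t"
  shows "cmp X (sm j t) [conjoint_unit j, whisker j t] = cid X (rp j t)"
proof (rule hat_inj_gl[OF assms])
  note s = smile_at_cmp[OF into_one(1) assms conjoint_unit_spec(1)[OF assms(1)] whisker_spec(1)[OF assms]]
  show "gl (cmp X (sm j t) [conjoint_unit j, whisker j t]) [rp j t] j t" using s(1) by simp
  show "gl (cid X (rp j t)) [rp j t] j t" by (rule hat_cid(1)[OF assms])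
  show "cmp X (\<kappa> j t) [cmp X (sm j t) [conjoint_unit j, whisker j t]] = cmp X (\<kappa> j t) [cid X (rp j t)]"
    using s(2) conjoint_unit_spec(2)[OF assms(1)] whisker_spec(2)[OF assms] hat_cid(2)[OF assms]
      star_unit_left[OF rep_cell(1)[OF assms]] by simp
qed

lemma section_jux:
  assumes "into j" "into t"
  shows "jux [conjoint_unit j, whisker j t] [rp j t] [rp j one, rp one t] (tid X (tdom X j)) (tid X (tdom X t))"
  using jux_two[OF conjoint_unit_spec(1)[OF assms(1)] whisker_spec(1)[OF assms]] by simp

lemma sm_eval:
  assumes "into j" "into t" "cell \<chi> [rp j t] q f g"
  shows "cmp X (cmp X \<chi> [sm j t]) [conjoint_unit j, whisker j t] = \<chi>"
  using assoc1[OF assms(3) sm_spec(1)[OF assms(1,2)] section_jux[OF assms(1,2)]]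
    sm_section[OF assms(1,2)] cmp_id_right[OF assms(3)] by simp

lemma sm_inj:
  assumes "into j" "into t" "cell \<chi> [rp j t] q f g" "cell \<chi>' [rp j t] q f g"
  shows "cmp X \<chi> [sm j t] = cmp X \<chi>' [sm j t] \<longleftrightarrow> \<chi> = \<chi>'"
  using sm_eval[OF assms(1,2,3)] sm_eval[OF assms(1,2,4)] by metis

text \<open>With \<open>t\<close> taken to be \<open>j\<close>, this gives uniqueness of the
  factorisation through \<open>E(j,j)\<close> that occurs in the right unit law of a loose relative
  monad.\<close>

lemma sm_inj_right:
  assumes "into j" "into t" and \<chi>: "cell \<chi> [p, rp j t] q f g" and p: "is_loose X p (tdom X j) B"
  shows "cmp X (cmp X \<chi> [cid X p, sm j t]) [cid X p, conjoint_unit j, whisker j t] = \<chi>"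
proof -
  have "cmp X (cmp X \<chi> [cid X p, sm j t]) ([cid X p] @ [conjoint_unit j, whisker j t]) =
    cmp X \<chi> [cmp X (cid X p) [cid X p], cmp X (sm j t) [conjoint_unit j, whisker j t]]"
    by (rule assoc2[OF \<chi> cell_cid[OF p] sm_spec(1)[OF assms(1,2)] jux_single[OF cell_cid[OF p]]
          section_jux[OF assms(1,2)]]) simp_all
  then show ?thesis
    using sm_section[OF assms(1,2)] cmp_id_right[OF \<chi>] comp_id_left[OF cell_cid[OF p]] by simp
qed

lemma sm_sm_inj:
  assumes "into j" "into t" "tdom X j = tdom X t"
    "cell \<chi> [rp j t, rp j t] q f g" "cell \<chi>' [rp j t, rp j t] q f g"
  shows "cmp X \<chi> [sm j t, sm j t] = cmp X \<chi>' [sm j t, sm j t] \<longleftrightarrow> \<chi> = \<chi>'"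
proof -
  have "cmp X (cmp X \<chi> [sm j t, sm j t]) ([conjoint_unit j, whisker j t] @ [conjoint_unit j, whisker j t]) = \<chi>"
    if \<chi>: "cell \<chi> [rp j t, rp j t] q f g" for \<chi>
  proof -
    have s: "gl (sm j t) [rp j one, rp one t] j t" by (rule sm_spec(1)[OF assms(1,2)])
    note sj = section_jux[OF assms(1,2)]
    have "cmp X (cmp X \<chi> [sm j t, sm j t]) ([conjoint_unit j, whisker j t] @ [conjoint_unit j, whisker j t]) =
        cmp X \<chi> [cmp X (sm j t) [conjoint_unit j, whisker j t], cmp X (sm j t) [conjoint_unit j, whisker j t]]"
      by (rule assoc2[OF \<chi> s _ sj]) (use s sj assms(3) in simp_all)
    then show ?thesis
      using sm_section[OF assms(1,2)] cmp_id_right[OF \<chi>] by simp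
  qed
  then show ?thesis using assms(4,5) by metis
qed

text \<open>The existence half of \<open>E(j,1) \<odot> E(1,t) = E(j,t)\<close>. Applying
  \<open>sm j t\<close> and then its section introduces a loose-identity between the two factors.
  \<open>D\<close> cannot distinguish absorbing it into \<open>E(1,t)\<close> from absorbing it into
  \<open>E(j,1)\<close>, and in the latter form the conjoint zigzag removes it.\<close>

lemma sm_factor:
  assumes j: "into j" and t: "into t" and D: "cell D [rp j one, rp one t] q f g"
  shows "cell (cmp X D [conjoint_unit j, whisker j t]) [rp j t] q f g"
    and "cmp X (cmp X D [conjoint_unit j, whisker j t]) [sm j t] = D"
proof -
  let ?J = "rp j one" and ?p = "rp one t"
  note KJ = rep_cell[OF j into_one(1)] and Kp = rep_cell[OF into_one(1) t]
  note cv = conjoint_unit_spec[OF j] and ro = whisker_spec[OF j t] and s = sm_spec[OF j t]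
  note cI = cell_cid[OF I_loose] and lc = lidc_cell[OF E]
  have J: "is_loose X ?J E (tdom X j)" and p: "is_loose X ?p (tdom X t) E"
    using KJ(3) Kp(3) E by simp_all
  have o: "tdom X j \<in> Ob X" "tdom X t \<in> Ob X" using into_dom j t by auto
  note l = lunit_spec[OF p] and cp = cell_cid[OF p] and cJ = cell_cid[OF J]
  obtain r where r: "cell r [?J, I] ?J (tid X (tdom X j)) one" "cmp X r [cid X ?J, lidc X E] = cid X ?J"
    using runit_ex[OF J] by blast
  show "cell (cmp X D [conjoint_unit j, whisker j t]) [rp j t] q f g"
    using cell_pre[OF D section_jux[OF j t]] o by simp

  \<comment> \<open>After \<open>sm j t\<close>, the cell \<open>whisker j t\<close> is the action
    of \<open>\<kappa> j one\<close> on \<open>E(1,t)\<close>: both have image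
    \<open>star (\<kappa> j one) (\<kappa> one t)\<close>.\<close>
  have 1: "cmp X (whisker j t) [sm j t] = cmp X (lunit X ?p) [\<kappa> j one, cid X ?p]"
  proof (rule hat_inj[OF into_one(1) t])
    note lr = lunit_rep[OF t KJ(1) cp]
    show "cell (cmp X (whisker j t) [sm j t]) [?J, ?p] ?p j (tid X (tdom X t))"
      by (rule cell_pre[OF ro(1) jux_single[OF s(1)]]) (use o in simp_all)
    show "cell (cmp X (lunit X ?p) [\<kappa> j one, cid X ?p]) [?J, ?p] ?p j (tid X (tdom X t))"
      using lr(1) by simp
    show "cmp X (\<kappa> one t) [cmp X (whisker j t) [sm j t]] =
        cmp X (\<kappa> one t) [cmp X (lunit X ?p) [\<kappa> j one, cid X ?p]]"
      using hat_cmp[OF into_one(1) t ro(1) jux_single[OF s(1)]] ro(2) s(2) lr(2)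
        hat_cid(2)[OF into_one(1) t] by simp
  qed

  \<comment> \<open>The middle loose-identity may change sides: filling it with
    \<open>lidc X E\<close> reduces both composites to \<open>D\<close>.\<close>
  have 2: "cmp X D [cid X ?J, lunit X ?p] = cmp X D [r, cid X ?p]"
  proof (rule lid_ext[where ps = "[?J]" and rs = "[?p]" and B = E])
    show "cell (cmp X D [cid X ?J, lunit X ?p]) ([?J] @ I # [?p]) q f g"
      using cell_pre[OF D jux_two[OF cJ l(1)]] o by simp
    show "cell (cmp X D [r, cid X ?p]) ([?J] @ I # [?p]) q f g"
      using cell_pre[OF D jux_two[OF r(1) cp]] o by simp
    have "cmp X (cmp X D [cid X ?J, lunit X ?p]) ([cid X ?J] @ [lidc X E, cid X ?p]) =
        cmp X D [cmp X (cid X ?J) [cid X ?J], cmp X (lunit X ?p) [lidc X E, cid X ?p]]"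
      by (rule assoc2[OF D cJ l(1) jux_single[OF cJ] jux_two[OF lc cp]]) simp_all
    moreover have "cmp X (cmp X D [r, cid X ?p]) ([cid X ?J, lidc X E] @ [cid X ?p]) =
        cmp X D [cmp X r [cid X ?J, lidc X E], cmp X (cid X ?p) [cid X ?p]]"
      by (rule assoc2[OF D r(1) cp jux_two[OF cJ lc] jux_single[OF cp]]) simp_all
    ultimately show "cmp X (cmp X D [cid X ?J, lunit X ?p]) (map (cid X) [?J] @ lidc X E # map (cid X) [?p]) =
        cmp X (cmp X D [r, cid X ?p]) (map (cid X) [?J] @ lidc X E # map (cid X) [?p])"
      using comp_id_left[OF cJ] comp_id_left[OF cp] l(2) r(2) by simp
  qed (rule E)

  \<comment> \<open>On images, \<open>r\<close> is right multiplication by \<open>I\<close>, again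
    tested on \<open>lidc X E\<close>.\<close>
  have 3: "cmp X (\<kappa> j one) [r] = cmp X (lunit X I) [\<kappa> j one, cid X I]"
  proof (rule lid_ext[where ps = "[?J]" and rs = "[]" and B = E])
    show "cell (cmp X (\<kappa> j one) [r]) ([?J] @ I # []) I j one"
      using cell_pre[OF KJ(1) jux_single[OF r(1)]] o E by simp
    show "cell (cmp X (lunit X I) [\<kappa> j one, cid X I]) ([?J] @ I # []) I j one"
      using cell_post[OF lunit_I_cell jux_two[OF KJ(1) cI]] E by simp
    have "cmp X (cmp X (\<kappa> j one) [r]) [cid X ?J, lidc X E] = \<kappa> j one"
      using assoc1[OF KJ(1) r(1) jux_two[OF cJ lc]] r(2) hat_cid(2)[OF j into_one(1)] by simp
    moreover have "cmp X (cmp X (lunit X I) [\<kappa> j one, cid X I]) ([cid X ?J] @ [lidc X E]) =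
        cmp X (lunit X I) [cmp X (\<kappa> j one) [cid X ?J], cmp X (cid X I) [lidc X E]]"
      by (rule assoc2[OF lunit_I_cell KJ(1) cI jux_single[OF cJ] jux_single[OF lc]]) simp_all
    moreover have "lidc X E = tight_unit one"
      using comp_id_right[OF lc, of E] E by (simp add: tight_unit_def)
    ultimately show "cmp X (cmp X (\<kappa> j one) [r]) (map (cid X) [?J] @ lidc X E # map (cid X) []) =
        cmp X (cmp X (lunit X I) [\<kappa> j one, cid X I]) (map (cid X) [?J] @ lidc X E # map (cid X) [])"
      using comp_id_left[OF lc] hat_cid(2)[OF j into_one(1)] star_unit_right[OF KJ(1)]
      by (simp add: star_def)
  qed (rule E)

  \<comment> \<open>The conjoint zigzag, checked on images by means of 3.\<close>
  have 4: "cmp X r [conjoint_unit j, \<kappa> j one] = cid X ?J"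
  proof (rule hat_inj[OF j into_one(1)])
    note cvk = jux_two[OF cv(1) KJ(1)]
    show "cell (cmp X r [conjoint_unit j, \<kappa> j one]) [?J] ?J (tid X (tdom X j)) one"
      using cell_post[OF r(1) cvk] o E by simp
    show "cell (cid X ?J) [?J] ?J (tid X (tdom X j)) one" by (rule cJ)
    have "cmp X (cmp X (\<kappa> j one) [r]) [conjoint_unit j, \<kappa> j one] =
        cmp X (cmp X (lunit X I) [\<kappa> j one, cid X I]) ([conjoint_unit j] @ [\<kappa> j one])"
      using 3 by simp
    also have "\<dots> = cmp X (lunit X I) [cmp X (\<kappa> j one) [conjoint_unit j], cmp X (cid X I) [\<kappa> j one]]"
      by (rule assoc2[OF lunit_I_cell KJ(1) cI jux_single[OF cv(1)] jux_single[OF KJ(1)]]) simp_all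
    also have "\<dots> = \<kappa> j one"
      using cv(2) comp_id_left[OF KJ(1)] star_unit_left[OF KJ(1)] by (simp add: star_def)
    finally show "cmp X (\<kappa> j one) [cmp X r [conjoint_unit j, \<kappa> j one]] = cmp X (\<kappa> j one) [cid X ?J]"
      using assoc1[OF KJ(1) r(1) cvk] hat_cid(2)[OF j into_one(1)] by simp
  qed

  have Df: "tdom X f = tdom X j"
    using cellD(8)[OF D] J by (auto simp: is_loose_def)
  \<comment> \<open>As \<open>conjoint_unit j\<close> is nullary, it takes the empty block and
    \<open>sm j t\<close> goes entirely to \<open>whisker j t\<close>.\<close>
  have "ccomp X (cmp X D [conjoint_unit j, whisker j t]) (tid X (tdom X j)) ([] @ [sm j t]) =
      cmp X D [ccomp X (conjoint_unit j) (tid X (tdom X j)) [], ccomp X (whisker j t) (tid X (tdom X j)) [sm j t]]"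
    by (rule cmp_assoc2[OF D cv(1) ro(1) _ jux_Nil jux_single[OF s(1)]]) (use o Df in simp_all)
  then have "cmp X (cmp X D [conjoint_unit j, whisker j t]) [sm j t] = cmp X D [conjoint_unit j, cmp X (whisker j t) [sm j t]]"
    using comp_id_right[OF cv(1), of "tdom X j"] o by (simp add: ccomp_cmp[OF s(1)])
  also have "\<dots> = cmp X D [cmp X (cid X ?J) [conjoint_unit j], cmp X (lunit X ?p) [\<kappa> j one, cid X ?p]]"
    using 1 comp_id_left[OF cv(1)] by simp
  also have "\<dots> = cmp X (cmp X D [cid X ?J, lunit X ?p]) ([conjoint_unit j] @ [\<kappa> j one, cid X ?p])"
    by (rule assoc2[OF D cJ l(1) jux_single[OF cv(1)] jux_two[OF KJ(1) cp], symmetric]) simp_all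
  also have "\<dots> = cmp X (cmp X D [r, cid X ?p]) ([conjoint_unit j, \<kappa> j one] @ [cid X ?p])"
    using 2 by simp
  also have "\<dots> = cmp X D [cmp X r [conjoint_unit j, \<kappa> j one], cmp X (cid X ?p) [cid X ?p]]"
    by (rule assoc2[OF D r(1) cp jux_two[OF cv(1) KJ(1)] jux_single[OF cp]]) simp_all
  also have "\<dots> = D"
    using 4 comp_id_left[OF cp] cmp_id_right[OF D] by simp
  finally show "cmp X (cmp X D [conjoint_unit j, whisker j t]) [sm j t] = D" .
qed

end

section \<open>Translation of the laws\<close>

context equipment_at
begin

lemma hat_iff:
  assumes "into f" "into g" "gl \<chi> \<Gamma> f g" "gl \<chi>' \<Gamma> f g"
  shows "\<chi> = \<chi>' \<longleftrightarrow> cmp X (\<kappa> f g) [\<chi>] = cmp X (\<kappa> f g) [\<chi>']"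
  using hat_inj_gl[OF assms] by metis

lemma gl_cmp1:
  assumes "into f" "into g" "gl \<phi> [q] f g" "cell \<psi> \<Gamma> q k l"
  shows "cell (cmp X \<phi> [\<psi>]) \<Gamma> (rp f g) k l"
    "cmp X (\<kappa> f g) [cmp X \<phi> [\<psi>]] = cmp X (cmp X (\<kappa> f g) [\<phi>]) [\<psi>]"
  using cell_post[OF assms(3) jux_single[OF assms(4)]] into_dom assms(1,2)
    hat_cmp[OF assms(1-3) jux_single[OF assms(4)]] by auto

text \<open>On images the map is \<open>star (\<kappa> one t)\<close>, so this is the Yoneda
  correspondence with empty domain. It serves twice: for morphisms
  \<open>t \<Rightarrow> t'\<close>, and for the units \<open>j \<Rightarrow> t\<close> of the
  structures.\<close>

lemma rep_post_one_bij:
  assumes t: "into t" "tdom X t = A" and t': "into t'" "tdom X t' = A"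
  shows "bij_betw (rep_post X one t t') {\<tau>. gl \<tau> [] t t'} {T. gl T [rp one t] one t'}"
proof (rule bij_betwI')
  note rs = rep_post_spec[OF into_one(1) t(1) t'(1) _ t(2) t'(2)]
  fix \<tau> \<sigma> assume "\<tau> \<in> {\<tau>. gl \<tau> [] t t'}" "\<sigma> \<in> {\<tau>. gl \<tau> [] t t'}"
  then have \<tau>: "gl \<tau> [] t t'" and \<sigma>: "gl \<sigma> [] t t'" by auto
  note h = hat_gl[OF t(1) t'(1) \<tau>] hat_gl[OF t(1) t'(1) \<sigma>]
  show "rep_post X one t t' \<tau> = rep_post X one t t' \<sigma> \<longleftrightarrow> \<tau> = \<sigma>"
    unfolding hat_iff[OF into_one(1) t'(1) rs(1)[OF \<tau>] rs(1)[OF \<sigma>]] rs(2)[OF \<tau>] rs(2)[OF \<sigma>]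
      yoneda_inj[OF h] hat_iff[OF t(1) t'(1) \<tau> \<sigma>] ..
next
  note rs = rep_post_spec[OF into_one(1) t(1) t'(1) _ t(2) t'(2)]
  fix \<tau> assume "\<tau> \<in> {\<tau>. gl \<tau> [] t t'}"
  then show "rep_post X one t t' \<tau> \<in> {T. gl T [rp one t] one t'}" using rs(1) by simp
next
  note rs = rep_post_spec[OF into_one(1) t(1) t'(1) _ t(2) t'(2)]
  fix T assume "T \<in> {T. gl T [rp one t] one t'}"
  then have T: "gl T [rp one t] one t'" by simp
  let ?\<psi> = "cmp X (\<kappa> one t') [T]"
  have \<psi>: "cell ?\<psi> [rp one t] I one t'" by (rule hat_gl[OF into_one(1) t'(1) T])
  let ?\<phi> = "cmp X ?\<psi> (companion_unit t # map (cid X) [])"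
  note y = yoneda_surj[OF t(1) \<psi>]
  note f = rep_factor_spec[OF y(1)]
  have "T = rep_post X one t t' (rep_factor t t' ?\<phi>)"
    unfolding hat_iff[OF into_one(1) t'(1) T rs(1)[OF f(1)]] rs(2)[OF f(1)] f(2) y(2) ..
  then show "\<exists>\<tau> \<in> {\<tau>. gl \<tau> [] t t'}. T = rep_post X one t t' \<tau>" using f(1) by blast
qed

section \<open>Transposition for a fixed \<open>j\<close>\<close>

context
  fixes j A
  assumes j: "into j" "tdom X j = A"
begin

abbreviation tr :: "'t \<Rightarrow> 'c \<Rightarrow> 'c" where "tr \<equiv> transpose_ext X j"

lemma oA: "A \<in> Ob X"
  using into_dom j by auto

lemma J_spec:
  "cell (cid X (rp j one)) [rp j one] (rp j one) (tid X A) one"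
  using hat_cid(1)[OF j(1) into_one(1)] j(2) E by simp

lemma p_spec:
  assumes "into t" "tdom X t = A"
  shows "cell (cid X (rp one t)) [rp one t] (rp one t) one (tid X A)"
    "is_loose X (rp one t) A E"
  using hat_cid(1)[OF into_one(1) assms(1)] rep_cell(3)[OF into_one(1) assms(1)] assms(2) E
  by auto

lemma Jp_jux:
  assumes "into t" "tdom X t = A"
  shows "jux [cid X (rp j one), cid X (rp one t)] [rp j one, rp one t] [rp j one, rp one t] (tid X A) (tid X A)"
  using jux_two[OF J_spec p_spec(1)[OF assms]] by simp

lemma transpose_spec:
  assumes t: "into t" "tdom X t = A" and d: "gl d [rp j t] t t"
  shows "gl (tr t d) [rp one t, rp j one, rp one t] one t"
    and "cmp X (\<kappa> one t) [tr t d] = star (\<kappa> one t) (cmp X (cmp X (\<kappa> t t) [d]) [sm j t])"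
    and "cell (cmp X (cmp X (\<kappa> t t) [d]) [sm j t]) [rp j one, rp one t] I t t"
proof -
  note s = sm_spec[OF j(1) t(1)]
  note ds = gl_cmp1[OF t(1) t(1) d s(1)]
  have ds1: "cell (cmp X d [sm j t]) [rp j one, rp one t] (rp t t) (tid X A) (tid X (tdom X t))"
    using ds(1) j(2) by simp
  note c = smile_at_cmp[OF t(1) into_one(1) t(1) p_spec(1)[OF t] ds1]
  have *: "tr t d = cmp X (smile_at X t one t) [cid X (rp one t), cmp X d [sm j t]]"
    using j by (simp add: transpose_ext_def Let_def)
  show "gl (tr t d) [rp one t, rp j one, rp one t] one t"
    "cmp X (\<kappa> one t) [tr t d] = star (\<kappa> one t) (cmp X (cmp X (\<kappa> t t) [d]) [sm j t])"
    using c ds(2) hat_cid(2)[OF into_one(1) t(1)] into_one(2) by (simp_all add: *)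
  show "cell (cmp X (cmp X (\<kappa> t t) [d]) [sm j t]) [rp j one, rp one t] I t t"
    using hat_gl[OF t(1,1), of "cmp X d [sm j t]"] ds1 ds(2) t by simp
qed

lemma transpose_inj:
  assumes t: "into t" "tdom X t = A" and d: "gl d [rp j t] t t" and d': "gl d' [rp j t] t t"
    and eq: "tr t d = tr t d'"
  shows "d = d'"
proof -
  note T = transpose_spec[OF t d] and T' = transpose_spec[OF t d']
  note h = hat_gl[OF t(1,1) d] hat_gl[OF t(1,1) d']
  have "cmp X (cmp X (\<kappa> t t) [d]) [sm j t] = cmp X (cmp X (\<kappa> t t) [d']) [sm j t]"
    using eq T(2) T'(2) yoneda_inj[OF T(3) T'(3)] by simp
  then show ?thesis
    using sm_inj[OF j(1) t(1) h] hat_iff[OF t(1,1) d d'] by simp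
qed

text \<open>The three layers of transposition are removed in turn:
  \<open>star (\<kappa> one t)\<close> by the companion unit, \<open>sm j t\<close> by its section,
  and the cartesian cell of \<open>E(t,t)\<close> by its universal property.\<close>

lemma transpose_surj:
  assumes t: "into t" "tdom X t = A" and \<mu>: "gl \<mu> [rp one t, rp j one, rp one t] one t"
  shows "\<exists>d. gl d [rp j t] t t \<and> tr t d = \<mu>"
proof -
  let ?\<psi> = "cmp X (\<kappa> one t) [\<mu>]"
  have \<psi>: "cell ?\<psi> [rp one t, rp j one, rp one t] I one t" by (rule hat_gl[OF into_one(1) t(1) \<mu>])
  note y = yoneda_surj[OF t(1) \<psi>]
  let ?D = "cmp X ?\<psi> (companion_unit t # map (cid X) [rp j one, rp one t])"
  note f = sm_factor[OF j(1) t(1) y(1)]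
  let ?h = "cmp X ?D [conjoint_unit j, whisker j t]"
  note g = rep_factor_spec[OF f(1)]
  have "tr t (rep_factor t t ?h) = \<mu>"
    unfolding hat_iff[OF into_one(1) t(1) transpose_spec(1)[OF t g(1)] \<mu>] transpose_spec(2)[OF t g(1)] g(2) f(2) y(2) ..
  then show ?thesis using g(1) by blast
qed

section \<open>The three laws for a single structure over \<open>t\<close>\<close>

context
  fixes t d \<eta>
  assumes t: "into t" "tdom X t = A" and d: "gl d [rp j t] t t" and \<eta>: "gl \<eta> [] j t"
begin

private abbreviation "\<mu> \<equiv> tr t d"
private abbreviation "u \<equiv> rep_post X one j t \<eta>"
private abbreviation "d' \<equiv> cmp X (\<kappa> t t) [d]"
private abbreviation "e' \<equiv> cmp X (\<kappa> j t) [\<eta>]"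
private abbreviation "D \<equiv> cmp X d' [sm j t]"
private abbreviation "\<pi> \<equiv> \<kappa> one t"
private abbreviation "\<iota> \<equiv> \<kappa> j one"
private abbreviation "J \<equiv> rp j one"
private abbreviation "p \<equiv> rp one t"

private lemmas \<mu>_spec = transpose_spec[OF t d]
private lemmas dh = hat_gl[OF t(1,1) d]
private lemmas eh = hat_gl[OF j(1) t(1) \<eta>]
private lemmas s = sm_spec[OF j(1) t(1)]
private lemmas u_spec = rep_post_spec[OF into_one(1) j(1) t(1) \<eta> j(2) t(2)]
private lemmas \<pi> = rep_cell(1)[OF into_one(1) t(1)]
private lemmas \<iota> = rep_cell(1)[OF j(1) into_one(1)]
private lemmas \<kappa>1 = rep_cell(1)[OF into_one(1) j(1)]
private lemmas Jp = Jp_jux[OF t]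
private lemmas cp = p_spec(1)[OF t]

private lemma u_cell: "cell u [rp one j] p one (tid X A)"
  using u_spec(1) into_one t by simp

private lemma \<mu>_cell: "cell \<mu> [p, J, p] p one (tid X A)"
  using \<mu>_spec(1) into_one t by simp

private lemma s_cell: "cell (sm j t) [J, p] (rp j t) (tid X A) (tid X A)"
  using s(1) j t by simp

text \<open>The images of the two loose sides are \<open>star (\<kappa> one j) (star e' D)\<close>
  and \<open>star (\<kappa> one j) (star \<iota> \<pi>)\<close>. The Yoneda correspondence at
  \<open>j\<close> cancels the first factor. What remains is the image of law (i) precomposed with
  \<open>sm j t\<close>, which cancels as well.\<close>

lemma unit_law_left:
  "cmp X \<mu> [u, cid X J, cid X p] = cmp X (lunit X p) [smile X j, cid X p] \<longleftrightarrow>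
   cmp X (rep_pre X j t \<eta> t) [d] = cid X (rp j t)"
proof -
  have sj: "smile X j = star (\<kappa> one j) \<iota>"
    using j(1) by (simp add: smile_def star_def Let_def)
  have sjc: "cell (smile X j) [rp one j, J] I one one"
    using star_cell[OF \<kappa>1 \<iota>] sj by simp
  note lr = lunit_rep[OF t(1) sjc cp]
  note uJp = jux_Cons[OF u_cell Jp]
  have 1: "gl (cmp X \<mu> [u, cid X J, cid X p]) [rp one j, J, p] one t"
    using cell_post[OF \<mu>_cell uJp] oA E into_one t by simp
  have 2: "gl (cmp X (lunit X p) [smile X j, cid X p]) [rp one j, J, p] one t"
    using lr(1) into_one t by simp
  have "cmp X (star \<pi> D) ([u] @ [cid X J, cid X p]) = star (cmp X \<pi> [u]) (cmp X D [cid X J, cid X p])"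
    by (rule star_cmp[OF \<pi> \<mu>_spec(3) jux_single[OF u_cell] Jp]) simp_all
  then have 3: "cmp X \<pi> [cmp X \<mu> [u, cid X J, cid X p]] = star (\<kappa> one j) (star e' D)"
    using hat_cmp[OF into_one(1) t(1) \<mu>_cell uJp] \<mu>_spec(2) cmp_id_right[OF \<mu>_spec(3)]
      u_spec(2) star_assoc[OF \<kappa>1 eh \<mu>_spec(3)] by simp
  have 4: "cmp X \<pi> [cmp X (lunit X p) [smile X j, cid X p]] = star (\<kappa> one j) (star \<iota> \<pi>)"
    using lr(2) sj star_assoc[OF \<kappa>1 \<iota> \<pi>] hat_cid(2)[OF into_one(1) t(1)] by simp
  have c1: "cell (star e' D) [J, p] I j t" "cell (star \<iota> \<pi>) [J, p] I j t"
    using star_cell[OF eh \<mu>_spec(3)] star_cell[OF \<iota> \<pi>] by auto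
  have c2: "cell (star e' d') [rp j t] I j t" using star_cell[OF eh dh] by simp
  have 5: "star e' D = cmp X (star e' d') [sm j t]"
    using star_cmp_right[OF eh dh jux_single[OF s_cell]] oA by simp
  have pre: "gl (rep_pre X j t \<eta> t) [rp t t] j t"
    "cmp X (\<kappa> j t) [rep_pre X j t \<eta> t] = star e' (\<kappa> t t)"
    using rep_pre_spec[OF t(1) j(1) t(1) \<eta> j(2) t(2)] by auto
  have dA: "cell d [rp j t] (rp t t) (tid X A) (tid X A)" using d t by simp
  note pd = gl_cmp1[OF j(1) t(1) pre(1) dA]
  have 6: "cmp X (\<kappa> j t) [cmp X (rep_pre X j t \<eta> t) [d]] = star e' d'"
    using pd(2) pre(2) star_cmp_right[OF eh rep_cell(1)[OF t(1,1)] jux_single[OF dA]] oA by simp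
  have pd1: "gl (cmp X (rep_pre X j t \<eta> t) [d]) [rp j t] j t" using pd(1) j t by simp
  show ?thesis
    unfolding hat_iff[OF into_one(1) t(1) 1 2] 3 4 yoneda_inj[OF c1]
    unfolding 5 s(2)[symmetric]
      sm_inj[OF j(1) t(1) c2 rep_cell(1)[OF j(1) t(1)]]
      hat_iff[OF j(1) t(1) pd1 hat_cid(1)[OF j(1) t(1)]] 6 hat_cid(2)[OF j(1) t(1)] ..
qed

text \<open>The factorisation through \<open>E(j,j)\<close> is unwound first: it is
  \<open>d \<circ> E(j,\<eta>)\<close> acting on \<open>p\<close>. Precomposing it with
  \<open>frown X j\<close> then gives \<open>star \<pi>\<close> of the image of the left side of law
  (ii).\<close>

lemma unit_law_right:
  "cmp X (the_opfactor X [p] (smile_at X one j j) [] (cmp X \<mu> [cid X p, cid X J, u]))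
     [cid X p, frown X j] = cid X p \<longleftrightarrow>
   cmp X d [cmp X (rep_post X j j t \<eta>) [frown X j]] = frown X t"
proof -
  let ?w = "rep_post X j j t \<eta>" and ?\<phi> = "cmp X \<mu> [cid X p, cid X J, u]"
  have w: "cell ?w [rp j j] (rp j t) (tid X A) (tid X A)" "cmp X (\<kappa> j t) [?w] = star (\<kappa> j j) e'"
    using rep_post_spec[OF j(1) j(1) t(1) \<eta> j(2) t(2)] j t by auto
  have w': "gl ?w [rp j j] j t" using w(1) j t by simp
  have sj: "cell (sm j j) [J, rp one j] (rp j j) (tid X A) (tid X A)"
    "cmp X (\<kappa> j j) [sm j j] = star \<iota> (\<kappa> one j)"
    using sm_spec[OF j(1) j(1)] j by auto
  have dA: "cell d [rp j t] (rp t t) (tid X A) (tid X A)" using d t by simp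
  have dw: "cell (cmp X d [?w]) [rp j j] (rp t t) (tid X A) (tid X A)"
    using gl_cmp1[OF t(1) t(1) d w(1)] by simp
  have fr: "cell (frown X j) [] (rp j j) (tid X A) (tid X A)" "cmp X (\<kappa> j j) [frown X j] = tight_unit j"
    using frown_spec[OF j(1)] j by auto
  have ft: "gl (frown X t) [] t t" "cmp X (\<kappa> t t) [frown X t] = tight_unit t"
    using frown_spec[OF t(1)] by auto
  \<comment> \<open>The candidate for \<open>the_opfactor\<close>: the transposition formula with
    \<open>d \<circ> E(j,\<eta>)\<close>, now on \<open>E(j,j)\<close>, in place of
    \<open>d\<close>.\<close>
  let ?F = "cmp X (smile_at X t one t) [cid X p, cmp X d [?w]]"
  note F = smile_at_cmp[OF t(1) into_one(1) t(1) cp dw]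
  have F2: "cmp X \<pi> [?F] = star \<pi> (cmp X d' [?w])"
    using F(2) hat_cid(2)[OF into_one(1) t(1)] gl_cmp1(2)[OF t(1) t(1) d w(1)] by simp
  have F1: "cell ?F [p, rp j j] p one (tid X A)" using F(1) by simp
  have dhw: "cell (cmp X d' [?w]) [rp j j] I t t"
    using cell_pre[OF dh jux_single[OF w(1)]] oA by simp

  have Ju: "jux [cid X J, u] [J, rp one j] [J, p] (tid X A) (tid X A)"
    using jux_two[OF J_spec u_cell] by simp
  have pJu: "jux [cid X p, cid X J, u] [p, J, rp one j] [p, J, p] one (tid X A)"
    using jux_Cons[OF cp Ju] by simp
  have ps: "jux [cid X p, sm j j] [p, J, rp one j] [p, rp j j] one (tid X A)"
    using jux_two[OF cp sj(1)] by simp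
  have \<phi>: "cell ?\<phi> [p, J, rp one j] p one (tid X A)"
    using cell_post[OF \<mu>_cell pJu] oA E by simp

  \<comment> \<open>\<open>E(j,\<eta>)\<close> and \<open>u\<close> correspond under composition at
    the identity of \<open>E\<close>; both sides have image
    \<open>star \<iota> (star (\<kappa> one j) e')\<close>.\<close>
  have 1: "cmp X ?w [sm j j] = cmp X (sm j t) [cid X J, u]"
  proof (rule hat_inj_gl[OF j(1) t(1)])
    note c = smile_at_cmp[OF into_one(1) j(1) t(1) J_spec u_cell]
    show "gl (cmp X ?w [sm j j]) [J, rp one j] j t"
      using cell_post[OF w(1) jux_single[OF sj(1)]] oA j t by simp
    show "gl (cmp X (sm j t) [cid X J, u]) [J, rp one j] j t"
      using c(1) j t by simp
    have "cmp X (\<kappa> j t) [cmp X ?w [sm j j]] = cmp X (star (\<kappa> j j) e') [sm j j]"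
      using gl_cmp1(2)[OF j(1) t(1) w' sj(1)] w(2) by simp
    also have "\<dots> = star (star \<iota> (\<kappa> one j)) e'"
      using star_cmp_left[OF rep_cell(1)[OF j(1,1)] eh jux_single[OF sj(1)]] oA sj(2) by simp
    also have "\<dots> = star \<iota> (star (\<kappa> one j) e')" by (rule star_assoc[OF \<iota> \<kappa>1 eh])
    finally show "cmp X (\<kappa> j t) [cmp X ?w [sm j j]] = cmp X (\<kappa> j t) [cmp X (sm j t) [cid X J, u]]"
      using c(2) u_spec(2) hat_cid(2)[OF j(1) into_one(1)] by simp
  qed

  have 2: "cmp X ?F [cid X p, sm j j] = ?\<phi>"
  proof (rule hat_inj[OF into_one(1) t(1)])
    show "cell (cmp X ?F [cid X p, sm j j]) [p, J, rp one j] p one (tid X A)"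
      using cell_post[OF F1 ps] oA E by simp
    show "cell ?\<phi> [p, J, rp one j] p one (tid X A)" by (rule \<phi>)
    have "cmp X (star \<pi> (cmp X d' [?w])) ([cid X p] @ [sm j j]) =
        star (cmp X \<pi> [cid X p]) (cmp X (cmp X d' [?w]) [sm j j])"
      by (rule star_cmp[OF \<pi> dhw jux_single[OF cp] jux_single[OF sj(1)]]) simp_all
    moreover have "cmp X (star \<pi> D) ([cid X p] @ [cid X J, u]) =
        star (cmp X \<pi> [cid X p]) (cmp X D [cid X J, u])"
      by (rule star_cmp[OF \<pi> \<mu>_spec(3) jux_single[OF cp] Ju]) simp_all
    moreover have "cmp X (cmp X d' [?w]) [sm j j] = cmp X D [cid X J, u]"
      using assoc1[OF dh w(1) jux_single[OF sj(1)]] assoc1[OF dh s_cell Ju] 1 by simp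
    ultimately show "cmp X \<pi> [cmp X ?F [cid X p, sm j j]] = cmp X \<pi> [?\<phi>]"
      using hat_cmp[OF into_one(1) t(1) F1 ps] F2
        hat_cmp[OF into_one(1) t(1) \<mu>_cell pJu] \<mu>_spec(2) by simp
  qed

  \<comment> \<open>Existence of the factorisation is 2; uniqueness holds because
    \<open>sm j j\<close> has a section.\<close>
  have 3: "the_opfactor X [p] (sm j j) [] ?\<phi> = ?F"
    unfolding the_opfactor_def
  proof (rule the_equality)
    note k = cellD[OF \<phi>] cellD[OF sj(1)]
    show "opfactor X [p] (sm j j) [] ?\<phi> ?F"
      using F1 2 k by (simp add: opfactor_def)
    fix \<chi> assume "opfactor X [p] (sm j j) [] ?\<phi> \<chi>"
    then have c: "cell \<chi> [p, rp j j] p one (tid X A)" "cmp X \<chi> [cid X p, sm j j] = ?\<phi>"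
      using k by (auto simp: opfactor_def)
    have pl: "is_loose X p (tdom X j) E" using p_spec(2)[OF t] j by simp
    show "\<chi> = ?F"
      using sm_inj_right[OF j(1) j(1) c(1) pl] sm_inj_right[OF j(1) j(1) F1 pl] c(2) 2 by simp
  qed

  have pf: "jux [cid X p, frown X j] [p] [p, rp j j] one (tid X A)"
    using jux_two[OF cp fr(1)] by simp
  have g1: "gl (cmp X ?F [cid X p, frown X j]) [p] one t"
    using cell_post[OF F1 pf] oA E into_one t by simp
  have g2: "gl (cid X p) [p] one t" using cp into_one t by simp
  have "cmp X (star \<pi> (cmp X d' [?w])) ([cid X p] @ [frown X j]) =
      star (cmp X \<pi> [cid X p]) (cmp X (cmp X d' [?w]) [frown X j])"
    by (rule star_cmp[OF \<pi> dhw jux_single[OF cp] jux_single[OF fr(1)]]) simp_all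
  then have 4: "cmp X \<pi> [cmp X ?F [cid X p, frown X j]] = star \<pi> (cmp X (cmp X d' [?w]) [frown X j])"
    using hat_cmp[OF into_one(1) t(1) F1 pf] F2 hat_cid(2)[OF into_one(1) t(1)] by simp
  \<comment> \<open>Padding \<open>\<pi>\<close> with a unit of \<open>star\<close> gives both sides
    the form required for cancelling \<open>\<pi>\<close>.\<close>
  have 5: "cmp X \<pi> [cid X p] = star \<pi> (tight_unit t)"
    using star_unit_right[OF \<pi>] hat_cid(2)[OF into_one(1) t(1)] by simp
  have c6: "cell (cmp X (cmp X d' [?w]) [frown X j]) [] I t t"
    using cell_pre[OF dhw jux_single[OF fr(1)]] oA by simp
  have wf: "cell (cmp X ?w [frown X j]) [] (rp j t) (tid X A) (tid X A)"
    using cell_post[OF w(1) jux_single[OF fr(1)]] oA by simp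
  have dwf: "gl (cmp X d [cmp X ?w [frown X j]]) [] t t"
    using gl_cmp1(1)[OF t(1) t(1) d wf] t by simp
  have 7: "cmp X (\<kappa> t t) [cmp X d [cmp X ?w [frown X j]]] = cmp X (cmp X d' [?w]) [frown X j]"
    using gl_cmp1(2)[OF t(1) t(1) d wf] assoc1[OF dh w(1) jux_single[OF fr(1)]] by simp
  show ?thesis
    unfolding 3 hat_iff[OF into_one(1) t(1) g1 g2] 4 5 yoneda_inj[OF c6 tight_unit_cell[OF t(1)]]
      hat_iff[OF t(1) t(1) dwf ft(1)] 7 ft(2) ..
qed

text \<open>Using \<open>\<mu>\<close> in the first slot yields
  \<open>star \<pi> (star D D)\<close>, and using it in the last slot yields \<open>\<pi>\<close>
  times \<open>D\<close> precomposed with \<open>\<mu>\<close>. After \<open>\<pi>\<close> is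
  cancelled, both factor through \<open>sm\<close> on each of the two copies of
  \<open>E(j,t)\<close>, leaving the images of the two sides of law (iii).\<close>

lemma assoc_law:
  "cmp X \<mu> [\<mu>, cid X J, cid X p] = cmp X \<mu> [cid X p, cid X J, \<mu>] \<longleftrightarrow>
   cmp X (smile_at X t t t) [d, d] = cmp X d [cmp X (smile_at X t j t) [cid X (rp j t), d]]"
proof -
  have dA: "cell d [rp j t] (rp t t) (tid X A) (tid X A)" using d t by simp
  have cjt: "cell (cid X (rp j t)) [rp j t] (rp j t) (tid X A) (tid X A)"
    using hat_cid(1)[OF j(1) t(1)] j t by simp
  let ?y = "cmp X (smile_at X t j t) [cid X (rp j t), d]"
  note y0 = smile_at_cmp[OF t(1) j(1) t(1) cjt dA]
  have y: "cell ?y [rp j t, rp j t] (rp j t) (tid X A) (tid X A)"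
    "cmp X (\<kappa> j t) [?y] = star (\<kappa> j t) d'"
    using y0 hat_cid(2)[OF j(1) t(1)] by auto
  note dd = smile_at_cmp[OF t(1) t(1) t(1) dA dA]
  have ss: "jux [sm j t, sm j t] [J, p, J, p] [rp j t, rp j t] (tid X A) (tid X A)"
    using jux_two[OF s_cell s_cell] by simp
  have J\<mu>: "jux [cid X J, \<mu>] [J, p, J, p] [J, p] (tid X A) (tid X A)"
    using jux_two[OF J_spec \<mu>_cell] by simp
  have pJ\<mu>: "jux [cid X p, cid X J, \<mu>] [p, J, p, J, p] [p, J, p] one (tid X A)"
    using jux_Cons[OF cp J\<mu>] by simp
  have \<mu>Jp: "jux [\<mu>, cid X J, cid X p] [p, J, p, J, p] [p, J, p] one (tid X A)"
    using jux_Cons[OF \<mu>_cell Jp] by simp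
  \<comment> \<open>The inner \<open>\<mu>\<close> passes through \<open>sm\<close> and becomes the
    action \<open>?y\<close> of \<open>d\<close> on \<open>E(j,t)\<close>; the common image is
    \<open>star \<iota> (star \<pi> D)\<close>.\<close>
  have 1: "cmp X (sm j t) [cid X J, \<mu>] = cmp X ?y [sm j t, sm j t]"
  proof (rule hat_inj[OF j(1) t(1)])
    note c = smile_at_cmp[OF into_one(1) j(1) t(1) J_spec \<mu>_cell]
    show "cell (cmp X (sm j t) [cid X J, \<mu>]) [J, p, J, p] (rp j t) (tid X A) (tid X A)"
      using c(1) by simp
    show "cell (cmp X ?y [sm j t, sm j t]) [J, p, J, p] (rp j t) (tid X A) (tid X A)"
      using cell_post[OF y(1) ss] oA by simp
    have "cmp X (star (\<kappa> j t) d') ([sm j t] @ [sm j t]) = star (cmp X (\<kappa> j t) [sm j t]) D"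
      by (rule star_cmp[OF rep_cell(1)[OF j(1) t(1)] dh jux_single[OF s_cell] jux_single[OF s_cell]])
        simp_all
    also have "\<dots> = star \<iota> (star \<pi> D)"
      unfolding s(2) by (rule star_assoc[OF \<iota> \<pi> \<mu>_spec(3)])
    finally show "cmp X (\<kappa> j t) [cmp X (sm j t) [cid X J, \<mu>]] = cmp X (\<kappa> j t) [cmp X ?y [sm j t, sm j t]]"
      using c(2) \<mu>_spec(2) hat_cid(2)[OF j(1) into_one(1)] hat_cmp[OF j(1) t(1) y(1) ss] y(2) by simp
  qed
  have g1: "gl (cmp X \<mu> [\<mu>, cid X J, cid X p]) [p, J, p, J, p] one t"
    using cell_post[OF \<mu>_cell \<mu>Jp] oA E into_one t by simp
  have g2: "gl (cmp X \<mu> [cid X p, cid X J, \<mu>]) [p, J, p, J, p] one t"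
    using cell_post[OF \<mu>_cell pJ\<mu>] oA E into_one t by simp
  have "cmp X (star \<pi> D) ([\<mu>] @ [cid X J, cid X p]) = star (cmp X \<pi> [\<mu>]) (cmp X D [cid X J, cid X p])"
    by (rule star_cmp[OF \<pi> \<mu>_spec(3) jux_single[OF \<mu>_cell] Jp]) simp_all
  then have 2: "cmp X \<pi> [cmp X \<mu> [\<mu>, cid X J, cid X p]] = star \<pi> (star D D)"
    using hat_cmp[OF into_one(1) t(1) \<mu>_cell \<mu>Jp] \<mu>_spec(2) cmp_id_right[OF \<mu>_spec(3)]
      star_assoc[OF \<pi> \<mu>_spec(3,3)] by simp
  have "cmp X (star \<pi> D) ([cid X p] @ [cid X J, \<mu>]) = star (cmp X \<pi> [cid X p]) (cmp X D [cid X J, \<mu>])"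
    by (rule star_cmp[OF \<pi> \<mu>_spec(3) jux_single[OF cp] J\<mu>]) simp_all
  then have 3: "cmp X \<pi> [cmp X \<mu> [cid X p, cid X J, \<mu>]] = star \<pi> (cmp X D [cid X J, \<mu>])"
    using hat_cmp[OF into_one(1) t(1) \<mu>_cell pJ\<mu>] \<mu>_spec(2) hat_cid(2)[OF into_one(1) t(1)] by simp
  have 4: "cmp X D [cid X J, \<mu>] = cmp X (cmp X d' [?y]) [sm j t, sm j t]"
    using assoc1[OF dh s_cell J\<mu>] assoc1[OF dh y(1) ss] 1 by simp
  have "cmp X (star d' d') ([sm j t] @ [sm j t]) = star D D"
    by (rule star_cmp[OF dh dh jux_single[OF s_cell] jux_single[OF s_cell]]) simp_all
  then have 5: "star D D = cmp X (star d' d') [sm j t, sm j t]" by simp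
  have c1: "cell (star D D) [J, p, J, p] I t t" "cell (cmp X D [cid X J, \<mu>]) [J, p, J, p] I t t"
    using star_cell[OF \<mu>_spec(3,3)] cell_pre[OF \<mu>_spec(3) J\<mu>] oA by auto
  have c2: "cell (star d' d') [rp j t, rp j t] I t t" "cell (cmp X d' [?y]) [rp j t, rp j t] I t t"
    using star_cell[OF dh dh] cell_pre[OF dh jux_single[OF y(1)]] oA by auto
  have g3: "gl (cmp X (smile_at X t t t) [d, d]) [rp j t, rp j t] t t"
    using dd(1) t by simp
  have g4: "gl (cmp X d [?y]) [rp j t, rp j t] t t"
    using gl_cmp1(1)[OF t(1) t(1) d y(1)] t by simp
  have jt: "tdom X j = tdom X t" using j t by simp
  show ?thesis
    unfolding hat_iff[OF into_one(1) t(1) g1 g2] 2 3 yoneda_inj[OF c1]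
    unfolding 4 5 sm_sm_inj[OF j(1) t(1) jt c2]
      hat_iff[OF t(1) t(1) g3 g4] dd(2) gl_cmp1(2)[OF t(1) t(1) d y(1)] ..
qed

end

text \<open>By associativity of \<open>star\<close>, both sides have images starting with
  \<open>\<kappa> one j\<close>. Cancelling it leaves the images of
  \<open>tight_vcomp X j t t' \<eta> \<tau>\<close> and of \<open>\<eta>'\<close>.\<close>

lemma hom_unit_law:
  assumes t: "into t" "tdom X t = A" and t': "into t'" "tdom X t' = A"
    and \<eta>: "gl \<eta> [] j t" and \<eta>': "gl \<eta>' [] j t'" and \<tau>: "gl \<tau> [] t t'"
  shows "cmp X (rep_post X one t t' \<tau>) [rep_post X one j t \<eta>] = rep_post X one j t' \<eta>' \<longleftrightarrow>
    tight_vcomp X j t t' \<eta> \<tau> = \<eta>'"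
proof -
  note T = rep_post_spec[OF into_one(1) t(1) t'(1) \<tau> t(2) t'(2)]
  note u = rep_post_spec[OF into_one(1) j(1) t(1) \<eta> j(2) t(2)]
  note u' = rep_post_spec[OF into_one(1) j(1) t'(1) \<eta>' j(2) t'(2)]
  note v = tight_vcomp_spec[OF j(1) t(1) t'(1) \<eta> \<tau>]
  note eh = hat_gl[OF j(1) t(1) \<eta>] and eh' = hat_gl[OF j(1) t'(1) \<eta>'] and th = hat_gl[OF t(1) t'(1) \<tau>]
  note \<kappa>1 = rep_cell(1)[OF into_one(1) j(1)]
  have uA: "cell (rep_post X one j t \<eta>) [rp one j] (rp one t) one (tid X A)"
    using u(1) into_one t by simp
  note c = gl_cmp1[OF into_one(1) t'(1) T(1) uA]
  have c1: "gl (cmp X (rep_post X one t t' \<tau>) [rep_post X one j t \<eta>]) [rp one j] one t'"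
    using c(1) into_one t' by simp
  have "cmp X (\<kappa> one t') [cmp X (rep_post X one t t' \<tau>) [rep_post X one j t \<eta>]] =
      star (cmp X (\<kappa> one t) [rep_post X one j t \<eta>]) (cmp X (\<kappa> t t') [\<tau>])"
    using c(2) T(2) star_cmp_left[OF rep_cell(1)[OF into_one(1) t(1)] th jux_single[OF uA]] oA by simp
  also have "\<dots> = star (\<kappa> one j) (star (cmp X (\<kappa> j t) [\<eta>]) (cmp X (\<kappa> t t') [\<tau>]))"
    using u(2) star_assoc[OF \<kappa>1 eh th] by simp
  finally have 1: "cmp X (\<kappa> one t') [cmp X (rep_post X one t t' \<tau>) [rep_post X one j t \<eta>]] =
      star (\<kappa> one j) (star (cmp X (\<kappa> j t) [\<eta>]) (cmp X (\<kappa> t t') [\<tau>]))" .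
  have c2: "cell (star (cmp X (\<kappa> j t) [\<eta>]) (cmp X (\<kappa> t t') [\<tau>])) [] I j t'"
    using star_cell[OF eh th] by simp
  show ?thesis
    unfolding hat_iff[OF into_one(1) t'(1) c1 u'(1)] 1 u'(2) yoneda_inj[OF c2 eh']
      hat_iff[OF j(1) t'(1) v(1) \<eta>'] v(2) ..
qed

text \<open>On the left, \<open>\<tau>\<close> ends up to the right of \<open>?D\<close>. On the
  right, the outer copy of \<open>?T\<close> puts \<open>\<tau>\<close> in front of
  \<open>?D'\<close>, and the inner copy turns into \<open>E(j,\<tau>)\<close> when moved through
  \<open>sm\<close>. Cancelling \<open>\<kappa> one t\<close> and then \<open>sm j t\<close> leaves
  the law for relative monads.\<close>

lemma hom_mult_law:
  assumes t: "into t" "tdom X t = A" and t': "into t'" "tdom X t' = A"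
    and d: "gl d [rp j t] t t" and d': "gl d' [rp j t'] t' t'" and \<tau>: "gl \<tau> [] t t'"
  shows "cmp X (rep_post X one t t' \<tau>) [tr t d] =
      cmp X (tr t' d') [rep_post X one t t' \<tau>, cid X (rp j one), rep_post X one t t' \<tau>] \<longleftrightarrow>
    cmp X (rep_post X t t t' \<tau>) [d] = cmp X (rep_pre X t t' \<tau> t') [cmp X d' [rep_post X j t t' \<tau>]]"
proof -
  let ?T = "rep_post X one t t' \<tau>" and ?J = "rp j one" and ?p = "rp one t" and ?p' = "rp one t'"
  let ?d = "cmp X (\<kappa> t t) [d]" and ?d' = "cmp X (\<kappa> t' t') [d']" and ?th = "cmp X (\<kappa> t t') [\<tau>]"
  let ?R = "rep_post X j t t' \<tau>"
  let ?D = "cmp X ?d [sm j t]" and ?D' = "cmp X ?d' [sm j t']"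
  note T = rep_post_spec[OF into_one(1) t(1) t'(1) \<tau> t(2) t'(2)]
  note R = rep_post_spec[OF j(1) t(1) t'(1) \<tau> t(2) t'(2)]
  note th = hat_gl[OF t(1) t'(1) \<tau>]
  note \<mu> = transpose_spec[OF t d] and \<mu>' = transpose_spec[OF t' d']
  note dh = hat_gl[OF t(1,1) d] and dh' = hat_gl[OF t'(1,1) d']
  note \<pi> = rep_cell(1)[OF into_one(1) t(1)] and \<pi>' = rep_cell(1)[OF into_one(1) t'(1)]
  note \<iota> = rep_cell(1)[OF j(1) into_one(1)]
  have TA: "cell ?T [?p] ?p' one (tid X A)" using T(1) into_one t' by simp
  have RA: "cell ?R [rp j t] (rp j t') (tid X A) (tid X A)" using R(1) j t' by simp
  have dA: "cell d [rp j t] (rp t t) (tid X A) (tid X A)" using d t by simp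
  have \<mu>A: "cell (tr t d) [?p, ?J, ?p] ?p one (tid X A)" using \<mu>(1) into_one t by simp
  have \<mu>A': "cell (tr t' d') [?p', ?J, ?p'] ?p' one (tid X A)" using \<mu>'(1) into_one t' by simp
  have s: "cell (sm j t) [?J, ?p] (rp j t) (tid X A) (tid X A)"
    "cmp X (\<kappa> j t) [sm j t] = star (\<kappa> j one) (\<kappa> one t)"
    using sm_spec[OF j(1) t(1)] j t by auto
  have s': "cell (sm j t') [?J, ?p'] (rp j t') (tid X A) (tid X A)"
    "cmp X (\<kappa> j t') [sm j t'] = star (\<kappa> j one) (\<kappa> one t')"
    using sm_spec[OF j(1) t'(1)] j t' by auto
  have JT: "jux [cid X ?J, ?T] [?J, ?p] [?J, ?p'] (tid X A) (tid X A)"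
    using jux_two[OF J_spec TA] by simp
  have TJT: "jux [?T, cid X ?J, ?T] [?p, ?J, ?p] [?p', ?J, ?p'] one (tid X A)"
    using jux_Cons[OF TA JT] by simp

  have g1: "gl (cmp X ?T [tr t d]) [?p, ?J, ?p] one t'"
    using cell_post[OF TA jux_single[OF \<mu>A]] oA E into_one t' by simp
  have g2: "gl (cmp X (tr t' d') [?T, cid X ?J, ?T]) [?p, ?J, ?p] one t'"
    using cell_post[OF \<mu>A' TJT] oA E into_one t' by simp
  have "cmp X (\<kappa> one t') [cmp X ?T [tr t d]] = cmp X (star (\<kappa> one t) ?th) [tr t d]"
    using gl_cmp1(2)[OF into_one(1) t'(1) T(1) \<mu>A] T(2) by simp
  also have "\<dots> = star (star (\<kappa> one t) ?D) ?th"
    using star_cmp_left[OF \<pi> th jux_single[OF \<mu>A]] \<mu>(2) oA by simp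
  also have "\<dots> = star (\<kappa> one t) (star ?D ?th)"
    by (rule star_assoc[OF \<pi> \<mu>(3) th])
  finally have 1: "cmp X (\<kappa> one t') [cmp X ?T [tr t d]] = star (\<kappa> one t) (star ?D ?th)" .
  have D'JT: "cell (cmp X ?D' [cid X ?J, ?T]) [?J, ?p] I t' t'"
    using cell_pre[OF \<mu>'(3) JT] oA by simp
  have "cmp X (star (\<kappa> one t') ?D') ([?T] @ [cid X ?J, ?T]) =
      star (cmp X (\<kappa> one t') [?T]) (cmp X ?D' [cid X ?J, ?T])"
    by (rule star_cmp[OF \<pi>' \<mu>'(3) jux_single[OF TA] JT]) simp_all
  then have 2: "cmp X (\<kappa> one t') [cmp X (tr t' d') [?T, cid X ?J, ?T]] =
      star (\<kappa> one t) (star ?th (cmp X ?D' [cid X ?J, ?T]))"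
    using hat_cmp[OF into_one(1) t'(1) \<mu>A' TJT] \<mu>'(2) T(2) star_assoc[OF \<pi> th D'JT] by simp
  \<comment> \<open>Naturality of \<open>sm\<close> in its second argument; the common image is
    \<open>star (\<kappa> j one) (star (\<kappa> one t) ?th)\<close>.\<close>
  have 3: "cmp X (sm j t') [cid X ?J, ?T] = cmp X ?R [sm j t]"
  proof (rule hat_inj[OF j(1) t'(1)])
    note c = smile_at_cmp[OF into_one(1) j(1) t'(1) J_spec TA]
    show "cell (cmp X (sm j t') [cid X ?J, ?T]) [?J, ?p] (rp j t') (tid X A) (tid X A)"
      using c(1) by simp
    show "cell (cmp X ?R [sm j t]) [?J, ?p] (rp j t') (tid X A) (tid X A)"
      using cell_post[OF RA jux_single[OF s(1)]] oA by simp
    have "cmp X (\<kappa> j t') [cmp X ?R [sm j t]] = star (star (\<kappa> j one) (\<kappa> one t)) ?th"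
      using gl_cmp1(2)[OF j(1) t'(1) R(1) s(1)] R(2) s(2) oA
        star_cmp_left[OF rep_cell(1)[OF j(1) t(1)] th jux_single[OF s(1)]] by simp
    also have "\<dots> = star (\<kappa> j one) (star (\<kappa> one t) ?th)" by (rule star_assoc[OF \<iota> \<pi> th])
    finally show "cmp X (\<kappa> j t') [cmp X (sm j t') [cid X ?J, ?T]] = cmp X (\<kappa> j t') [cmp X ?R [sm j t]]"
      using c(2) T(2) hat_cid(2)[OF j(1) into_one(1)] by simp
  qed
  have dR: "cell (cmp X ?d' [?R]) [rp j t] I t' t'"
    using cell_pre[OF dh' jux_single[OF RA]] oA by simp
  have "cmp X ?D' [cid X ?J, ?T] = cmp X (cmp X ?d' [?R]) [sm j t]"
    using assoc1[OF dh' s'(1) JT] assoc1[OF dh' RA jux_single[OF s(1)]] 3 by simp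
  then have 4: "star ?th (cmp X ?D' [cid X ?J, ?T]) = cmp X (star ?th (cmp X ?d' [?R])) [sm j t]"
    using star_cmp_right[OF th dR jux_single[OF s(1)]] oA by simp
  have 5: "star ?D ?th = cmp X (star ?d ?th) [sm j t]"
    using star_cmp_left[OF dh th jux_single[OF s(1)]] oA by simp
  have c1: "cell (star ?D ?th) [?J, ?p] I t t'" "cell (star ?th (cmp X ?D' [cid X ?J, ?T])) [?J, ?p] I t t'"
    using star_cell[OF \<mu>(3) th] star_cell[OF th D'JT] by auto
  have c2: "cell (star ?d ?th) [rp j t] I t t'" "cell (star ?th (cmp X ?d' [?R])) [rp j t] I t t'"
    using star_cell[OF dh th] star_cell[OF th dR] by auto

  note P = rep_post_spec[OF t(1) t(1) t'(1) \<tau> t(2) t'(2)]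
  note Q = rep_pre_spec[OF t'(1) t(1) t'(1) \<tau> t(2) t'(2)]
  have d'R: "cell (cmp X d' [?R]) [rp j t] (rp t' t') (tid X A) (tid X A)"
    using gl_cmp1(1)[OF t'(1,1) d' RA] by simp
  have g3: "gl (cmp X (rep_post X t t t' \<tau>) [d]) [rp j t] t t'"
    using gl_cmp1(1)[OF t(1) t'(1) P(1) dA] t t' by simp
  have g4: "gl (cmp X (rep_pre X t t' \<tau> t') [cmp X d' [?R]]) [rp j t] t t'"
    using gl_cmp1(1)[OF t(1) t'(1) Q(1) d'R] t t' by simp
  have 6: "cmp X (\<kappa> t t') [cmp X (rep_post X t t t' \<tau>) [d]] = star ?d ?th"
    using gl_cmp1(2)[OF t(1) t'(1) P(1) dA] P(2) oA
      star_cmp_left[OF rep_cell(1)[OF t(1,1)] th jux_single[OF dA]] by simp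
  have 7: "cmp X (\<kappa> t t') [cmp X (rep_pre X t t' \<tau> t') [cmp X d' [?R]]] = star ?th (cmp X ?d' [?R])"
    using gl_cmp1(2)[OF t(1) t'(1) Q(1) d'R] Q(2) oA gl_cmp1(2)[OF t'(1,1) d' RA]
      star_cmp_right[OF th rep_cell(1)[OF t'(1,1)] jux_single[OF d'R]] by simp
  show ?thesis
    unfolding hat_iff[OF into_one(1) t'(1) g1 g2] 1 2 yoneda_inj[OF c1]
    unfolding 4 5 sm_inj[OF j(1) t(1) c2] hat_iff[OF t(1) t'(1) g3 g4] 6 7 ..
qed

end
end

section \<open>Pullbacks of categories of structured objects\<close>

lemma Hom_hom_cat:
  "x \<in> Hom (hom_cat S H i m) a b \<longleftrightarrow> (\<exists>\<phi>. x = (a, \<phi>, b) \<and> a \<in> S \<and> b \<in> S \<and> \<phi> \<in> H a b)"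
  by (auto simp: Hom_def hom_cat_def)

lemma hom_cat_simps [simp]:
  "Obj (hom_cat S H i m) = S"
  "Id (hom_cat S H i m) a = (a, i a, a)"
  "Comp (hom_cat S H i m) (b, \<psi>, c) (a, \<phi>, b') = (a, m a b c \<phi> \<psi>, c)"
  "Dom (hom_cat S H i m) (a, \<phi>, b) = a"
  "Cod (hom_cat S H i m) (a, \<phi>, b) = b"
  "(a, \<phi>, b) \<in> Arr (hom_cat S H i m) \<longleftrightarrow> a \<in> S \<and> b \<in> S \<and> \<phi> \<in> H a b"
  by (auto simp: hom_cat_def)

lemma Arr_hom_cat: "x \<in> Arr (hom_cat S H i m) \<longleftrightarrow> (\<exists>a \<phi> b. x = (a, \<phi>, b) \<and> a \<in> S \<and> b \<in> S \<and> \<phi> \<in> H a b)"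
  by (auto simp: hom_cat_def)

lemma hom_cat_category:
  assumes "\<And>a. a \<in> S \<Longrightarrow> i a \<in> H a a"
    and "\<And>a b c \<phi> \<psi>. a \<in> S \<Longrightarrow> b \<in> S \<Longrightarrow> c \<in> S \<Longrightarrow> \<phi> \<in> H a b \<Longrightarrow> \<psi> \<in> H b c \<Longrightarrow> m a b c \<phi> \<psi> \<in> H a c"
    and "\<And>a b \<phi>. a \<in> S \<Longrightarrow> b \<in> S \<Longrightarrow> \<phi> \<in> H a b \<Longrightarrow> m a b b \<phi> (i b) = \<phi>"
    and "\<And>a b \<phi>. a \<in> S \<Longrightarrow> b \<in> S \<Longrightarrow> \<phi> \<in> H a b \<Longrightarrow> m a a b (i a) \<phi> = \<phi>"
    and "\<And>a b c d \<phi> \<psi> \<chi>. a \<in> S \<Longrightarrow> b \<in> S \<Longrightarrow> c \<in> S \<Longrightarrow> d \<in> S \<Longrightarrow>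
      \<phi> \<in> H a b \<Longrightarrow> \<psi> \<in> H b c \<Longrightarrow> \<chi> \<in> H c d \<Longrightarrow>
      m a c d (m a b c \<phi> \<psi>) \<chi> = m a b d \<phi> (m b c d \<psi> \<chi>)"
  shows "category (hom_cat S H i m)"
  by unfold_locales (auto simp: Hom_hom_cat Arr_hom_cat assms)

lemma hom_functor_simps [simp]:
  "FO (hom_functor o' h) a = o' a"
  "FA (hom_functor o' h) (a, \<phi>, b) = (o' a, h a b \<phi>, o' b)"
  by (auto simp: hom_functor_def)

lemma hom_functor_is_functor:
  assumes "category (hom_cat S H i m)" "category (hom_cat S' H' i' m')"
    and "\<And>a. a \<in> S \<Longrightarrow> o' a \<in> S'"
    and "\<And>a b \<phi>. a \<in> S \<Longrightarrow> b \<in> S \<Longrightarrow> \<phi> \<in> H a b \<Longrightarrow> h a b \<phi> \<in> H' (o' a) (o' b)"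
    and "\<And>a. a \<in> S \<Longrightarrow> h a a (i a) = i' (o' a)"
    and "\<And>a b c \<phi> \<psi>. a \<in> S \<Longrightarrow> b \<in> S \<Longrightarrow> c \<in> S \<Longrightarrow> \<phi> \<in> H a b \<Longrightarrow> \<psi> \<in> H b c \<Longrightarrow>
      h a c (m a b c \<phi> \<psi>) = m' (o' a) (o' b) (o' c) (h a b \<phi>) (h b c \<psi>)"
  shows "is_functor (hom_cat S H i m) (hom_cat S' H' i' m') (hom_functor o' h)"
  using assms(1,2) by (intro is_functor.intro) (auto simp: Hom_hom_cat assms(3-))

lemma hom_functor_fully_faithful:
  assumes "is_functor (hom_cat S H i m) (hom_cat S' H' i' m') (hom_functor o' h)"
    and "\<And>a b. a \<in> S \<Longrightarrow> b \<in> S \<Longrightarrow> bij_betw (h a b) (H a b) (H' (o' a) (o' b))"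
  shows "fully_faithful (hom_cat S H i m) (hom_cat S' H' i' m') (hom_functor o' h)"
  unfolding fully_faithful_def
proof (intro conjI ballI assms(1))
  fix a b assume "a \<in> Obj (hom_cat S H i m)" "b \<in> Obj (hom_cat S H i m)"
  then have ab: "a \<in> S" "b \<in> S" by auto
  interpret F: is_functor "hom_cat S H i m" "hom_cat S' H' i' m'" "hom_functor o' h" by fact
  have o: "o' a \<in> S'" "o' b \<in> S'" using F.obj ab by auto
  have "Hom (hom_cat S H i m) a b = (\<lambda>\<phi>. (a, \<phi>, b)) ` H a b"
    "Hom (hom_cat S' H' i' m') (o' a) (o' b) = (\<lambda>\<phi>. (o' a, \<phi>, o' b)) ` H' (o' a) (o' b)"
    using ab o by (auto simp: Hom_hom_cat)
  then show "bij_betw (FA (hom_functor o' h)) (Hom (hom_cat S H i m) a b)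
      (Hom (hom_cat S' H' i' m') (FO (hom_functor o' h) a) (FO (hom_functor o' h) b))"
    using assms(2)[OF ab] by (auto simp: bij_betw_def inj_on_def image_image)
qed

text \<open>Here \<open>SP'\<close> holds raw structures over objects of \<open>C\<close>, and the
  laws enter only through \<open>SP\<close>, as the requirement that the image under
  \<open>oH\<close> lie in \<open>SB\<close>. Both \<open>inj\<close> and \<open>surj\<close>
  concern a fixed object of \<open>C\<close>, because \<open>oF\<close> may identify objects. Full
  faithfulness of \<open>K\<close> comes along, since the arrows of \<open>P\<close> are the arrows
  of \<open>C\<close> whose image lies in \<open>HB\<close>.\<close>

lemma hom_cat_pullback:
  fixes SB :: "('d \<times> 'y) set" and SP :: "('c \<times> 'x) set"
    and HB :: "'d \<times> 'y \<Rightarrow> 'd \<times> 'y \<Rightarrow> 'n set" and h :: "'c \<Rightarrow> 'c \<Rightarrow> 'm \<Rightarrow> 'n"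
    and SC SD HC HD HP iC iD mC mD oF oH SP'
  defines "P \<equiv> hom_cat SP HP (\<lambda>M. iC (fst M)) (\<lambda>M M' M''. mC (fst M) (fst M') (fst M''))"
    and "B \<equiv> hom_cat SB HB (\<lambda>N. iD (fst N)) (\<lambda>N N' N''. mD (fst N) (fst N') (fst N''))"
    and "C \<equiv> hom_cat SC HC iC mC"
    and "D \<equiv> hom_cat SD HD iD mD"
    and "F \<equiv> hom_functor oF h"
    and "K \<equiv> hom_functor oH (\<lambda>M M'. h (fst M) (fst M'))"
  assumes FF: "fully_faithful C D F"
    and B: "category B"
    and SB: "\<And>N. N \<in> SB \<Longrightarrow> fst N \<in> SD"
    and HB: "\<And>N N'. N \<in> SB \<Longrightarrow> N' \<in> SB \<Longrightarrow> HB N N' \<subseteq> HD (fst N) (fst N')"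
    and SP: "\<And>M. M \<in> SP \<longleftrightarrow> M \<in> SP' \<and> oH M \<in> SB"
    and SP': "\<And>M. M \<in> SP' \<Longrightarrow> fst M \<in> SC \<and> fst (oH M) = oF (fst M)"
    and HP: "\<And>M M'. M \<in> SP \<Longrightarrow> M' \<in> SP \<Longrightarrow>
      HP M M' = {\<tau> \<in> HC (fst M) (fst M'). h (fst M) (fst M') \<tau> \<in> HB (oH M) (oH M')}"
    and inj: "\<And>M M'. M \<in> SP' \<Longrightarrow> M' \<in> SP' \<Longrightarrow> fst M = fst M' \<Longrightarrow> oH M = oH M' \<Longrightarrow> M = M'"
    and surj: "\<And>t N. t \<in> SC \<Longrightarrow> N \<in> SB \<Longrightarrow> fst N = oF t \<Longrightarrow> \<exists>M \<in> SP'. fst M = t \<and> oH M = N"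
  shows "pullback_square TYPE('zo \<times> 'za) P B C D K forget forget F \<and> fully_faithful P B K"
proof -
  have F: "is_functor C D F" using FF by (simp add: fully_faithful_def)
  interpret F: is_functor C D F by (rule F)
  interpret C: category C by (rule F.source)
  interpret D: category D by (rule F.target)
  interpret B: category B by (rule B)
  have SPD: "fst M \<in> SC" "oH M \<in> SB" "fst (oH M) = oF (fst M)" if "M \<in> SP" for M
    using that SP SP' by auto
  have HPD: "\<tau> \<in> HC (fst M) (fst M')" "h (fst M) (fst M') \<tau> \<in> HB (oH M) (oH M')"
    if "M \<in> SP" "M' \<in> SP" "\<tau> \<in> HP M M'" for M M' \<tau>
    using HP that by auto
  have Fid: "h a a (iC a) = iD (oF a)" if "a \<in> SC" for a
    using F.preserves_id[of a] that by (simp add: F_def C_def D_def)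
  have Fcomp: "h a c (mC a b c \<phi> \<psi>) = mD (oF a) (oF b) (oF c) (h a b \<phi>) (h b c \<psi>)"
    if "a \<in> SC" "b \<in> SC" "c \<in> SC" "\<phi> \<in> HC a b" "\<psi> \<in> HC b c" for a b c \<phi> \<psi>
    using F.preserves_comp[of "(a, \<phi>, b)" a b "(b, \<psi>, c)" c] that
    by (simp add: F_def C_def D_def Hom_hom_cat)
  have Cid: "iC a \<in> HC a a" if "a \<in> SC" for a
    using C.id_in_hom[of a] that by (simp add: C_def Hom_hom_cat)
  have Ccomp: "mC a b c \<phi> \<psi> \<in> HC a c"
    if "a \<in> SC" "b \<in> SC" "c \<in> SC" "\<phi> \<in> HC a b" "\<psi> \<in> HC b c" for a b c \<phi> \<psi>
    using C.comp_in_hom[of "(a, \<phi>, b)" a b "(b, \<psi>, c)" c] that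
    by (simp add: C_def Hom_hom_cat)
  have Cl: "mC a b b \<phi> (iC b) = \<phi>" "mC a a b (iC a) \<phi> = \<phi>" if "a \<in> SC" "b \<in> SC" "\<phi> \<in> HC a b" for a b \<phi>
    using C.id_left[of "(a, \<phi>, b)" a b] C.id_right[of "(a, \<phi>, b)" a b] that
    by (simp_all add: C_def Hom_hom_cat)
  have Ca: "mC a c d (mC a b c \<phi> \<psi>) \<chi> = mC a b d \<phi> (mC b c d \<psi> \<chi>)"
    if "a \<in> SC" "b \<in> SC" "c \<in> SC" "d \<in> SC" "\<phi> \<in> HC a b" "\<psi> \<in> HC b c" "\<chi> \<in> HC c d" for a b c d \<phi> \<psi> \<chi>
    using C.assoc[of "(a, \<phi>, b)" a b "(b, \<psi>, c)" c "(c, \<chi>, d)" d] that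
    by (simp add: C_def Hom_hom_cat)
  have Bid: "iD (fst N) \<in> HB N N" if "N \<in> SB" for N
    using B.id_in_hom[of N] that by (simp add: B_def Hom_hom_cat)
  have Bcomp: "mD (fst a) (fst b) (fst c) \<phi> \<psi> \<in> HB a c"
    if "a \<in> SB" "b \<in> SB" "c \<in> SB" "\<phi> \<in> HB a b" "\<psi> \<in> HB b c" for a b c \<phi> \<psi>
    using B.comp_in_hom[of "(a, \<phi>, b)" a b "(b, \<psi>, c)" c] that
    by (simp add: B_def Hom_hom_cat)
  \<comment> \<open>Strips the endpoints from the triples that encode arrows, so that full
    faithfulness becomes a statement about \<open>h\<close>.\<close>
  have Fbij: "bij_betw (h a b) (HC a b) (HD (oF a) (oF b))" if ab: "a \<in> SC" "b \<in> SC" for a b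
  proof -
    have "oF a \<in> SD" "oF b \<in> SD" using F.obj ab by (auto simp: C_def D_def F_def)
    then have e: "Hom C a b = (\<lambda>\<phi>. (a, \<phi>, b)) ` HC a b"
      "Hom D (oF a) (oF b) = (\<lambda>\<phi>. (oF a, \<phi>, oF b)) ` HD (oF a) (oF b)"
      using ab by (auto simp: Hom_hom_cat C_def D_def)
    have "bij_betw (FA F) (Hom C a b) (Hom D (oF a) (oF b))"
      using FF ab by (auto simp: fully_faithful_def C_def F_def)
    then have bb: "inj_on (FA F) ((\<lambda>\<phi>. (a, \<phi>, b)) ` HC a b)"
      "FA F ` (\<lambda>\<phi>. (a, \<phi>, b)) ` HC a b = (\<lambda>\<phi>. (oF a, \<phi>, oF b)) ` HD (oF a) (oF b)"
      unfolding e bij_betw_def by auto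
    have "inj_on (h a b) (HC a b)" using bb(1) by (auto simp: inj_on_def F_def)
    moreover have "h a b ` HC a b = HD (oF a) (oF b)"
    proof -
      have "(\<lambda>\<phi>. (oF a, \<phi>, oF b)) ` h a b ` HC a b = (\<lambda>\<phi>. (oF a, \<phi>, oF b)) ` HD (oF a) (oF b)"
        using bb(2) by (simp add: image_image F_def)
      then show ?thesis by (simp add: inj_image_eq_iff inj_def)
    qed
    ultimately show ?thesis by (simp add: bij_betw_def)
  qed
  have P: "category P"
    unfolding P_def
  proof (rule hom_cat_category)
    fix M assume "M \<in> SP"
    then show "iC (fst M) \<in> HP M M"
      using SPD[of M] Cid Fid Bid[of "oH M"] by (simp add: HP)
  next
    fix a b c \<phi> \<psi>
    assume o: "a \<in> SP" "b \<in> SP" "c \<in> SP" and m: "\<phi> \<in> HP a b" "\<psi> \<in> HP b c"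
    note [simp] = o[THEN SPD(1)] o[THEN SPD(2)] HPD[OF o(1,2) m(1)] HPD[OF o(2,3) m(2)]
    show "mC (fst a) (fst b) (fst c) \<phi> \<psi> \<in> HP a c"
      using o Bcomp[of "oH a" "oH b" "oH c", OF _ _ _ HPD(2)[OF o(1,2) m(1)] HPD(2)[OF o(2,3) m(2)]]
      by (simp add: HP Ccomp Fcomp o[THEN SPD(3)])
  qed (auto simp: SPD HPD Cl Ca dest: HPD(1))
  have PB: "is_functor P B K"
    unfolding P_def B_def K_def
  proof (rule hom_functor_is_functor[OF P[unfolded P_def] B[unfolded B_def]])
    fix a b c \<phi> \<psi>
    assume o: "a \<in> SP" "b \<in> SP" "c \<in> SP" and m: "\<phi> \<in> HP a b" "\<psi> \<in> HP b c"
    then show "h (fst a) (fst c) (mC (fst a) (fst b) (fst c) \<phi> \<psi>) =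
        mD (fst (oH a)) (fst (oH b)) (fst (oH c)) (h (fst a) (fst b) \<phi>) (h (fst b) (fst c) \<psi>)"
      by (simp add: Fcomp SPD HPD)
  qed (auto simp: SPD HPD Fid)
  have PC: "is_functor P C forget"
    unfolding P_def C_def forget_def
    by (rule hom_functor_is_functor[OF P[unfolded P_def] F.source[unfolded C_def]])
      (auto simp: SPD HPD)
  have BD: "is_functor B D forget"
    unfolding B_def D_def forget_def
    by (rule hom_functor_is_functor[OF B[unfolded B_def] F.target[unfolded D_def]])
      (use SB HB[THEN subsetD] in auto)
  have sq: "functor_eq P (fcomp forget K) (fcomp F forget)"
    by (auto simp: functor_eq_def fcomp_def P_def Arr_hom_cat forget_def K_def F_def SPD)
  have KF: "fully_faithful P B K"
    unfolding P_def B_def K_def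
  proof (rule hom_functor_fully_faithful[OF PB[unfolded P_def B_def K_def]])
    fix M M' assume o: "M \<in> SP" "M' \<in> SP"
    note b = Fbij[OF o[THEN SPD(1)]]
    \<comment> \<open>Every structure-preserving arrow is in particular an arrow of
      \<open>D\<close>, hence has a preimage under \<open>h\<close>.\<close>
    have "HB (oH M) (oH M') \<subseteq> h (fst M) (fst M') ` HC (fst M) (fst M')"
      using HB[OF o[THEN SPD(2)]] b o[THEN SPD(3)] by (simp add: bij_betw_def)
    then show "bij_betw (h (fst M) (fst M')) (HP M M') (HB (oH M) (oH M'))"
      using b by (auto simp: HP[OF o] bij_betw_def inj_on_def)
  qed
  have univ: "\<exists>W. is_functor Z P W \<and> functor_eq Z (fcomp K W) U \<and> functor_eq Z (fcomp forget W) V \<and>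
      (\<forall>W'. is_functor Z P W' \<and> functor_eq Z (fcomp K W') U \<and> functor_eq Z (fcomp forget W') V \<longrightarrow>
        functor_eq Z W' W)"
    if U: "is_functor Z B U" and V: "is_functor Z C V"
      and UV: "functor_eq Z (fcomp forget U) (fcomp F V)"
    for Z :: "('zo, 'za) cat" and U V
  proof -
    interpret U: is_functor Z B U by (rule U)
    interpret V: is_functor Z C V by (rule V)
    interpret Z: category Z by (rule U.source)
    interpret PP: category P by (rule P)
    \<comment> \<open>Commutativity over \<open>D\<close> forces the 2-cell of \<open>FA U f\<close>
      to be \<open>h\<close> of the 2-cell of \<open>FA V f\<close>, so \<open>V\<close> alone
      determines what \<open>W\<close> must do to the 2-cell of an arrow.\<close>
    have Ar: "FA U f = (FO U (Dom Z f), h (FO V (Dom Z f)) (FO V (Cod Z f)) (fst (snd (FA V f))), FO U (Cod Z f))"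
      "FA V f = (FO V (Dom Z f), fst (snd (FA V f)), FO V (Cod Z f))"
      "fst (snd (FA V f)) \<in> HC (FO V (Dom Z f)) (FO V (Cod Z f))"
      "h (FO V (Dom Z f)) (FO V (Cod Z f)) (fst (snd (FA V f))) \<in> HB (FO U (Dom Z f)) (FO U (Cod Z f))"
      if "f \<in> Arr Z" for f
    proof -
      have f: "f \<in> Hom Z (Dom Z f) (Cod Z f)" using that by (simp add: Hom_def)
      obtain \<tau> where \<tau>: "FA V f = (FO V (Dom Z f), \<tau>, FO V (Cod Z f))"
        "\<tau> \<in> HC (FO V (Dom Z f)) (FO V (Cod Z f))"
        using V.arr[OF f] by (auto simp: C_def Hom_hom_cat)
      obtain T where T: "FA U f = (FO U (Dom Z f), T, FO U (Cod Z f))"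
        "T \<in> HB (FO U (Dom Z f)) (FO U (Cod Z f))"
        using U.arr[OF f] by (auto simp: B_def Hom_hom_cat)
      have "T = h (FO V (Dom Z f)) (FO V (Cod Z f)) \<tau>"
        using UV that \<tau>(1) T(1) by (auto simp: functor_eq_def fcomp_def forget_def F_def)
      then show "FA U f = (FO U (Dom Z f), h (FO V (Dom Z f)) (FO V (Cod Z f)) (fst (snd (FA V f))), FO U (Cod Z f))"
      "FA V f = (FO V (Dom Z f), fst (snd (FA V f)), FO V (Cod Z f))"
      "fst (snd (FA V f)) \<in> HC (FO V (Dom Z f)) (FO V (Cod Z f))"
      "h (FO V (Dom Z f)) (FO V (Cod Z f)) (fst (snd (FA V f))) \<in> HB (FO U (Dom Z f)) (FO U (Cod Z f))"
        using \<tau> T by auto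
    qed
    have "\<exists>M. M \<in> SP \<and> fst M = FO V z \<and> oH M = FO U z" if "z \<in> Obj Z" for z
    proof -
      have "FO V z \<in> SC" "FO U z \<in> SB"
        using U.obj[OF that] V.obj[OF that] by (auto simp: B_def C_def)
      moreover have "fst (FO U z) = oF (FO V z)"
        using UV that by (auto simp: functor_eq_def fcomp_def forget_def F_def)
      ultimately obtain M where "M \<in> SP'" "fst M = FO V z" "oH M = FO U z" using surj by blast
      then show ?thesis using SP[of M] \<open>FO U z \<in> SB\<close> by (intro exI[of _ M]) auto
    qed
    then obtain w where w: "\<And>z. z \<in> Obj Z \<Longrightarrow> w z \<in> SP" "\<And>z. z \<in> Obj Z \<Longrightarrow> fst (w z) = FO V z"
      "\<And>z. z \<in> Obj Z \<Longrightarrow> oH (w z) = FO U z"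
      by metis
    \<comment> \<open>Objects are the lifts supplied by \<open>surj\<close>, and 2-cells are taken
      over from \<open>V\<close>. That they lie in \<open>HP\<close> is the content of the last two
      parts of \<open>Ar\<close>.\<close>
    define W where "W = \<lparr>FO = w, FA = (\<lambda>f. (w (Dom Z f), fst (snd (FA V f)), w (Cod Z f)))\<rparr>"
    have Wo [simp]: "FO W z = w z" and Wa: "FA W f = (w (Dom Z f), fst (snd (FA V f)), w (Cod Z f))" for z f
      by (simp_all add: W_def)
    have W: "is_functor Z P W"
    proof (intro is_functor.intro)
      show "category Z" "category P" by (rule U.source, rule P)
    next
      fix a assume a: "a \<in> Obj Z"
      then show "FO W a \<in> Obj P" using w by (simp add: P_def)
      have i: "Dom Z (Id Z a) = a" "Cod Z (Id Z a) = a"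
        using Z.id_in_hom[OF a] by (auto simp: Hom_def)
      show "FA W (Id Z a) = Id P (FO W a)"
        using V.preserves_id[OF a] w(2)[OF a] i by (simp add: Wa P_def C_def)
    next
      fix f a b assume f: "f \<in> Hom Z a b"
      then have *: "f \<in> Arr Z" "Dom Z f = a" "Cod Z f = b" by (auto simp: Hom_def)
      then have o: "a \<in> Obj Z" "b \<in> Obj Z" using Z.ends by auto
      show "FA W f \<in> Hom P (FO W a) (FO W b)"
        using Ar(3,4)[OF *(1)] o * by (simp add: Wa P_def Hom_hom_cat w HP)
    next
      fix f a b g c assume f: "f \<in> Hom Z a b" and g: "g \<in> Hom Z b c"
      then have *: "f \<in> Arr Z" "Dom Z f = a" "Cod Z f = b" "g \<in> Arr Z" "Dom Z g = b" "Cod Z g = c"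
        by (auto simp: Hom_def)
      then have o: "a \<in> Obj Z" "b \<in> Obj Z" "c \<in> Obj Z" using Z.ends by auto
      have gf: "Dom Z (Comp Z g f) = a" "Cod Z (Comp Z g f) = c"
        using Z.comp_in_hom[OF f g] by (auto simp: Hom_def)
      have "FA V (Comp Z g f) = Comp C (FO V b, fst (snd (FA V g)), FO V c) (FO V a, fst (snd (FA V f)), FO V b)"
        using V.preserves_comp[OF f g] Ar(2)[OF *(1)] Ar(2)[OF *(4)] * by simp
      then show "FA W (Comp Z g f) = Comp P (FA W g) (FA W f)"
        using * o gf by (simp add: Wa P_def C_def w)
    qed
    have 1: "functor_eq Z (fcomp K W) U"
      unfolding functor_eq_def
    proof (intro conjI ballI)
      fix f assume f: "f \<in> Arr Z"
      then have "Dom Z f \<in> Obj Z" "Cod Z f \<in> Obj Z" using Z.ends by auto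
      then show "FA (fcomp K W) f = FA U f"
        using Ar(1)[OF f] by (simp add: fcomp_def K_def Wa w)
    qed (simp add: fcomp_def K_def w)
    have 2: "functor_eq Z (fcomp forget W) V"
      unfolding functor_eq_def
    proof (intro conjI ballI)
      fix f assume f: "f \<in> Arr Z"
      then have "Dom Z f \<in> Obj Z" "Cod Z f \<in> Obj Z" using Z.ends by auto
      then show "FA (fcomp forget W) f = FA V f"
        using Ar(2)[OF f] by (simp add: fcomp_def forget_def Wa w)
    qed (simp add: fcomp_def forget_def w)
    have 3: "functor_eq Z W' W"
      if W': "is_functor Z P W'" and k: "functor_eq Z (fcomp K W') U"
        and f: "functor_eq Z (fcomp forget W') V" for W'
    proof -
      interpret W': is_functor Z P W' by (rule W')
      \<comment> \<open>Two lifts of the same pair of objects agree after \<open>fst\<close> and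
        after \<open>oH\<close>, which is the situation of \<open>inj\<close>.\<close>
      have ob: "FO W' z = w z" if z: "z \<in> Obj Z" for z
      proof (rule inj)
        show "FO W' z \<in> SP'" "w z \<in> SP'"
          using W'.obj[OF z] w(1)[OF z] SP by (auto simp: P_def)
        show "fst (FO W' z) = fst (w z)" "oH (FO W' z) = oH (w z)"
          using k f z w by (auto simp: functor_eq_def fcomp_def forget_def K_def)
      qed
      have "FA W' g = FA W g" if g: "g \<in> Arr Z" for g
      proof -
        have gh: "g \<in> Hom Z (Dom Z g) (Cod Z g)" using g by (simp add: Hom_def)
        obtain \<tau> where \<tau>: "FA W' g = (FO W' (Dom Z g), \<tau>, FO W' (Cod Z g))"
          using W'.arr[OF gh] by (auto simp: P_def Hom_hom_cat)
        have "FA forget (FA W' g) = FA V g"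
          using f g by (auto simp: functor_eq_def fcomp_def)
        then have "FA V g = (fst (FO W' (Dom Z g)), \<tau>, fst (FO W' (Cod Z g)))"
          unfolding \<tau> by (simp add: forget_def)
        then have "fst (snd (FA V g)) = \<tau>" by simp
        then show ?thesis using \<tau> ob Z.ends[OF g] by (simp add: Wa)
      qed
      then show ?thesis using ob by (simp add: functor_eq_def)
    qed
    show ?thesis using W 1 2 3 by blast
  qed
  show ?thesis
    unfolding pullback_square_def using PB PC BD F sq univ KF by blast
qed

section \<open>The square of relative monads\<close>

context equipment_at
begin

lemma into_iff: "is_tight X t A E \<longleftrightarrow> into t \<and> tdom X t = A"
  by (auto simp: is_tight_def)

text \<open>On images in the cells into \<open>I\<close>, composition is \<open>star\<close> and the
  identities are its units, so the category laws are those of \<open>star\<close>.\<close>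

lemma tight_category: "category (tight_cat X A E)"
  unfolding tight_cat_def
proof (rule hom_cat_category, unfold mem_Collect_eq into_iff)
  fix a assume "into a \<and> tdom X a = A"
  then show "tight_2cell X (frown X a) a a"
    using frown_spec(1)[of a] by (simp add: tight_2cell_def globular_rep)
next
  fix a b c \<phi> \<psi>
  assume a: "into a \<and> tdom X a = A" and b: "into b \<and> tdom X b = A" and c: "into c \<and> tdom X c = A"
    and "tight_2cell X \<phi> a b" "tight_2cell X \<psi> b c"
  then show "tight_2cell X (tight_vcomp X a b c \<phi> \<psi>) a c"
    using tight_vcomp_spec(1)[of a b c \<phi> \<psi>] by (simp add: tight_2cell_def globular_rep)
next
  fix a b \<phi>
  assume "into a \<and> tdom X a = A" "into b \<and> tdom X b = A" and "tight_2cell X \<phi> a b"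
  then have a: "into a" and b: "into b" and p: "gl \<phi> [] a b"
    by (simp_all add: tight_2cell_def globular_rep)
  note h = hat_gl[OF a b p]
  note v1 = tight_vcomp_spec[OF a b b p frown_spec(1)[OF b]]
  show "tight_vcomp X a b b \<phi> (frown X b) = \<phi>"
    unfolding hat_iff[OF a b v1(1) p] v1(2) frown_spec(2)[OF b] by (rule star_unit_right[OF h])
  note v2 = tight_vcomp_spec[OF a a b frown_spec(1)[OF a] p]
  show "tight_vcomp X a a b (frown X a) \<phi> = \<phi>"
    unfolding hat_iff[OF a b v2(1) p] v2(2) frown_spec(2)[OF a] by (rule star_unit_left[OF h])
next
  fix a b c d \<phi> \<psi> \<chi>
  assume "into a \<and> tdom X a = A" "into b \<and> tdom X b = A" "into c \<and> tdom X c = A"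
    "into d \<and> tdom X d = A" "tight_2cell X \<phi> a b" "tight_2cell X \<psi> b c" "tight_2cell X \<chi> c d"
  then have a: "into a" and b: "into b" and c: "into c" and d: "into d"
    and p: "gl \<phi> [] a b" and q: "gl \<psi> [] b c" and r: "gl \<chi> [] c d"
    by (simp_all add: tight_2cell_def globular_rep)
  note pq = tight_vcomp_spec[OF a b c p q] and qr = tight_vcomp_spec[OF b c d q r]
  note l = tight_vcomp_spec[OF a c d pq(1) r] and m = tight_vcomp_spec[OF a b d p qr(1)]
  show "tight_vcomp X a c d (tight_vcomp X a b c \<phi> \<psi>) \<chi> = tight_vcomp X a b d \<phi> (tight_vcomp X b c d \<psi> \<chi>)"
    unfolding hat_iff[OF a d l(1) m(1)] l(2) m(2) pq(2) qr(2)
    by (rule star_assoc[OF hat_gl[OF a b p] hat_gl[OF b c q] hat_gl[OF c d r]])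
qed

lemma globular_loose:
  "is_loose X q A B \<Longrightarrow> globular X \<phi> \<Gamma> q \<longleftrightarrow> cell \<phi> \<Gamma> q (tid X B) (tid X A)"
  by (simp add: globular_def is_loose_def)

lemma globular_cmp:
  assumes "globular X \<phi> [p] q" "globular X \<psi> [q] r" "is_loose X q A B" "is_loose X r A B"
  shows "globular X (cmp X \<psi> [\<phi>]) [p] r"
proof -
  have "A \<in> Ob X" "B \<in> Ob X" using assms(3) loose_ends by (auto simp: is_loose_def)
  then show ?thesis
    using cell_post[OF _ jux_single, of \<psi> q r B A \<phi> "[p]"] assms
    by (simp add: globular_loose)
qed

lemma globular_cmp_assoc:
  assumes "globular X \<phi> \<Gamma> q" "globular X \<psi> [q] r" "globular X \<chi> [r] s"
    "is_loose X q A B" "is_loose X r A B" "is_loose X s A B"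
  shows "cmp X (cmp X \<chi> [\<psi>]) [\<phi>] = cmp X \<chi> [cmp X \<psi> [\<phi>]]"
  using assoc1[OF _ _ jux_single, of \<chi> r s "tid X B" "tid X A" \<psi> q "tid X B" "tid X A" \<phi> \<Gamma>] assms
  by (simp add: globular_loose)

lemma loose_category: "category (loose_cat X A E)"
  unfolding loose_cat_def
proof (rule hom_cat_category, unfold mem_Collect_eq)
  fix p assume "is_loose X p A E"
  then show "globular X (cid X p) [p] p" by (auto intro: cell_id simp: is_loose_def)
next
  fix p q \<phi> assume "is_loose X p A E" "is_loose X q A E" "globular X \<phi> [p] q"
  then have c: "cell \<phi> [p] q one (tid X A)" by (simp add: globular_loose)
  show "cmp X (cid X q) [\<phi>] = \<phi>" "cmp X \<phi> [cid X p] = \<phi>"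
    using comp_id_left[OF c] cmp_id_right[OF c] by auto
qed (auto intro: globular_cmp globular_cmp_assoc[symmetric])

text \<open>Functoriality reduces to the right unit law and associativity of \<open>star\<close>;
  bijectivity on arrows is \<open>rep_post_one_bij\<close>.\<close>

lemma tight_to_loose_ff: "fully_faithful (tight_cat X A E) (loose_cat X A E) (tight_to_loose X E)"
  unfolding tight_cat_def loose_cat_def tight_to_loose_def
proof (rule hom_functor_fully_faithful[OF hom_functor_is_functor], unfold mem_Collect_eq)
  show "category (hom_cat {f. is_tight X f A E} (\<lambda>f g. {\<phi>. tight_2cell X \<phi> f g}) (frown X) (tight_vcomp X))"
    using tight_category by (simp add: tight_cat_def)
  show "category (hom_cat {p. is_loose X p A E} (\<lambda>p q. {\<phi>. globular X \<phi> [p] q}) (cid X)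
      (\<lambda>p q r \<phi> \<psi>. cmp X \<psi> [\<phi>]))"
    using loose_category by (simp add: loose_cat_def)
next
  fix t assume "is_tight X t A E"
  then have t: "into t" "tdom X t = A" by (auto simp: into_iff)
  show "is_loose X (rp one t) A E"
    using rep_cell(3)[OF into_one(1) t(1)] t(2) into_one(2) by simp
  note f = frown_spec[OF t(1)]
  note r = rep_post_spec[OF into_one(1) t(1) t(1) f(1) t(2) t(2)]
  show "rep_post X one t t (frown X t) = cid X (rp one t)"
    unfolding hat_iff[OF into_one(1) t(1) r(1) hat_cid(1)[OF into_one(1) t(1)]] r(2) f(2)
      hat_cid(2)[OF into_one(1) t(1)] by (rule star_unit_right[OF rep_cell(1)[OF into_one(1) t(1)]])
next
  fix t t' assume "is_tight X t A E" "is_tight X t' A E"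
  then have t: "into t" "tdom X t = A" and t': "into t'" "tdom X t' = A" by (auto simp: into_iff)
  show b: "bij_betw (rep_post X one t t') {\<phi>. tight_2cell X \<phi> t t'} {\<phi>. globular X \<phi> [rp one t] (rp one t')}"
    using rep_post_one_bij[OF t t']
    by (simp add: tight_2cell_def globular_rep t(1) t'(1) into_one)
  show "globular X (rep_post X one t t' \<phi>) [rp one t] (rp one t')" if "tight_2cell X \<phi> t t'" for \<phi>
    using bij_betwE[OF b] that by simp
next
  fix a b c \<phi> \<psi>
  assume "is_tight X a A E" "is_tight X b A E" "is_tight X c A E"
    "tight_2cell X \<phi> a b" "tight_2cell X \<psi> b c"
  then have a: "into a" "tdom X a = A" and b: "into b" "tdom X b = A" and c: "into c" "tdom X c = A"
    and p: "gl \<phi> [] a b" and q: "gl \<psi> [] b c"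
    by (simp_all add: into_iff tight_2cell_def globular_rep)
  note o = into_one(1)
  note pq = tight_vcomp_spec[OF a(1) b(1) c(1) p q]
  note l = rep_post_spec[OF o a(1) c(1) pq(1) a(2) c(2)]
  note P = rep_post_spec[OF o a(1) b(1) p a(2) b(2)]
  note Q = rep_post_spec[OF o b(1) c(1) q b(2) c(2)]
  have A: "A \<in> Ob X" using into_dom a by auto
  have PA: "cell (rep_post X one a b \<phi>) [rp one a] (rp one b) one (tid X A)"
    using P(1) b into_one(2) by simp
  note m = gl_cmp1[OF o c(1) Q(1) PA]
  have m1: "gl (cmp X (rep_post X one b c \<psi>) [rep_post X one a b \<phi>]) [rp one a] one c"
    using m(1) c into_one(2) by simp
  note ph = hat_gl[OF a(1) b(1) p] and qh = hat_gl[OF b(1) c(1) q]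
  have "cmp X (\<kappa> one c) [cmp X (rep_post X one b c \<psi>) [rep_post X one a b \<phi>]] =
      star (star (\<kappa> one a) (cmp X (\<kappa> a b) [\<phi>])) (cmp X (\<kappa> b c) [\<psi>])"
    using m(2) Q(2) P(2) star_cmp_left[OF rep_cell(1)[OF o b(1)] qh jux_single[OF PA]] A by simp
  then show "rep_post X one a c (tight_vcomp X a b c \<phi> \<psi>) =
      cmp X (rep_post X one b c \<psi>) [rep_post X one a b \<phi>]"
    unfolding hat_iff[OF o c(1) l(1) m1] l(2) pq(2)
    using star_assoc[OF rep_cell(1)[OF o a(1)] ph qh] by simp
qed

section \<open>The square for a fixed \<open>j\<close>\<close>

context
  fixes j A
  assumes j: "into j" "tdom X j = A"
begin

lemma J_loose: "is_loose X (rp j one) E A"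
  using rep_cell(3)[OF j(1) into_one(1)] j(2) into_one(2) by simp

lemma loose_rel_monad_category: "category (LRMnd X j)"
  unfolding LRMnd_def
proof (rule hom_cat_category, unfold mem_Collect_eq)
  fix a assume a: "loose_rel_monad X j a"
  obtain p \<mu> u where e: "a = (p, \<mu>, u)" by (cases a)
  have p: "is_loose X p A E" and \<mu>: "globular X \<mu> [p, rp j one, p] p" and u: "globular X u [rp one j] p"
    using a j by (auto simp: e loose_rel_monad_def Let_def)
  have c: "cell \<mu> [p, rp j one, p] p one (tid X A)" "cell u [rp one j] p one (tid X A)"
    using \<mu> u p by (simp_all add: globular_loose)
  show "cid X (fst a) \<in> loose_rel_monad_hom X j a a"
    using comp_id_left[OF c(1)] comp_id_left[OF c(2)] cmp_id_right[OF c(1)] cell_id p j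
    by (simp add: e loose_rel_monad_hom_def is_loose_def)
next
  fix a b c \<phi> \<psi>
  assume o: "loose_rel_monad X j a" "loose_rel_monad X j b" "loose_rel_monad X j c"
    and \<phi>: "\<phi> \<in> loose_rel_monad_hom X j a b" and \<psi>: "\<psi> \<in> loose_rel_monad_hom X j b c"
  obtain p \<mu> u p' \<mu>' u' p'' \<mu>'' u'' where e: "a = (p, \<mu>, u)" "b = (p', \<mu>', u')" "c = (p'', \<mu>'', u'')"
    by (cases a, cases b, cases c) blast
  let ?J = "rp j one"
  have l: "is_loose X p A E" "is_loose X p' A E" "is_loose X p'' A E"
    and m: "globular X \<mu> [p, ?J, p] p" "globular X \<mu>' [p', ?J, p'] p'" "globular X \<mu>'' [p'', ?J, p''] p''"
    and u: "globular X u [rp one j] p" "globular X u' [rp one j] p'"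
    using o j by (auto simp: e loose_rel_monad_def Let_def)
  have g: "globular X \<phi> [p] p'" "globular X \<psi> [p'] p''"
    and h: "cmp X \<phi> [u] = u'" "cmp X \<psi> [u'] = u''"
      "cmp X \<phi> [\<mu>] = cmp X \<mu>' [\<phi>, cid X ?J, \<phi>]" "cmp X \<psi> [\<mu>'] = cmp X \<mu>'' [\<psi>, cid X ?J, \<psi>]"
    using \<phi> \<psi> j by (auto simp: e loose_rel_monad_hom_def)
  have A: "A \<in> Ob X" using into_dom j by auto
  have c: "cell \<phi> [p] p' one (tid X A)" "cell \<psi> [p'] p'' one (tid X A)"
    "cell \<mu> [p, ?J, p] p one (tid X A)" "cell \<mu>' [p', ?J, p'] p' one (tid X A)"
    "cell \<mu>'' [p'', ?J, p''] p'' one (tid X A)"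
    using g m l by (simp_all add: globular_loose)
  note cJ = cell_cid[OF J_loose]
  have "cmp X (cmp X \<psi> [\<phi>]) [u] = u''"
    using globular_cmp_assoc[OF u(1) g l] h by simp
  moreover have "cmp X (cmp X \<psi> [\<phi>]) [\<mu>] = cmp X \<mu>'' [cmp X \<psi> [\<phi>], cid X ?J, cmp X \<psi> [\<phi>]]"
  proof -
    have jx: "jux [\<phi>, cid X ?J, \<phi>] [p, ?J, p] [p', ?J, p'] one (tid X A)"
      using jux_Cons[OF c(1) jux_two[OF cJ c(1)]] by simp
    have "cmp X (cmp X \<psi> [\<phi>]) [\<mu>] = cmp X \<psi> [cmp X \<mu>' [\<phi>, cid X ?J, \<phi>]]"
      using globular_cmp_assoc[OF m(1) g l] h by simp
    \<comment> \<open>The multiplication square of \<open>\<psi>\<close> is applied after that of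
      \<open>\<phi>\<close>; the next step merges the two layers slot by slot, with an identity in
      the middle slot.\<close>
    also have "\<dots> = cmp X (cmp X \<mu>'' [\<psi>, cid X ?J, \<psi>]) ([\<phi>] @ [cid X ?J] @ [\<phi>])"
      using assoc1[OF c(2) c(4) jx] h by simp
    also have "\<dots> = cmp X \<mu>'' [cmp X \<psi> [\<phi>], cmp X (cid X ?J) [cid X ?J], cmp X \<psi> [\<phi>]]"
      by (rule assoc3[OF c(5) c(2) cJ c(2) jux_single[OF c(1)] jux_single[OF cJ] jux_single[OF c(1)]])
        simp_all
    finally show ?thesis using comp_id_left[OF cJ] by simp
  qed
  ultimately show "cmp X \<psi> [\<phi>] \<in> loose_rel_monad_hom X j a c"
    using globular_cmp[OF g l(2,3)] j by (simp add: e loose_rel_monad_hom_def)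
next
  fix a b \<phi> assume "loose_rel_monad X j a" "loose_rel_monad X j b" "\<phi> \<in> loose_rel_monad_hom X j a b"
  then have c: "cell \<phi> [fst a] (fst b) one (tid X A)"
    using j by (auto simp: loose_rel_monad_def loose_rel_monad_hom_def Let_def globular_loose)
  show "cmp X (cid X (fst b)) [\<phi>] = \<phi>" "cmp X \<phi> [cid X (fst a)] = \<phi>"
    using comp_id_left[OF c] cmp_id_right[OF c] by auto
next
  fix a b c d \<phi> \<psi> \<chi>
  assume "loose_rel_monad X j a" "loose_rel_monad X j b" "loose_rel_monad X j c" "loose_rel_monad X j d"
    "\<phi> \<in> loose_rel_monad_hom X j a b" "\<psi> \<in> loose_rel_monad_hom X j b c" "\<chi> \<in> loose_rel_monad_hom X j c d"
  then have l: "is_loose X (fst b) A E" "is_loose X (fst c) A E" "is_loose X (fst d) A E"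
    and g: "globular X \<phi> [fst a] (fst b)" "globular X \<psi> [fst b] (fst c)" "globular X \<chi> [fst c] (fst d)"
    using j by (auto simp: loose_rel_monad_def loose_rel_monad_hom_def Let_def)
  show "cmp X \<chi> [cmp X \<psi> [\<phi>]] = cmp X (cmp X \<chi> [\<psi>]) [\<phi>]"
    using globular_cmp_assoc[OF g l] by simp
qed

lemma rel_monad_iff:
  assumes "into t" "tdom X t = A" "gl d [rp j t] t t" "gl \<eta> [] j t"
  shows "rel_monad X j (t, d, \<eta>) \<longleftrightarrow>
    loose_rel_monad X j (rp one t, transpose_ext X j t d, rep_post X one j t \<eta>)"
proof -
  have l: "is_loose X (rp one t) A E"
    using rep_cell(3)[OF into_one(1) assms(1)] assms(2) into_one(2) by simp
  have g: "globular X (transpose_ext X j t d) [rp one t, rp j one, rp one t] (rp one t)"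
    "globular X (rep_post X one j t \<eta>) [rp one j] (rp one t)"
    using transpose_spec(1)[OF j assms(1-3)] rep_post_spec(1)[OF into_one(1) j(1) assms(1,4) j(2) assms(2)]
    by (simp_all add: globular_rep[OF into_one(1) assms(1)])
  have r: "is_tight X t A E" "globular X d [rp j t] (rp t t)" "tight_2cell X \<eta> j t"
    using assms j by (simp_all add: into_iff globular_rep tight_2cell_def)
  show ?thesis
    using l g r unit_law_left[OF j assms] unit_law_right[OF j assms] assoc_law[OF j assms] j
    by (simp add: rel_monad_def loose_rel_monad_def Let_def)
qed

lemma pullback:
  "pullback_square TYPE('zo \<times> 'za) (RMnd X j) (LRMnd X j) (tight_cat X A E) (loose_cat X A E)
     (RMnd_to_LRMnd X j) forget forget (tight_to_loose X E) \<and>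
   fully_faithful (RMnd X j) (LRMnd X j) (RMnd_to_LRMnd X j)"
proof -
  let ?H = "\<lambda>(t, d, \<eta>). (rp one t, transpose_ext X j t d, rep_post X one j t \<eta>)"
  \<comment> \<open>Raw data of the right types with no laws imposed, playing the part of
    \<open>SP'\<close>. On these, transposition and \<open>E(1,-)\<close> are already injective over
    each \<open>t\<close>.\<close>
  let ?S = "{(t, d, \<eta>). into t \<and> tdom X t = A \<and> gl d [rp j t] t t \<and> gl \<eta> [] j t}"
  have jE: "tcod X j = E" using j by simp
  have up: "RMnd_to_LRMnd X j = hom_functor ?H (\<lambda>M M'. rep_post X one (fst M) (fst M'))"
    by (simp add: RMnd_to_LRMnd_def jE Let_def)
  have RS: "M \<in> ?S" if "rel_monad X j M" for M
  proof -
    obtain t d \<eta> where e: "M = (t, d, \<eta>)" by (cases M)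
    have "is_tight X t A E" "globular X d [rp j t] (rp t t)" "tight_2cell X \<eta> j t"
      using that by (simp_all add: e rel_monad_def jE j(2))
    then show ?thesis using j(1) by (simp add: e into_iff globular_rep tight_2cell_def)
  qed
  show ?thesis
    unfolding up RMnd_def LRMnd_def tight_cat_def loose_cat_def tight_to_loose_def
  proof (rule hom_cat_pullback[where SP' = ?S and SP = "{M. rel_monad X j M}" and HP = "rel_monad_hom X j"
        and SB = "{M. loose_rel_monad X j M}" and HB = "loose_rel_monad_hom X j"
        and SC = "{f. is_tight X f A E}" and HC = "\<lambda>f g. {\<phi>. tight_2cell X \<phi> f g}"
        and iC = "frown X" and mC = "tight_vcomp X"
        and SD = "{p. is_loose X p A E}" and HD = "\<lambda>p q. {\<phi>. globular X \<phi> [p] q}"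
        and iD = "cid X" and mD = "\<lambda>p q r \<phi> \<psi>. cmp X \<psi> [\<phi>]"
        and oF = "rp one" and h = "rep_post X one" and oH = ?H])
    show "fully_faithful
       (hom_cat {f. is_tight X f A E} (\<lambda>f g. {\<phi>. tight_2cell X \<phi> f g}) (frown X) (tight_vcomp X))
       (hom_cat {p. is_loose X p A E} (\<lambda>p q. {\<phi>. globular X \<phi> [p] q}) (cid X) (\<lambda>p q r \<phi> \<psi>. cmp X \<psi> [\<phi>]))
       (hom_functor (rp one) (rep_post X one))"
      using tight_to_loose_ff by (simp add: tight_cat_def loose_cat_def tight_to_loose_def)
    show "category (hom_cat {M. loose_rel_monad X j M} (loose_rel_monad_hom X j) (\<lambda>M. cid X (fst M))
        (\<lambda>M M' M'' \<phi> \<psi>. cmp X \<psi> [\<phi>]))"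
      using loose_rel_monad_category by (simp add: LRMnd_def)
  next
    fix N assume "N \<in> {M. loose_rel_monad X j M}"
    then show "fst N \<in> {p. is_loose X p A E}"
      by (cases N) (simp add: loose_rel_monad_def Let_def jE j(2))
  next
    fix N N'
    show "loose_rel_monad_hom X j N N' \<subseteq> {\<phi>. globular X \<phi> [fst N] (fst N')}"
      by (cases N, cases N') (auto simp: loose_rel_monad_hom_def)
  next
    fix M
    show "M \<in> {M. rel_monad X j M} \<longleftrightarrow> M \<in> ?S \<and> ?H M \<in> {M. loose_rel_monad X j M}"
    proof (cases M)
      case (fields t d \<eta>)
      have "rel_monad X j M \<longleftrightarrow> loose_rel_monad X j (?H M)" if "M \<in> ?S"
      proof -
        have "into t" "tdom X t = A" "gl d [rp j t] t t" "gl \<eta> [] j t"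
          using that unfolding fields mem_Collect_eq prod.case by blast+
        from rel_monad_iff[OF this] show ?thesis by (simp add: fields)
      qed
      then show ?thesis using RS[of M] by blast
    qed
  next
    fix M assume "M \<in> ?S"
    then show "fst M \<in> {f. is_tight X f A E} \<and> fst (?H M) = rp one (fst M)"
      by (auto simp: into_iff)
  next
    fix M M' assume "M \<in> {M. rel_monad X j M}" "M' \<in> {M. rel_monad X j M}"
    then have S: "M \<in> ?S" "M' \<in> ?S" using RS by auto
    obtain t d \<eta> t' d' \<eta>' where e: "M = (t, d, \<eta>)" "M' = (t', d', \<eta>')" by (cases M, cases M') blast
    have t: "into t" "tdom X t = A" and t': "into t'" "tdom X t' = A"
      and d: "gl d [rp j t] t t" and d': "gl d' [rp j t'] t' t'"
      and \<eta>: "gl \<eta> [] j t" and \<eta>': "gl \<eta>' [] j t'"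
      using S by (auto simp: e)
    have gT: "globular X (rep_post X one t t' \<tau>) [rp one t] (rp one t')" if "gl \<tau> [] t t'" for \<tau>
      using rep_post_spec(1)[OF into_one(1) t(1) t'(1) that t(2) t'(2)]
      by (simp add: globular_rep[OF into_one(1) t'(1)])
    show "rel_monad_hom X j M M' = {\<tau> \<in> {\<phi>. tight_2cell X \<phi> (fst M) (fst M')}.
        rep_post X one (fst M) (fst M') \<tau> \<in> loose_rel_monad_hom X j (?H M) (?H M')}"
    proof (rule set_eqI)
      fix \<tau>
      \<comment> \<open>The translation of the morphism laws presupposes the frame of
        \<open>\<tau>\<close>, so the equivalence is first shown for cells
        \<open>t \<Rightarrow> t'\<close>; the next two facts supply that frame in either
        direction.\<close>
      have "\<tau> \<in> rel_monad_hom X j M M' \<longleftrightarrow> rep_post X one t t' \<tau> \<in> loose_rel_monad_hom X j (?H M) (?H M')"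
        if "gl \<tau> [] t t'"
        using hom_unit_law[OF j t t' \<eta> \<eta>' that] hom_mult_law[OF j t t' d d' that] gT[OF that] that
        by (simp add: e rel_monad_hom_def loose_rel_monad_hom_def jE tight_2cell_def
            globular_rep[OF t(1) t'(1)])
      moreover have "\<tau> \<in> rel_monad_hom X j M M' \<Longrightarrow> gl \<tau> [] t t'"
        by (simp add: e rel_monad_hom_def tight_2cell_def globular_rep[OF t(1) t'(1)])
      moreover have "tight_2cell X \<tau> t t' \<longleftrightarrow> gl \<tau> [] t t'"
        by (simp add: tight_2cell_def globular_rep[OF t(1) t'(1)])
      ultimately show "\<tau> \<in> rel_monad_hom X j M M' \<longleftrightarrow>
          \<tau> \<in> {\<tau> \<in> {\<phi>. tight_2cell X \<phi> (fst M) (fst M')}.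
            rep_post X one (fst M) (fst M') \<tau> \<in> loose_rel_monad_hom X j (?H M) (?H M')}"
        unfolding mem_Collect_eq e fst_conv by blast
    qed
  next
    fix M M' assume S: "M \<in> ?S" "M' \<in> ?S" and q: "fst M = fst M'" "?H M = ?H M'"
    obtain t d \<eta> d' \<eta>' where e: "M = (t, d, \<eta>)" "M' = (t, d', \<eta>')"
      using q(1) by (cases M, cases M') auto
    have t: "into t" "tdom X t = A" and d: "gl d [rp j t] t t" "gl d' [rp j t] t t"
      and \<eta>: "gl \<eta> [] j t" "gl \<eta>' [] j t"
      using S by (auto simp: e)
    have "d = d'" using transpose_inj[OF j t d] q(2) by (simp add: e)
    moreover have "\<eta> = \<eta>'"
      using rep_post_one_bij[OF j t] q(2) \<eta> by (auto simp: e bij_betw_def inj_on_def)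
    ultimately show "M = M'" by (simp add: e)
  next
    fix t N assume "t \<in> {f. is_tight X f A E}" "N \<in> {M. loose_rel_monad X j M}" "fst N = rp one t"
    then obtain \<mu> u where t: "into t" "tdom X t = A" and N: "N = (rp one t, \<mu>, u)"
      and L: "loose_rel_monad X j (rp one t, \<mu>, u)"
      by (cases N) (auto simp: into_iff)
    have \<mu>: "gl \<mu> [rp one t, rp j one, rp one t] one t" and u: "gl u [rp one j] one t"
      using L by (simp_all add: loose_rel_monad_def Let_def jE globular_rep[OF into_one(1) t(1)])
    obtain d where d: "gl d [rp j t] t t" "transpose_ext X j t d = \<mu>"
      using transpose_surj[OF j t \<mu>] by blast
    \<comment> \<open>The unit \<open>u\<close> is an arrow from \<open>E(1,j)\<close> to
      \<open>E(1,t)\<close>, so full faithfulness of \<open>E(1,-)\<close> at \<open>j\<close> and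
      \<open>t\<close> supplies \<open>\<eta>\<close>.\<close>
    have "u \<in> rep_post X one j t ` {\<eta>. gl \<eta> [] j t}"
      unfolding bij_betw_imp_surj_on[OF rep_post_one_bij[OF j t]] using u by blast
    then obtain \<eta> where \<eta>: "gl \<eta> [] j t" "rep_post X one j t \<eta> = u"
      by blast
    show "\<exists>M \<in> ?S. fst M = t \<and> ?H M = N"
      using d \<eta> t N by (intro bexI[of _ "(t, d, \<eta>)"]) auto
  qed
qed

end
end

theorem proposition4p19:
  fixes X :: "('o, 't, 'l, 'c) equipment"
    and j :: 't and A E :: 'o
  assumes "virtual_equipment X"
    and "is_tight X j A E"
  shows "pullback_square TYPE('zo \<times> 'za)
           (RMnd X j)         (LRMnd X j)
           (tight_cat X A E)  (loose_cat X A E)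
           (RMnd_to_LRMnd X j) forget forget (tight_to_loose X E) \<and>
         fully_faithful (tight_cat X A E) (loose_cat X A E) (tight_to_loose X E) \<and>
         fully_faithful (RMnd X j) (LRMnd X j) (RMnd_to_LRMnd X j)"
proof -
  interpret virtual_equipment X by (rule assms(1))
  interpret equipment_at X E
    using tight_ends[of j] assms(2) by unfold_locales (auto simp: is_tight_def)
  show ?thesis
    using pullback[of j A] tight_to_loose_ff assms(2) by (auto simp: is_tight_def)
qed

end
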